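(* Suppose that $B\colon\Lambda\to H_\square$ satisfies Assumption 2 (stated in the context, with exponent $\gamma\in(0,1]$). Then, for every $0\le s\le t\le T$, the mapping $H\ni\phi\mapsto w^{s,\phi}_t\in\mathcal{H}$ belongs to $C^{1+\gamma}(H;\mathcal{H})$. In particular, for every $\phi,\psi\in H$, $Dw^{s,\phi}_t\psi$ is the unique solution in $\mathcal{H}$ of the equation $$Dw^{s,\phi}_t\psi=\psi+\int_s^tD\overline{B}\left(w^{s,\phi}_t\right)\left(r,Dw^{s,\phi}_t\psi\right)\mathrm{d}r .$$ Furthermore, there exists a constant $C_2=C_2(d,T)>0$ such that, for every $\phi,\psi,\eta\in H$, $\mathbb{P}$-a.s., $$\|Dw^{s,\phi}_t\eta\|_2\le C_2\|\eta\|_2,\qquad \|Dw^{s,\phi}_t\eta-Dw^{s,\psi}_t\eta\|_2\le C_2\|w^{s,\phi}_t-w^{s,\psi}_t\|_2^\gamma\,\|\eta\|_2 .$$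
   Context: Fix $T>0$, $d\in\mathbb{N}$. $(\Omega,\mathcal{F},\mathbb{P},\mathbb{F})$ is a complete filtered probability space, $\mathbb{F}=(\mathcal{F}_t)_{t\in[0,T]}$ satisfies the usual conditions, and $W$ is a standard $\mathbb{R}^d$-valued $\mathbb{F}$-Brownian motion. $k_2(t)=\frac{1}{\Gamma(\alpha)}t^{\alpha-1}$, $t>0$, for some $\alpha\in(\frac12,1)$. $H=L^2(0,T;\mathbb{R}^d)$ with norm $\|\cdot\|_2$; $\Lambda=C([0,T];\mathbb{R}^d)$; $\Lambda_2$ is the normed space $(\Lambda,\|\cdot\|_2)$; $H_\square=L^2((0,T)\times(0,T);\mathbb{R}^d)$ with norm $\|\cdot\|_{2,\square}$; $\mathcal{H}=L^2(\Omega;H)$. The map $\sigma\colon[0,T]\to\mathcal{L}(\mathbb{R}^d;H)$ is $[\sigma(t)x](\xi)=k_2(\xi-t)1_{\{t<\xi\}}x$, and $\int_s^t\sigma(r)\,\mathrm{d}W_r$ is the $H$-valued stochastic integral. Assumption 1. The function $B\colon\Lambda\to H_\square$ satisfies, for some constant $C_0=C_0(d,T)>0$ and all $w_1,w_2\in\Lambda$, $\|B(w_1)\|_{2,\square}\le C_0(1+\|w_1\|_2)$ and $\|B(w_1)-B(w_2)\|_{2,\square}\le C_0\|w_1-w_2\|_2$. Moreover, given $w\in\Lambda$ and $0<t\le T$, for a.e. $r\in(0,t)$ the function $B(w)(r,\cdot)\in H$ is of Volterra type, i.e. $B(w)(r,\xi)=0$ for a.e. $\xi\in(0,r)$, and depends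 on $w$ only via its restriction $w|_{(0,t)}$. Assumption 2. $B\colon\Lambda\to H_\square$ satisfies Assumption 1, is Fréchet differentiable as a map on $\Lambda_2$, and (with the same constant $C_0$ without loss of generality) $\|DB(w_1)(w_2)\|_{2,\square}\le C_0\|w_2\|_2$ and $\|DB(w_1)-DB(w_2)\|_{\mathcal{L}(\Lambda_2;H_\square)}\le C_0\|w_1-w_2\|_2^\gamma$ for all $w_1,w_2\in\Lambda$, for some $\gamma\in(0,1]$. $\overline{B}\colon H\to H_\square$ denotes the unique continuous map with $\overline{B}|_\Lambda=B$, and $\overline{B}(r,w)=\overline{B}(w)(r,\cdot)\in H$ for a.e. $r\in(0,T)$. Under Assumption 2, $\overline{B}$ is Fréchet differentiable on $H$; its differential $D\overline{B}\colon H\to\mathcal{L}(H;H_\square)$ is the continuous extension of $DB$, and one writes $D\overline{B}(w_1)(r,w_2)=[D\overline{B}(w_1)(w_2)](r,\cdot)\in H$. For $\phi\in H$ and $0\le s\le t\le T$, $w^{s,\phi}_t\in\mathcal{H}$ is the unique solution in $\mathcal{H}$ (which exists under Assumption 1) of $$w=\phi+\int_s^t\overline{B}(r,w)\,\mathrm{d}r+\int_s^t\sigma(r)\,\mathrm{d}W_r .$$ $Dw^{s,\phi}_t\in\mathcal{L}(H;\mathcal{H})$ denotes the Fréchet differential at $\phi$ of the map $H\ni\phi\mapsto w^{s,\phi}_t\in\mathcal{H}$. $C^{1+\gamma}(H;\mathcal{H})$ is the space of Fréchet differentiable maps $H\to\mathcal{H}$ whose differential $H\to\mathcal{L}(H;\mathcal{H})$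 is $\gamma$-Hölder continuous. Constants written $C(d,T)$ depend only on the listed quantities (and on the fixed constant $C_0=C_0(d,T)$); in particular not on $s,t,\phi,\psi,\eta$. *)

theory Defs
  imports "HOL-Probability.Probability"
begin

definition sq_integrable :: "('m::euclidean_space \<Rightarrow> 'a::euclidean_space) \<Rightarrow> bool" where
  "sq_integrable f \<longleftrightarrow> f \<in> borel_measurable lborel \<and> integrable lborel (\<lambda>x. (norm (f x))\<^sup>2)"

definition L2_rel :: "('m::euclidean_space \<Rightarrow> 'a::euclidean_space) \<Rightarrow> ('m \<Rightarrow> 'a) \<Rightarrow> bool" where
  "L2_rel f g \<longleftrightarrow> sq_integrable f \<and> sq_integrable g \<and> (AE x in lborel. f x = g x)"

lemma sq_integrable_measurable [measurable_dest]: "sq_integrable f \<Longrightarrow> f \<in> borel_measurable borel"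
  by (simp add: sq_integrable_def)

lemma sq_integrable_bound:
  assumes "sq_integrable f" "sq_integrable g" "h \<in> borel_measurable borel"
    and "\<And>x. norm (h x) \<le> a * norm (f x) + b * norm (g x)"
  shows "sq_integrable h"
proof -
  have [measurable]: "h \<in> borel_measurable borel" by fact
  have "integrable lborel (\<lambda>x. 2 * a\<^sup>2 * (norm (f x))\<^sup>2 + 2 * b\<^sup>2 * (norm (g x))\<^sup>2)"
    using assms by (auto simp: sq_integrable_def)
  note int = this
  have "(norm (h x))\<^sup>2 \<le> 2 * a\<^sup>2 * (norm (f x))\<^sup>2 + 2 * b\<^sup>2 * (norm (g x))\<^sup>2" for x
  proof -
    have "(norm (h x))\<^sup>2 \<le> (a * norm (f x) + b * norm (g x))\<^sup>2"
      using assms(4)[of x] by (intro power_mono) auto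
    also have "\<dots> \<le> 2 * a\<^sup>2 * (norm (f x))\<^sup>2 + 2 * b\<^sup>2 * (norm (g x))\<^sup>2"
      using sum_squares_bound[of "a * norm (f x)" "b * norm (g x)"]
      by (simp add: power2_sum power_mult_distrib)
    finally show ?thesis .
  qed
  then have "integrable lborel (\<lambda>x. (norm (h x))\<^sup>2)"
    by (intro Bochner_Integration.integrable_bound[OF int]) (auto intro!: AE_I2 order_trans[OF _ abs_ge_self])
  then show ?thesis by (simp add: sq_integrable_def)
qed

lemma sq_integrable_0: "sq_integrable (\<lambda>_. 0)"
  by (simp add: sq_integrable_def)

lemma sq_integrable_add:
  assumes "sq_integrable f" "sq_integrable g"
  shows "sq_integrable (\<lambda>x. f x + g x)"
  using assms by (intro sq_integrable_bound[OF assms, of _ 1 1]) (auto intro: norm_triangle_ineq dest!: sq_integrable_measurable)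

lemma sq_integrable_scaleR:
  assumes "sq_integrable f"
  shows "sq_integrable (\<lambda>x. c *\<^sub>R f x)"
  using assms by (intro sq_integrable_bound[OF assms assms, of _ "\<bar>c\<bar>" 0]) (auto dest!: sq_integrable_measurable)

lemma sq_integrable_diff:
  assumes "sq_integrable f" "sq_integrable g"
  shows "sq_integrable (\<lambda>x. f x - g x)"
  using sq_integrable_add[OF assms(1) sq_integrable_scaleR[OF assms(2), of "-1"]] by simp

lemma integrable_inner_sq_integrable:
  assumes "sq_integrable f" "sq_integrable g"
  shows "integrable lborel (\<lambda>x. f x \<bullet> g x)"
proof (rule Bochner_Integration.integrable_bound)
  show "integrable lborel (\<lambda>x. (norm (f x))\<^sup>2 + (norm (g x))\<^sup>2)"
    using assms by (auto simp: sq_integrable_def)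
  show "(\<lambda>x. f x \<bullet> g x) \<in> borel_measurable lborel"
    using assms by (auto dest!: sq_integrable_measurable)
  have "\<bar>f x \<bullet> g x\<bar> \<le> (norm (f x))\<^sup>2 + (norm (g x))\<^sup>2" for x
  proof -
    have "0 \<le> norm (f x) * norm (g x)" by simp
    then show ?thesis
      using Cauchy_Schwarz_ineq2[of "f x" "g x"] sum_squares_bound[of "norm (f x)" "norm (g x)"] by linarith
  qed
  then show "AE x in lborel. norm (f x \<bullet> g x) \<le> norm ((norm (f x))\<^sup>2 + (norm (g x))\<^sup>2)"
    by (auto intro!: AE_I2)
qed

lemma part_equivp_L2_rel: "part_equivp L2_rel"
proof (rule part_equivpI)
  show "\<exists>f. L2_rel f f"
    by (rule exI[of _ "\<lambda>_. 0"]) (simp add: L2_rel_def sq_integrable_0)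
  show "symp L2_rel"
    by (rule sympI) (auto simp: L2_rel_def elim: eventually_mono)
  show "transp L2_rel"
    by (rule transpI) (auto simp: L2_rel_def elim: eventually_elim2)
qed

text \<open>The Hilbert space \<open>L\<^sup>2(\<real>\<^sup>m; \<real>\<^sup>n)\<close> of classes of square-integrable functions modulo almost
  everywhere equality.\<close>

quotient_type (overloaded) ('m, 'a) L2 = "'m::euclidean_space \<Rightarrow> 'a::euclidean_space" / partial: L2_rel
  by (rule part_equivp_L2_rel)

instantiation L2 :: (euclidean_space, euclidean_space) real_inner
begin

lift_definition zero_L2 :: "('a, 'b) L2" is "\<lambda>_. 0"
  by (simp add: L2_rel_def sq_integrable_0)

lift_definition plus_L2 :: "('a, 'b) L2 \<Rightarrow> ('a, 'b) L2 \<Rightarrow> ('a, 'b) L2" is "\<lambda>f g x. f x + g x"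
  by (auto simp: L2_rel_def intro: sq_integrable_add)

lift_definition scaleR_L2 :: "real \<Rightarrow> ('a, 'b) L2 \<Rightarrow> ('a, 'b) L2" is "\<lambda>c f x. c *\<^sub>R f x"
  by (auto simp: L2_rel_def intro: sq_integrable_scaleR)

lift_definition uminus_L2 :: "('a, 'b) L2 \<Rightarrow> ('a, 'b) L2" is "\<lambda>f x. - f x"
  using sq_integrable_scaleR[where c = "-1"] by (auto simp: L2_rel_def)

lift_definition minus_L2 :: "('a, 'b) L2 \<Rightarrow> ('a, 'b) L2 \<Rightarrow> ('a, 'b) L2" is "\<lambda>f g x. f x - g x"
  by (auto simp: L2_rel_def intro: sq_integrable_diff)

lift_definition inner_L2 :: "('a, 'b) L2 \<Rightarrow> ('a, 'b) L2 \<Rightarrow> real" is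
  "\<lambda>f g. \<integral>x. f x \<bullet> g x \<partial>lborel"
  unfolding L2_rel_def
  by (intro integral_cong_AE) (auto dest!: sq_integrable_measurable)

definition norm_L2 :: "('a, 'b) L2 \<Rightarrow> real" where
  "norm F = sqrt (F \<bullet> (F :: ('a, 'b) L2))"

definition dist_L2 :: "('a, 'b) L2 \<Rightarrow> ('a, 'b) L2 \<Rightarrow> real" where
  "dist F G = norm (F - (G :: ('a, 'b) L2))"

definition sgn_L2 :: "('a, 'b) L2 \<Rightarrow> ('a, 'b) L2" where
  "sgn F = scaleR (inverse (norm F)) (F :: ('a, 'b) L2)"

definition uniformity_L2 :: "(('a, 'b) L2 \<times> ('a, 'b) L2) filter" where
  "uniformity = (INF e\<in>{0<..}. principal {(F, G). dist F (G :: ('a, 'b) L2) < e})"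

definition open_L2 :: "('a, 'b) L2 set \<Rightarrow> bool" where
  "open U \<longleftrightarrow> (\<forall>F\<in>U. eventually (\<lambda>(F', G). F' = F \<longrightarrow> G \<in> (U :: ('a, 'b) L2 set)) uniformity)"

instance
proof
  fix F G K :: "('a, 'b) L2" and a b :: real
  show "F + G + K = F + (G + K)"
    by transfer (simp add: L2_rel_def sq_integrable_add add.assoc)
  show "F + G = G + F"
    by transfer (simp add: L2_rel_def sq_integrable_add add.commute)
  show "0 + F = F"
    by transfer (simp add: L2_rel_def)
  show "- F + F = 0"
    by transfer (simp add: L2_rel_def sq_integrable_0)
  show "F - G = F + - G"
    by transfer (auto simp: L2_rel_def dest: sq_integrable_diff)
  show "a *\<^sub>R (F + G) = a *\<^sub>R F + a *\<^sub>R G"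
    by transfer (simp add: L2_rel_def sq_integrable_add sq_integrable_scaleR scaleR_add_right)
  show "(a + b) *\<^sub>R F = a *\<^sub>R F + b *\<^sub>R F"
    by transfer (simp add: L2_rel_def sq_integrable_add sq_integrable_scaleR scaleR_add_left)
  show "a *\<^sub>R b *\<^sub>R F = (a * b) *\<^sub>R F"
    by transfer (simp add: L2_rel_def sq_integrable_scaleR)
  show "1 *\<^sub>R F = F"
    by transfer (simp add: L2_rel_def)
  show "dist F G = norm (F - G)"
    by (fact dist_L2_def)
  show "sgn F = scaleR (inverse (norm F)) F"
    by (fact sgn_L2_def)
  show "uniformity = (INF e\<in>{0<..}. principal {(F, G). dist F (G :: ('a, 'b) L2) < e})"
    by (fact uniformity_L2_def)
  show "open U \<longleftrightarrow> (\<forall>F\<in>U. eventually (\<lambda>(F', G). F' = F \<longrightarrow> G \<in> U) uniformity)"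
    for U :: "('a, 'b) L2 set"
    by (fact open_L2_def)
  show "F \<bullet> G = G \<bullet> F"
    by transfer (simp add: inner_commute)
  show "(F + G) \<bullet> K = F \<bullet> K + G \<bullet> K"
    by transfer (simp add: L2_rel_def inner_add_left integrable_inner_sq_integrable)
  show "(a *\<^sub>R F) \<bullet> G = a * (F \<bullet> G)"
    by transfer simp
  show "0 \<le> F \<bullet> F"
    by transfer simp
  show "F \<bullet> F = 0 \<longleftrightarrow> F = 0"
  proof transfer
    fix f :: "'a \<Rightarrow> 'b" assume f: "L2_rel f f"
    then have "sq_integrable f" by (simp add: L2_rel_def)
    then have "(\<integral>x. f x \<bullet> f x \<partial>lborel) = 0 \<longleftrightarrow> (AE x in lborel. f x \<bullet> f x = 0)"
      by (intro integral_nonneg_eq_0_iff_AE integrable_inner_sq_integrable) auto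
    with f show "(\<integral>x. f x \<bullet> f x \<partial>lborel) = 0 \<longleftrightarrow> L2_rel f (\<lambda>_. 0)"
      by (simp add: L2_rel_def sq_integrable_0)
  qed
  show "norm F = sqrt (F \<bullet> (F :: ('a, 'b) L2))"
    by (fact norm_L2_def)
qed

end

text \<open>The class of \<open>f\<close>, with the junk value 0 if \<open>f\<close> is not square-integrable.\<close>

definition mk_L2 :: "('m::euclidean_space \<Rightarrow> 'a::euclidean_space) \<Rightarrow> ('m, 'a) L2" where
  "mk_L2 f = (if sq_integrable f then abs_L2 f else 0)"

lemma sq_integrable_rep_L2: "sq_integrable (rep_L2 F)"
  using Quotient3_rep_reflp[OF Quotient3_L2, of F] by (simp add: L2_rel_def)

lemma mk_L2_rep_L2 [simp]: "mk_L2 (rep_L2 F) = F"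
  using Quotient3_abs_rep[OF Quotient3_L2, of F] by (simp add: mk_L2_def sq_integrable_rep_L2)

lemma measurable_rep_L2 [measurable]: "rep_L2 F \<in> borel_measurable borel"
  by (rule sq_integrable_measurable[OF sq_integrable_rep_L2])

lemma L2_rel_self: "sq_integrable f \<Longrightarrow> L2_rel f f"
  by (simp add: L2_rel_def)

lemma mk_L2_eq_iff:
  assumes "sq_integrable f" "sq_integrable g"
  shows "mk_L2 f = mk_L2 g \<longleftrightarrow> (AE x in lborel. f x = g x)"
  using assms Quotient3_rel[OF Quotient3_L2, of f g] by (auto simp: mk_L2_def L2_rel_def)

lemma rep_mk_L2: "sq_integrable f \<Longrightarrow> AE x in lborel. rep_L2 (mk_L2 f) x = f x"
  using mk_L2_eq_iff[OF sq_integrable_rep_L2, of f "mk_L2 f"] by simp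

lemma mk_L2_0 [simp]: "mk_L2 (\<lambda>_. 0) = 0"
  by (simp add: mk_L2_def zero_L2_def sq_integrable_0)

lemma mk_L2_add: "sq_integrable f \<Longrightarrow> sq_integrable g \<Longrightarrow> mk_L2 (\<lambda>x. f x + g x) = mk_L2 f + mk_L2 g"
  by (simp add: mk_L2_def sq_integrable_add plus_L2.abs_eq L2_rel_self)

lemma mk_L2_diff: "sq_integrable f \<Longrightarrow> sq_integrable g \<Longrightarrow> mk_L2 (\<lambda>x. f x - g x) = mk_L2 f - mk_L2 g"
  by (simp add: mk_L2_def sq_integrable_diff minus_L2.abs_eq L2_rel_self)

lemma mk_L2_scaleR: "sq_integrable f \<Longrightarrow> mk_L2 (\<lambda>x. c *\<^sub>R f x) = c *\<^sub>R mk_L2 f"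
  by (simp add: mk_L2_def sq_integrable_scaleR scaleR_L2.abs_eq L2_rel_self)

lemma inner_mk_L2: "sq_integrable f \<Longrightarrow> sq_integrable g \<Longrightarrow> mk_L2 f \<bullet> mk_L2 g = (\<integral>x. f x \<bullet> g x \<partial>lborel)"
  by (simp add: mk_L2_def inner_L2.abs_eq L2_rel_self)

lemma norm_mk_L2: "sq_integrable f \<Longrightarrow> (norm (mk_L2 f))\<^sup>2 = (\<integral>x. (norm (f x))\<^sup>2 \<partial>lborel)"
  by (simp add: power2_norm_eq_inner inner_mk_L2)

lemma mk_L2_sum:
  assumes "\<And>i. i \<in> I \<Longrightarrow> sq_integrable (f i)"
  shows "sq_integrable (\<lambda>x. \<Sum>i\<in>I. f i x)" "mk_L2 (\<lambda>x. \<Sum>i\<in>I. f i x) = (\<Sum>i\<in>I. mk_L2 (f i))"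
proof -
  have "sq_integrable (\<lambda>x. \<Sum>i\<in>I. f i x) \<and> mk_L2 (\<lambda>x. \<Sum>i\<in>I. f i x) = (\<Sum>i\<in>I. mk_L2 (f i))"
    using assms by (induction I rule: infinite_finite_induct) (auto simp: sq_integrable_0 sq_integrable_add mk_L2_add)
  then show "sq_integrable (\<lambda>x. \<Sum>i\<in>I. f i x)" "mk_L2 (\<lambda>x. \<Sum>i\<in>I. f i x) = (\<Sum>i\<in>I. mk_L2 (f i))"
    by auto
qed

lemma mk_L2_tendsto:
  assumes f: "sq_integrable f" and s: "\<And>n. s n \<in> borel_measurable borel"
    and bound: "\<And>n x. norm (s n x) \<le> 2 * norm (f x)"
    and lim: "\<And>x. (\<lambda>n. s n x) \<longlonglongrightarrow> f x"
  shows "(\<lambda>n. mk_L2 (s n)) \<longlonglongrightarrow> mk_L2 f"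
proof -
  have [measurable]: "s n \<in> borel_measurable borel" "f \<in> borel_measurable borel" for n
    using s f by (auto dest: sq_integrable_measurable)
  have sn: "sq_integrable (s n)" for n
    using bound by (intro sq_integrable_bound[OF f f, of _ 2 0]) auto
  have "(\<lambda>n. \<integral>x. (norm (s n x - f x))\<^sup>2 \<partial>lborel) \<longlonglongrightarrow> (\<integral>x. 0 \<partial>(lborel::'a measure))"
  proof (rule integral_dominated_convergence)
    show "integrable lborel (\<lambda>x. 9 * (norm (f x))\<^sup>2)"
      using f by (simp add: sq_integrable_def)
    show "AE x in lborel. (\<lambda>n. (norm (s n x - f x))\<^sup>2) \<longlonglongrightarrow> 0"
    proof (intro AE_I2)
      fix x
      have "(\<lambda>n. (norm (s n x - f x))\<^sup>2) \<longlonglongrightarrow> (norm (f x - f x))\<^sup>2"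
        by (intro tendsto_intros lim)
      then show "(\<lambda>n. (norm (s n x - f x))\<^sup>2) \<longlonglongrightarrow> 0" by simp
    qed
    show "AE x in lborel. norm ((norm (s n x - f x))\<^sup>2) \<le> 9 * (norm (f x))\<^sup>2" for n
    proof (intro AE_I2)
      fix x
      have "norm (s n x - f x) \<le> 3 * norm (f x)"
        using bound[of n x] norm_triangle_ineq4[of "s n x" "f x"] by linarith
      then have "(norm (s n x - f x))\<^sup>2 \<le> (3 * norm (f x))\<^sup>2"
        by (intro power_mono) auto
      then show "norm ((norm (s n x - f x))\<^sup>2) \<le> 9 * (norm (f x))\<^sup>2"
        by (simp add: power_mult_distrib)
    qed
  qed measurable
  moreover have "(\<integral>x. (norm (s n x - f x))\<^sup>2 \<partial>lborel) = (norm (mk_L2 (s n) - mk_L2 f))\<^sup>2" for n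
    by (simp add: mk_L2_diff[symmetric] sn f norm_mk_L2 sq_integrable_diff)
  ultimately have "(\<lambda>n. (norm (mk_L2 (s n) - mk_L2 f))\<^sup>2) \<longlonglongrightarrow> 0"
    by simp
  then have "(\<lambda>n. sqrt ((norm (mk_L2 (s n) - mk_L2 f))\<^sup>2)) \<longlonglongrightarrow> sqrt 0"
    by (rule tendsto_real_sqrt)
  then have "(\<lambda>n. norm (mk_L2 (s n) - mk_L2 f)) \<longlonglongrightarrow> 0" by simp
  then show ?thesis
    by (rule LIM_zero_cancel[OF tendsto_norm_zero_cancel])
qed

lemma L2_separable: "\<exists>Q :: ('m::euclidean_space, 'a::euclidean_space) L2 set. countable Q \<and> closure Q = UNIV"
proof -
  obtain B :: "'m set set" where B: "countable B" "topological_basis B"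
    using ex_countable_basis by auto
  define G where "G = (\<lambda>\<F>. \<Inter>\<F>) ` {\<F>. finite \<F> \<and> \<F> \<subseteq> B}"
  have cG: "countable G"
    unfolding G_def by (intro countable_image countable_Collect_finite_subset B)
  have stab: "Int_stable G"
    unfolding Int_stable_def
  proof safe
    fix a b assume "a \<in> G" "b \<in> G"
    then obtain F F' where "a = \<Inter>F" "b = \<Inter>F'" "finite F" "finite F'" "F \<subseteq> B" "F' \<subseteq> B"
      by (auto simp: G_def)
    then show "a \<inter> b \<in> G" unfolding G_def
      by (intro image_eqI[of _ _ "F \<union> F'"]) auto
  qed
  have Gb: "G \<subseteq> sets borel"
  proof
    fix a assume "a \<in> G"
    then obtain F where F: "a = \<Inter>F" "finite F" "F \<subseteq> B" by (auto simp: G_def)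
    have "open a" unfolding F(1)
      using F B(2) by (intro open_Inter) (auto simp: topological_basis_open)
    then show "a \<in> sets borel" by simp
  qed
  have BG: "B \<subseteq> G"
  proof
    fix b assume "b \<in> B"
    then show "b \<in> G" unfolding G_def by (intro image_eqI[of _ _ "{b}"]) auto
  qed
  have UG: "UNIV \<in> G"
    unfolding G_def by (intro image_eqI[of _ _ "{}"]) auto
  have gen: "sets borel \<subseteq> sigma_sets UNIV G"
  proof -
    have "sets borel = sigma_sets UNIV B"
      by (subst borel_eq_countable_basis[OF B]) (rule sets_measure_of, simp)
    also have "\<dots> \<subseteq> sigma_sets UNIV G"
      by (intro sigma_sets_mono') (rule BG)
    finally show ?thesis .
  qed
  have genb: "sigma_sets UNIV G \<subseteq> sets borel"
    using sigma_algebra.sigma_sets_subset[OF sets.sigma_algebra_axioms[of borel] Gb] by simp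

  obtain C :: "'a set" where C: "countable C" "\<And>X. open X \<Longrightarrow> X \<noteq> {} \<Longrightarrow> \<exists>d\<in>C. d \<in> X"
    by (rule countable_dense_setE) blast
  define ind :: "'m set \<Rightarrow> 'a \<Rightarrow> ('m, 'a) L2" where "ind A b = mk_L2 (\<lambda>x. indicator A x *\<^sub>R b)" for A b
  define Q where "Q = (\<lambda>l. \<Sum>(q, n, E, b) \<leftarrow> l. q *\<^sub>R ind (E \<inter> cball 0 (real n)) b) `
    lists ({-1, 1::real} \<times> (UNIV::nat set) \<times> G \<times> C)"
  have cQ: "countable Q"
    unfolding Q_def by (intro countable_image countable_lists countable_SIGMA) (auto simp: cG C)
  have Q0: "0 \<in> Q"
    unfolding Q_def by (intro image_eqI[of _ _ "[]"]) auto
  have Qadd: "x + y \<in> Q" if "x \<in> Q" "y \<in> Q" for x y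
  proof -
    from that obtain l l' where "l \<in> lists ({-1, 1} \<times> UNIV \<times> G \<times> C)" "l' \<in> lists ({-1, 1} \<times> UNIV \<times> G \<times> C)"
      "x = (\<Sum>(q, n, E, b) \<leftarrow> l. q *\<^sub>R ind (E \<inter> cball 0 (real n)) b)"
      "y = (\<Sum>(q, n, E, b) \<leftarrow> l'. q *\<^sub>R ind (E \<inter> cball 0 (real n)) b)"
      unfolding Q_def by blast
    then show ?thesis unfolding Q_def
      by (intro image_eqI[of _ _ "l @ l'"]) auto
  qed
  have Qneg: "- x \<in> Q" if "x \<in> Q" for x
  proof -
    from that obtain l where l: "l \<in> lists ({-1, 1} \<times> UNIV \<times> G \<times> C)"
      and x: "x = (\<Sum>(q, n, E, b) \<leftarrow> l. q *\<^sub>R ind (E \<inter> cball 0 (real n)) b)"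
      unfolding Q_def by blast
    have "- x = (\<Sum>(q, n, E, b) \<leftarrow> map (\<lambda>(q, r). (- q, r)) l. q *\<^sub>R ind (E \<inter> cball 0 (real n)) b)"
      unfolding x by (induction l) (auto simp: case_prod_beta)
    moreover have "map (\<lambda>(q, r). (- q, r)) l \<in> lists ({-1, 1} \<times> UNIV \<times> G \<times> C)"
      using l by (induction l) auto
    ultimately show ?thesis unfolding Q_def by (rule image_eqI)
  qed
  define D where "D = closure Q"
  have D0: "0 \<in> D"
    using Q0 closure_subset by (auto simp: D_def)
  have Dlim: "x \<in> D" if "\<And>n::nat. s n \<in> D" "s \<longlonglongrightarrow> x" for s x
    using closed_sequentially[of D s x] that by (simp add: D_def)
  have Dadd: "x + y \<in> D" if xy: "x \<in> D" "y \<in> D" for x y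
  proof -
    from xy obtain s t where "\<And>n. s n \<in> Q" "s \<longlonglongrightarrow> x" "\<And>n. t n \<in> Q" "t \<longlonglongrightarrow> y"
      unfolding D_def closure_sequential by blast
    then have "(\<lambda>n. s n + t n) \<longlonglongrightarrow> x + y" "\<And>n. s n + t n \<in> Q"
      by (auto intro: tendsto_add Qadd)
    then show ?thesis
      unfolding D_def closure_sequential by (intro exI[of _ "\<lambda>n. s n + t n"]) auto
  qed
  have Dneg: "- x \<in> D" if xy: "x \<in> D" for x
  proof -
    from xy obtain s where "\<And>n. s n \<in> Q" "s \<longlonglongrightarrow> x"
      unfolding D_def closure_sequential by blast
    then have "(\<lambda>n. - s n) \<longlonglongrightarrow> - x" "\<And>n. - s n \<in> Q"
      by (auto intro: tendsto_minus Qneg)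
    then show ?thesis
      unfolding D_def closure_sequential by (intro exI[of _ "\<lambda>n. - s n"]) auto
  qed
  have Ddiff: "x - y \<in> D" if "x \<in> D" "y \<in> D" for x y
    using Dadd[OF that(1) Dneg[OF that(2)]] by simp
  have Dsum: "(\<Sum>i\<in>I. g i) \<in> D" if "\<And>i. i \<in> I \<Longrightarrow> g i \<in> D" for I :: "'a set" and g
    using that by (induction I rule: infinite_finite_induct) (auto intro: D0 Dadd)

  have sq_ind: "sq_integrable (\<lambda>x. indicator (A \<inter> cball 0 (real n)) x *\<^sub>R (b::'a))"
    if [measurable]: "A \<in> sets borel" for A :: "'m set" and n b
  proof -
    have "integrable lborel (\<lambda>x. indicator (A \<inter> cball 0 (real n)) x *\<^sub>R ((norm b)\<^sup>2))"
    proof (intro integrable_indicator)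
      have "emeasure lborel (A \<inter> cball 0 (real n)) \<le> emeasure lborel (cball (0::'m) (real n))"
        by (intro emeasure_mono) auto
      also have "\<dots> < \<infinity>" by (rule emeasure_lborel_cball_finite)
      finally show "emeasure lborel (A \<inter> cball 0 (real n)) < \<infinity>" .
    qed auto
    then have "integrable lborel (\<lambda>x. (norm (indicator (A \<inter> cball 0 (real n)) x *\<^sub>R b))\<^sup>2)"
      by (rule Bochner_Integration.integrable_bound) (auto simp: indicator_def)
    moreover have "(\<lambda>x. indicator (A \<inter> cball 0 (real n)) x *\<^sub>R b) \<in> borel_measurable lborel"
      by (intro borel_measurable_scaleR borel_measurable_indicator borel_measurable_const sets.Int) (simp_all add: that)
    ultimately show ?thesis unfolding sq_integrable_def by blast
  qed
  have ind1: "ind (A \<inter> cball 0 (real n)) b \<in> D" if A: "A \<in> sets borel" and b: "b \<in> C" for A n b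
  proof -
    have GP: "G \<subseteq> Pow UNIV" by simp
    have "A \<in> sigma_sets UNIV G" using A gen by auto
    from stab GP this show ?thesis
    proof (induction rule: sigma_sets_induct_disjoint)
      case (basic A)
      have "ind (A \<inter> cball 0 (real n)) b \<in> Q"
        unfolding Q_def using basic b by (intro image_eqI[of _ _ "[(1, n, A, b)]"]) auto
      then show ?case using closure_subset by (auto simp: D_def)
    next
      case empty
      then show ?case by (simp add: ind_def D0)
    next
      case (compl A)
      have "ind (UNIV \<inter> cball 0 (real n)) b \<in> Q"
        unfolding Q_def using b
        by (intro image_eqI[of _ _ "[(1, n, UNIV, b)]"]) (auto simp: UG)
      then have "ind (UNIV \<inter> cball 0 (real n)) b \<in> D"
        using closure_subset by (auto simp: D_def)
      then have "ind (UNIV \<inter> cball 0 (real n)) b - ind (A \<inter> cball 0 (real n)) b \<in> D"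
        using compl by (intro Ddiff) auto
      moreover have "ind (UNIV \<inter> cball 0 (real n)) b - ind (A \<inter> cball 0 (real n)) b
          = ind ((UNIV - A) \<inter> cball 0 (real n)) b"
      proof -
        have Ab: "A \<in> sets borel" using compl genb by auto
        have "(\<lambda>x. indicator (UNIV \<inter> cball 0 (real n)) x *\<^sub>R b - indicator (A \<inter> cball 0 (real n)) x *\<^sub>R b)
          = (\<lambda>x. indicator ((UNIV - A) \<inter> cball 0 (real n)) x *\<^sub>R b)"
          by (auto simp: indicator_def)
        then show ?thesis
          unfolding ind_def using mk_L2_diff[OF sq_ind[of UNIV n b] sq_ind[OF Ab, of n b]] by simp
      qed
      ultimately show ?case by simp
    next
      case (union A)
      have Ab: "A i \<in> sets borel" for i using union genb by auto
      have part: "ind ((\<Union>i<k. A i) \<inter> cball 0 (real n)) b \<in> D" for k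
      proof (induction k)
        case 0
        then show ?case by (simp add: ind_def D0)
      next
        case (Suc k)
        have "A k \<inter> (\<Union>i<k. A i) = {}"
        proof -
          have "A k \<inter> A i = {}" if "i < k" for i
            using union(1) that unfolding disjoint_family_on_def by (metis UNIV_I less_irrefl)
          then show ?thesis by blast
        qed
        then have "(\<lambda>x. indicator ((\<Union>i<Suc k. A i) \<inter> cball 0 (real n)) x *\<^sub>R b)
          = (\<lambda>x. indicator ((\<Union>i<k. A i) \<inter> cball 0 (real n)) x *\<^sub>R b + indicator (A k \<inter> cball 0 (real n)) x *\<^sub>R b)"
          by (auto simp: fun_eq_iff indicator_def less_Suc_eq)
        then have "ind ((\<Union>i<Suc k. A i) \<inter> cball 0 (real n)) b
          = ind ((\<Union>i<k. A i) \<inter> cball 0 (real n)) b + ind (A k \<inter> cball 0 (real n)) b"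
          unfolding ind_def using Ab by (simp add: mk_L2_add sq_ind)
        then show ?case using Suc union(3) by (auto intro: Dadd)
      qed
      have "(\<lambda>k. ind ((\<Union>i<k. A i) \<inter> cball 0 (real n)) b) \<longlonglongrightarrow> ind ((\<Union>i. A i) \<inter> cball 0 (real n)) b"
        unfolding ind_def
      proof (rule mk_L2_tendsto)
        show "sq_integrable (\<lambda>x. indicator ((\<Union>i. A i) \<inter> cball 0 (real n)) x *\<^sub>R b)"
          using Ab by (intro sq_ind) auto
        show "(\<lambda>x. indicator ((\<Union>i<k. A i) \<inter> cball 0 (real n)) x *\<^sub>R b) \<in> borel_measurable borel" for k
          using Ab by (auto intro!: sq_integrable_measurable sq_ind)
        show "norm (indicator ((\<Union>i<k. A i) \<inter> cball 0 (real n)) x *\<^sub>R b)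
          \<le> 2 * norm (indicator ((\<Union>i. A i) \<inter> cball 0 (real n)) x *\<^sub>R b)" for k x
          by (auto simp: indicator_def)
        show "(\<lambda>k. indicator ((\<Union>i<k. A i) \<inter> cball 0 (real n)) x *\<^sub>R b)
          \<longlonglongrightarrow> indicator ((\<Union>i. A i) \<inter> cball 0 (real n)) x *\<^sub>R b" for x
        proof (cases "x \<in> (\<Union>i. A i)")
          case True
          then obtain i where "x \<in> A i" by auto
          then have "eventually (\<lambda>k. indicator ((\<Union>i<k. A i) \<inter> cball 0 (real n)) x *\<^sub>R b
              = indicator ((\<Union>i. A i) \<inter> cball 0 (real n)) x *\<^sub>R b) sequentially"
            by (intro eventually_mono[OF eventually_gt_at_top[of i]]) (auto simp: indicator_def)
          then show ?thesis by (rule tendsto_eventually)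
        next
          case False
          then show ?thesis by (intro tendsto_eventually always_eventually) (auto simp: indicator_def)
        qed
      qed
      with part show ?case by (rule Dlim)
    qed
  qed
  have ind2: "ind (A \<inter> cball 0 (real n)) b \<in> D" if A: "A \<in> sets borel" for A n b
  proof (cases "b = 0")
    case True
    then show ?thesis by (simp add: ind_def D0)
  next
    case False
    have "\<exists>c\<in>C. c \<in> ball b (min (norm b) (1 / Suc k))" for k
    proof -
      have "0 < min (norm b) (1 / real (Suc k))" using False by simp
      then have "b \<in> ball b (min (norm b) (1 / real (Suc k)))" by simp
      then show ?thesis by (intro C(2)) blast+
    qed
    then obtain c where c: "\<And>k. c k \<in> C" "\<And>k. c k \<in> ball b (min (norm b) (1 / Suc k))" by metis
    have lim: "c \<longlonglongrightarrow> b"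
    proof (rule metric_tendsto_imp_tendsto)
      show "(\<lambda>k. 1 / real (Suc k)) \<longlonglongrightarrow> 0" by real_asymp
      show "\<forall>\<^sub>F k in sequentially. dist (c k) b \<le> dist (1 / real (Suc k)) 0"
        using c(2) by (intro always_eventually) (auto simp: dist_commute less_imp_le)
    qed
    have le: "norm (c k) \<le> 2 * norm b" for k
      using c(2)[of k] norm_triangle_ineq2[of "c k" b] by (auto simp: dist_norm norm_minus_commute)
    have "(\<lambda>k. ind (A \<inter> cball 0 (real n)) (c k)) \<longlonglongrightarrow> ind (A \<inter> cball 0 (real n)) b"
      unfolding ind_def using A le lim
      by (intro mk_L2_tendsto sq_ind sq_integrable_measurable tendsto_intros) (auto simp: indicator_def)
    with ind1[OF A c(1)] show ?thesis by (rule Dlim)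
  qed
  have ind3: "mk_L2 (\<lambda>x. indicator A x *\<^sub>R b) \<in> D"
    if A: "A \<in> sets borel" and sq: "sq_integrable (\<lambda>x. indicator A x *\<^sub>R b)" for A b
  proof -
    have "(\<lambda>n. ind (A \<inter> cball 0 (real n)) b) \<longlonglongrightarrow> mk_L2 (\<lambda>x. indicator A x *\<^sub>R b)"
      unfolding ind_def
    proof (rule mk_L2_tendsto[OF sq])
      show "(\<lambda>x. indicator (A \<inter> cball 0 (real n)) x *\<^sub>R b) \<in> borel_measurable borel" for n
        using A by (intro sq_integrable_measurable sq_ind)
      show "norm (indicator (A \<inter> cball 0 (real n)) x *\<^sub>R b) \<le> 2 * norm (indicator A x *\<^sub>R b)" for n x
        by (auto simp: indicator_def)
      show "(\<lambda>n. indicator (A \<inter> cball 0 (real n)) x *\<^sub>R b) \<longlonglongrightarrow> indicator A x *\<^sub>R b" for x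
      proof (rule tendsto_eventually, rule eventually_mono[OF eventually_ge_at_top[of "nat \<lceil>norm x\<rceil>"]])
        fix n assume "nat \<lceil>norm x\<rceil> \<le> n"
        then have "norm x \<le> real n" by linarith
        then show "indicator (A \<inter> cball 0 (real n)) x *\<^sub>R b = indicator A x *\<^sub>R b"
          by (auto simp: indicator_def)
      qed
    qed
    with ind2[OF A] show ?thesis by (rule Dlim)
  qed
  have simple: "mk_L2 s \<in> D" if s: "simple_function lborel s" "sq_integrable s" for s :: "'m \<Rightarrow> 'a"
  proof -
    have fin: "finite (range s)" and meas: "s -` {y} \<in> sets borel" for y
      using s(1) simple_functionD(2)[OF s(1), of "{y}"] by (auto dest: simple_functionD)
    have sq: "sq_integrable (\<lambda>x. indicator (s -` {y}) x *\<^sub>R y)" for y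
    proof (rule sq_integrable_bound[OF s(2) s(2), of _ 1 0])
      show "(\<lambda>x. indicator (s -` {y}) x *\<^sub>R y) \<in> borel_measurable borel"
        by (intro borel_measurable_scaleR borel_measurable_indicator borel_measurable_const meas)
      show "norm (indicator (s -` {y}) x *\<^sub>R y) \<le> 1 * norm (s x) + 0 * norm (s x)" for x
        by (auto simp: indicator_def)
    qed
    have "s = (\<lambda>x. \<Sum>y\<in>range s. indicator (s -` {y}) x *\<^sub>R y)"
    proof
      fix x
      have "(\<Sum>y\<in>range s. indicator (s -` {y}) x *\<^sub>R y) = (\<Sum>y\<in>range s. if y = s x then y else 0)"
        by (intro sum.cong) (auto simp: indicator_def)
      also have "\<dots> = s x" using fin by (simp add: sum.delta)
      finally show "s x = (\<Sum>y\<in>range s. indicator (s -` {y}) x *\<^sub>R y)" by simp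
    qed
    then have "mk_L2 s = (\<Sum>y\<in>range s. mk_L2 (\<lambda>x. indicator (s -` {y}) x *\<^sub>R y))"
      using mk_L2_sum(2)[of "range s" "\<lambda>y x. indicator (s -` {y}) x *\<^sub>R y", OF sq] by simp
    also have "\<dots> \<in> D"
      by (intro Dsum ind3 meas sq)
    finally show ?thesis .
  qed
  have "F \<in> D" for F
  proof -
    let ?f = "rep_L2 F"
    obtain s where s: "\<And>i. simple_function lborel (s i)" "\<And>x. (\<lambda>i. s i x) \<longlonglongrightarrow> ?f x"
      "\<And>i x. norm (s i x) \<le> 2 * norm (?f x)"
      using borel_measurable_implies_sequence_metric[of ?f lborel 0] by auto
    have sm: "s i \<in> borel_measurable borel" for i
      using borel_measurable_simple_function[OF s(1), of i] by simp
    have "sq_integrable (s i)" for i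
      using s sm by (intro sq_integrable_bound[OF sq_integrable_rep_L2[of F] sq_integrable_rep_L2[of F], of _ 2 0]) auto
    then have "mk_L2 (s i) \<in> D" for i using simple s by auto
    moreover have "(\<lambda>i. mk_L2 (s i)) \<longlonglongrightarrow> mk_L2 ?f"
      using s sm by (intro mk_L2_tendsto sq_integrable_rep_L2)
    ultimately have "mk_L2 ?f \<in> D" by (rule Dlim)
    then show ?thesis by simp
  qed
  then have "closure Q = UNIV" by (auto simp: D_def)
  with cQ show ?thesis by blast
qed

instance L2 :: (euclidean_space, euclidean_space) second_countable_topology
proof
  obtain Q :: "('a, 'b) L2 set" where Q: "countable Q" "closure Q = UNIV"
    using L2_separable by blast
  define \<B> where "\<B> = (\<lambda>(q, n). ball q (1 / real (Suc n))) ` (Q \<times> UNIV)"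
  have "topological_basis \<B>"
  proof (rule topological_basisI)
    show "open U" if "U \<in> \<B>" for U using that by (auto simp: \<B>_def)
    fix U and x :: "('a, 'b) L2" assume "open U" "x \<in> U"
    then obtain e where e: "e > 0" "ball x e \<subseteq> U" by (auto simp: open_contains_ball)
    then obtain n where n: "1 / real (Suc n) < e / 2"
      using nat_approx_posE[of "e / 2"] by auto
    have "x \<in> closure Q" using Q by simp
    then obtain q where q: "q \<in> Q" "dist q x < 1 / real (Suc n)"
      unfolding closure_approachable by (metis of_nat_0_less_iff zero_less_Suc zero_less_divide_1_iff)
    have "ball q (1 / real (Suc n)) \<subseteq> ball x e"
    proof
      fix y assume "y \<in> ball q (1 / real (Suc n))"
      then have "dist x y < e"
        using dist_triangle[of x y q] q n by (simp add: dist_commute)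
      then show "y \<in> ball x e" by simp
    qed
    with q e show "\<exists>B'\<in>\<B>. x \<in> B' \<and> B' \<subseteq> U"
      by (intro bexI[of _ "ball q (1 / real (Suc n))"]) (auto simp: \<B>_def)
  qed
  moreover have "countable \<B>" using Q by (auto simp: \<B>_def)
  ultimately show "\<exists>B :: ('a, 'b) L2 set set. countable B \<and> open = generate_topology B"
    by (intro exI[of _ \<B>] conjI topological_basis_imp_subbasis)
qed

instance L2 :: (euclidean_space, euclidean_space) complete_space
proof
  fix X :: "nat \<Rightarrow> ('a, 'b) L2" assume X: "Cauchy X"
  have "\<exists>N. \<forall>m\<ge>N. \<forall>n\<ge>N. dist (X m) (X n) < (1/2) ^ k" for k
    using X by (auto simp: Cauchy_def)
  then obtain N where N: "\<And>k m n. m \<ge> N k \<Longrightarrow> n \<ge> N k \<Longrightarrow> dist (X m) (X n) < (1/2) ^ k"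
    by metis
  define r where "r k = (\<Sum>i\<le>k. Suc (N i))" for k
  have rN: "N k \<le> r m" if "k \<le> m" for k m
  proof -
    have "Suc (N k) \<le> r m" unfolding r_def by (rule member_le_sum) (use that in auto)
    then show ?thesis by simp
  qed
  have r: "strict_mono r" by (intro strict_monoI_Suc) (simp add: r_def)
  define f where "f k = rep_L2 (X (r k))" for k
  have f: "sq_integrable (f k)" "mk_L2 (f k) = X (r k)" for k
    by (simp_all add: f_def sq_integrable_rep_L2)
  have [measurable]: "f k \<in> borel_measurable borel" for k
    by (rule sq_integrable_measurable[OF f(1)])
  have diff: "(\<integral>\<^sup>+x. ennreal ((norm (f m x - f n x))\<^sup>2) \<partial>lborel) \<le> ennreal (((1/2) ^ k)\<^sup>2)" if "k \<le> m" "k \<le> n" for k m n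
  proof -
    have sq: "sq_integrable (\<lambda>x. f m x - f n x)" by (intro sq_integrable_diff f)
    have "(\<integral>\<^sup>+x. ennreal ((norm (f m x - f n x))\<^sup>2) \<partial>lborel) = ennreal (\<integral>x. (norm (f m x - f n x))\<^sup>2 \<partial>lborel)"
      using sq by (intro nn_integral_eq_integral) (auto simp: sq_integrable_def)
    also have "(\<integral>x. (norm (f m x - f n x))\<^sup>2 \<partial>lborel) = (dist (X (r m)) (X (r n)))\<^sup>2"
      using sq by (simp add: norm_mk_L2[symmetric] mk_L2_diff f dist_norm)
    also have "ennreal \<dots> \<le> ennreal (((1/2) ^ k)\<^sup>2)"
      using N[of k "r m" "r n"] rN[of k m] rN[of k n] that by (intro ennreal_leI power_mono) auto
    finally show ?thesis .
  qed
  have "(\<integral>\<^sup>+x. (\<Sum>k. ennreal (2 ^ k * (norm (f (Suc k) x - f k x))\<^sup>2)) \<partial>lborel)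
      = (\<Sum>k. \<integral>\<^sup>+x. ennreal (2 ^ k * (norm (f (Suc k) x - f k x))\<^sup>2) \<partial>lborel)"
    by (intro nn_integral_suminf) measurable
  also have "\<dots> \<le> (\<Sum>k. ennreal ((1/2) ^ k))"
  proof (intro suminf_le summableI)
    fix k
    have "(\<integral>\<^sup>+x. ennreal (2 ^ k * (norm (f (Suc k) x - f k x))\<^sup>2) \<partial>lborel)
        = ennreal (2 ^ k) * (\<integral>\<^sup>+x. ennreal ((norm (f (Suc k) x - f k x))\<^sup>2) \<partial>lborel)"
      by (simp add: ennreal_mult nn_integral_cmult)
    also have "\<dots> \<le> ennreal (2 ^ k) * ennreal (((1/2) ^ k)\<^sup>2)"
      by (intro mult_left_mono diff) auto
    also have "\<dots> = ennreal (2 ^ k * ((1/2) ^ k)\<^sup>2)" by (simp add: ennreal_mult)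
    also have "2 ^ k * ((1/2) ^ k)\<^sup>2 = (1/2 :: real) ^ k"
      by (simp add: power2_eq_square power_mult_distrib[symmetric] mult.assoc[symmetric])
    finally show "(\<integral>\<^sup>+x. ennreal (2 ^ k * (norm (f (Suc k) x - f k x))\<^sup>2) \<partial>lborel) \<le> ennreal ((1/2) ^ k)" .
  qed
  also have "\<dots> = ennreal (\<Sum>k. (1/2) ^ k)"
    by (intro suminf_ennreal2) (auto intro: summable_geometric)
  finally have "(\<integral>\<^sup>+x. (\<Sum>k. ennreal (2 ^ k * (norm (f (Suc k) x - f k x))\<^sup>2)) \<partial>lborel) \<noteq> \<infinity>"
    by (auto simp: top_unique)
  then have "AE x in lborel. (\<Sum>k. ennreal (2 ^ k * (norm (f (Suc k) x - f k x))\<^sup>2)) \<noteq> \<infinity>"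
    by (intro nn_integral_PInf_AE) measurable
  then have conv: "AE x in lborel. convergent (\<lambda>k. f k x)"
  proof eventually_elim
    fix x assume "(\<Sum>k. ennreal (2 ^ k * (norm (f (Suc k) x - f k x))\<^sup>2)) \<noteq> \<infinity>"
    then have 1: "summable (\<lambda>k. 2 ^ k * (norm (f (Suc k) x - f k x))\<^sup>2)"
      by (intro summable_suminf_not_top) auto
    have "summable (\<lambda>k. (1/2 :: real) ^ k + 2 ^ k * (norm (f (Suc k) x - f k x))\<^sup>2)"
      by (intro summable_add 1 summable_geometric) auto
    then have "summable (\<lambda>k. f (Suc k) x - f k x)"
    proof (rule summable_comparison_test'[where N = 0])
      fix k
      let ?h = "norm (f (Suc k) x - f k x)"
      have "2 * ?h \<le> (1/2 :: real) ^ k + 2 ^ k * ?h\<^sup>2"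
      proof -
        have "0 \<le> (1/2 :: real) ^ k * (1 - 2 ^ k * ?h)\<^sup>2" by simp
        also have "\<dots> = (1/2) ^ k - 2 * ?h * ((1/2) ^ k * 2 ^ k) + ((1/2) ^ k * 2 ^ k) * 2 ^ k * ?h\<^sup>2"
          by (simp add: power2_eq_square algebra_simps)
        also have "(1/2 :: real) ^ k * 2 ^ k = 1" by (simp add: power_mult_distrib[symmetric])
        finally show ?thesis by simp
      qed
      then show "?h \<le> (1/2 :: real) ^ k + 2 ^ k * ?h\<^sup>2"
        using norm_ge_zero[of "f (Suc k) x - f k x"] by linarith
    qed
    then have "convergent (\<lambda>n. \<Sum>k<n. f (Suc k) x - f k x)"
      by (simp add: summable_iff_convergent)
    then have "convergent (\<lambda>n. f 0 x + (\<Sum>k<n. f (Suc k) x - f k x))"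
      by (intro convergent_add convergent_const)
    then show "convergent (\<lambda>k. f k x)"
      by (simp add: sum_lessThan_telescope[where f = "\<lambda>k. f k x"])
  qed
  define g where "g x = lim (\<lambda>k. f k x)" for x
  have [measurable]: "g \<in> borel_measurable borel"
    unfolding g_def by measurable
  have lim: "AE x in lborel. (\<lambda>k. f k x) \<longlonglongrightarrow> g x"
    using conv by eventually_elim (simp add: g_def convergent_LIMSEQ_iff)
  have fatou: "(\<integral>\<^sup>+x. ennreal ((norm (g x - f k x))\<^sup>2) \<partial>lborel) \<le> ennreal (((1/2) ^ k)\<^sup>2)" for k
  proof -
    have "(\<integral>\<^sup>+x. ennreal ((norm (g x - f k x))\<^sup>2) \<partial>lborel)
        = (\<integral>\<^sup>+x. liminf (\<lambda>m. ennreal ((norm (f m x - f k x))\<^sup>2)) \<partial>lborel)"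
    proof (intro nn_integral_cong_AE)
      show "AE x in lborel. ennreal ((norm (g x - f k x))\<^sup>2) = liminf (\<lambda>m. ennreal ((norm (f m x - f k x))\<^sup>2))"
        using lim
      proof eventually_elim
        fix x assume "(\<lambda>k. f k x) \<longlonglongrightarrow> g x"
        then have "(\<lambda>m. ennreal ((norm (f m x - f k x))\<^sup>2)) \<longlonglongrightarrow> ennreal ((norm (g x - f k x))\<^sup>2)"
          by (intro tendsto_ennrealI tendsto_intros)
        then show "ennreal ((norm (g x - f k x))\<^sup>2) = liminf (\<lambda>m. ennreal ((norm (f m x - f k x))\<^sup>2))"
          by (intro lim_imp_Liminf[symmetric]) auto
      qed
    qed
    also have "\<dots> \<le> liminf (\<lambda>m. \<integral>\<^sup>+x. ennreal ((norm (f m x - f k x))\<^sup>2) \<partial>lborel)"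
      by (intro nn_integral_liminf) measurable
    also have "\<dots> \<le> limsup (\<lambda>m. \<integral>\<^sup>+x. ennreal ((norm (f m x - f k x))\<^sup>2) \<partial>lborel)"
      by (intro Liminf_le_Limsup) auto
    also have "\<dots> \<le> ennreal (((1/2) ^ k)\<^sup>2)"
      by (intro Limsup_bounded eventually_mono[OF eventually_ge_at_top[of k]] diff) auto
    finally show ?thesis .
  qed
  have gf: "sq_integrable (\<lambda>x. g x - f k x)" for k
    unfolding sq_integrable_def
  proof
    have "(\<integral>\<^sup>+x. ennreal (norm ((norm (g x - f k x))\<^sup>2)) \<partial>lborel) < \<infinity>"
      using fatou[of k] by (auto simp: less_top[symmetric] top_unique)
    then show "integrable lborel (\<lambda>x. (norm (g x - f k x))\<^sup>2)"
      by (intro integrableI_bounded) measurable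
  qed measurable
  have g: "sq_integrable g"
    using sq_integrable_add[OF gf[of 0] f(1)[of 0]] by simp
  have "dist (X (r k)) (mk_L2 g) \<le> (1/2) ^ k" for k
  proof -
    have "ennreal ((norm (mk_L2 g - X (r k)))\<^sup>2) = ennreal (\<integral>x. (norm (g x - f k x))\<^sup>2 \<partial>lborel)"
      using norm_mk_L2[OF gf[of k]] by (simp add: mk_L2_diff g f)
    also have "\<dots> = (\<integral>\<^sup>+x. ennreal ((norm (g x - f k x))\<^sup>2) \<partial>lborel)"
      using gf[of k] by (intro nn_integral_eq_integral[symmetric]) (auto simp: sq_integrable_def)
    also note fatou[of k]
    finally have "(norm (mk_L2 g - X (r k)))\<^sup>2 \<le> ((1/2) ^ k)\<^sup>2" by simp
    then have "norm (mk_L2 g - X (r k)) \<le> (1/2) ^ k" by (rule power2_le_imp_le) simp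
    then show ?thesis by (simp add: dist_norm norm_minus_commute)
  qed
  then have "(\<lambda>k. X (r k)) \<longlonglongrightarrow> mk_L2 g"
    by (intro metric_tendsto_imp_tendsto[OF LIMSEQ_power_zero[of "1/2 :: real"]] always_eventually) auto
  with X r have "X \<longlonglongrightarrow> mk_L2 g"
    using Cauchy_converges_subseq[of X r "mk_L2 g"] by (auto simp: o_def)
  then show "convergent X" by (auto simp: convergent_def)
qed

text \<open>\<open>L\<^sup>2(S)\<close> is realised as the closed subspace of those classes that vanish outside \<open>S\<close>.\<close>

definition L2_on :: "'m::euclidean_space set \<Rightarrow> ('m, 'a::euclidean_space) L2 set" where
  "L2_on S = {F. AE x in lborel. x \<notin> S \<longrightarrow> rep_L2 F x = 0}"

abbreviation H_space :: "real \<Rightarrow> (real, real^'d::finite) L2 set" where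
  "H_space T \<equiv> L2_on {0<..<T}"

abbreviation Hsq_space :: "real \<Rightarrow> (real \<times> real, real^'d::finite) L2 set" where
  "Hsq_space T \<equiv> L2_on ({0<..<T} \<times> {0<..<T})"

text \<open>The space \<open>C([0,T]; \<real>\<^sup>d)\<close> with the \<open>L\<^sup>2\<close> norm, as a linear subspace of \<open>H_space T\<close>; passing to
  classes is injective on continuous functions.\<close>

definition Lambda_space :: "real \<Rightarrow> (real, real^'d::finite) L2 set" where
  "Lambda_space T = {mk_L2 (\<lambda>\<xi>. indicator {0..T} \<xi> *\<^sub>R w \<xi>) | w. continuous_on {0..T} w}"

text \<open>The section \<open>F(r,\<cdot>)\<close>; by Fubini it is well defined and square-integrable for almost every \<open>r\<close>.\<close>

definition L2_section :: "(real \<times> real, 'a::euclidean_space) L2 \<Rightarrow> real \<Rightarrow> (real, 'a) L2" where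
  "L2_section F r = mk_L2 (\<lambda>\<xi>. rep_L2 F (r, \<xi>))"

definition agree_on :: "real set \<Rightarrow> (real, 'a::euclidean_space) L2 \<Rightarrow> (real, 'a) L2 \<Rightarrow> bool" where
  "agree_on S u v \<longleftrightarrow> (AE \<xi> in lborel. \<xi> \<in> S \<longrightarrow> rep_L2 u \<xi> = rep_L2 v \<xi>)"

definition volterra_drift ::
  "real \<Rightarrow> real \<Rightarrow> ((real, real^'d::finite) L2 \<Rightarrow> (real \<times> real, real^'d) L2) \<Rightarrow> bool" where
  "volterra_drift T C0 B \<longleftrightarrow>
     (\<forall>w\<in>Lambda_space T. B w \<in> Hsq_space T) \<and>
     (\<forall>w\<in>Lambda_space T. norm (B w) \<le> C0 * (1 + norm w)) \<and>
     (\<forall>w1\<in>Lambda_space T. \<forall>w2\<in>Lambda_space T. norm (B w1 - B w2) \<le> C0 * norm (w1 - w2)) \<and>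
     (\<forall>w\<in>Lambda_space T. \<forall>t. 0 < t \<and> t \<le> T \<longrightarrow>
        (AE r in lborel. r \<in> {0<..<t} \<longrightarrow> agree_on {0<..<r} (L2_section (B w) r) 0)) \<and>
     (\<forall>w1\<in>Lambda_space T. \<forall>w2\<in>Lambda_space T. \<forall>t. 0 < t \<and> t \<le> T \<and> agree_on {0<..<t} w1 w2 \<longrightarrow>
        (AE r in lborel. r \<in> {0<..<t} \<longrightarrow> L2_section (B w1) r = L2_section (B w2) r))"

text \<open>Derivatives within \<open>Lambda_space T\<close> are determined only on \<open>Lambda_space T\<close>, so they are only ever
  evaluated there. A bounded operator from this subspace to a Hilbert space always extends to a bounded
  operator on the ambient space, so \<open>differentiable\<close> is Frechet differentiability on the subspace.\<close>

abbreviation D_Lambda ::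
  "real \<Rightarrow> ((real, real^'d::finite) L2 \<Rightarrow> (real \<times> real, real^'d) L2) \<Rightarrow>
    (real, real^'d) L2 \<Rightarrow> (real, real^'d) L2 \<Rightarrow> (real \<times> real, real^'d) L2" where
  "D_Lambda T B w \<equiv> frechet_derivative B (at w within Lambda_space T)"

definition smooth_volterra_drift ::
  "real \<Rightarrow> real \<Rightarrow> real \<Rightarrow> ((real, real^'d::finite) L2 \<Rightarrow> (real \<times> real, real^'d) L2) \<Rightarrow> bool" where
  "smooth_volterra_drift T C0 \<gamma> B \<longleftrightarrow>
     volterra_drift T C0 B \<and>
     (\<forall>w\<in>Lambda_space T. B differentiable (at w within Lambda_space T)) \<and>
     (\<forall>w1\<in>Lambda_space T. \<forall>w2\<in>Lambda_space T. norm (D_Lambda T B w1 w2) \<le> C0 * norm w2) \<and>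
     (\<forall>w1\<in>Lambda_space T. \<forall>w2\<in>Lambda_space T. \<forall>h\<in>Lambda_space T.
        norm (D_Lambda T B w1 h - D_Lambda T B w2 h) \<le> C0 * norm (w1 - w2) powr \<gamma> * norm h)"

text \<open>The continuous extension of \<open>B\<close> to \<open>H_space T\<close>; unique on that set because \<open>Lambda_space T\<close> is
  dense in it.\<close>

definition Bbar ::
  "real \<Rightarrow> ((real, real^'d::finite) L2 \<Rightarrow> (real \<times> real, real^'d) L2) \<Rightarrow>
    (real, real^'d) L2 \<Rightarrow> (real \<times> real, real^'d) L2" where
  "Bbar T B = (SOME G. continuous_on (H_space T) G \<and> (\<forall>w\<in>Lambda_space T. G w = B w))"

definition DBbar ::
  "real \<Rightarrow> ((real, real^'d::finite) L2 \<Rightarrow> (real \<times> real, real^'d) L2) \<Rightarrow>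
    (real, real^'d) L2 \<Rightarrow> (real, real^'d) L2 \<Rightarrow> (real \<times> real, real^'d) L2" where
  "DBbar T B w = frechet_derivative (Bbar T B) (at w within H_space T)"

definition filtered_prob_space :: "real \<Rightarrow> 'w measure \<Rightarrow> (real \<Rightarrow> 'w measure) \<Rightarrow> bool" where
  "filtered_prob_space T M F \<longleftrightarrow>
     prob_space M \<and> complete_measure M \<and>
     (\<forall>t\<in>{0..T}. subalgebra M (F t)) \<and>
     (\<forall>s t. 0 \<le> s \<and> s \<le> t \<and> t \<le> T \<longrightarrow> sets (F s) \<subseteq> sets (F t)) \<and>
     null_sets M \<subseteq> sets (F 0) \<and>
     (\<forall>t\<in>{0..<T}. sets (F t) = (\<Inter>u\<in>{t<..T}. sets (F u)))"

definition brownian_motion ::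
  "real \<Rightarrow> 'w measure \<Rightarrow> (real \<Rightarrow> 'w measure) \<Rightarrow> (real \<Rightarrow> 'w \<Rightarrow> real^'d::finite) \<Rightarrow> bool" where
  "brownian_motion T M F W \<longleftrightarrow>
     (\<forall>t\<in>{0..T}. W t \<in> borel_measurable (F t)) \<and>
     (AE \<omega> in M. W 0 \<omega> = 0) \<and>
     (AE \<omega> in M. continuous_on {0..T} (\<lambda>t. W t \<omega>)) \<and>
     (\<forall>s t. 0 \<le> s \<and> s < t \<and> t \<le> T \<longrightarrow>
        distributed M lborel (\<lambda>\<omega>. W t \<omega> - W s \<omega>)
          (\<lambda>x. ennreal (\<Prod>i\<in>UNIV. normal_density 0 (sqrt (t - s)) (x $ i))) \<and>
        prob_space.indep_set M (sets (F s))
          (sets (vimage_algebra (space M) (\<lambda>\<omega>. W t \<omega> - W s \<omega>) borel)))"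

text \<open>Square-integrable random variables with values in a closed subspace \<open>K\<close>, as functions; equality in
  \<open>L\<^sup>2(\<Omega>; K)\<close> is almost sure equality.\<close>

definition rv_L2 :: "'w measure \<Rightarrow> 'h set \<Rightarrow> ('w \<Rightarrow> 'h::real_normed_vector) set" where
  "rv_L2 M K = {X \<in> borel_measurable M. (\<forall>\<omega>\<in>space M. X \<omega> \<in> K) \<and> integrable M (\<lambda>\<omega>. (norm (X \<omega>))\<^sup>2)}"

definition rv_norm :: "'w measure \<Rightarrow> ('w \<Rightarrow> 'h::real_normed_vector) \<Rightarrow> real" where
  "rv_norm M X = sqrt (\<integral>\<omega>. (norm (X \<omega>))\<^sup>2 \<partial>M)"

text \<open>A list of triples \<open>(a, b, A)\<close> stands for the deterministic elementary integrand
  \<open>\<Sum> 1\<^bsub>(a,b]\<^esub> A\<close> with operators \<open>A\<close> from \<open>\<real>\<^sup>d\<close> to \<open>K\<close>. For a deterministic square-integrable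
  \<open>\<Phi>\<close>, the Ito integral is the \<open>L\<^sup>2(\<Omega>; K)\<close> limit of the elementary integrals along any sequence of such
  integrands converging to \<open>\<Phi>\<close> in \<open>L\<^sup>2(s,t)\<close> with respect to the Hilbert-Schmidt norm.\<close>

type_synonym ('d, 'h) elementary = "(real \<times> real \<times> (real^'d \<Rightarrow> 'h)) list"

definition elementary_on :: "'h::real_normed_vector set \<Rightarrow> real \<Rightarrow> real \<Rightarrow> ('d::finite, 'h) elementary \<Rightarrow> bool" where
  "elementary_on K s t l \<longleftrightarrow>
     (\<forall>(a, b, A)\<in>set l. s \<le> a \<and> a \<le> b \<and> b \<le> t \<and> linear A \<and> range A \<subseteq> K)"

definition elementary_fun :: "('d::finite, 'h::real_normed_vector) elementary \<Rightarrow> real \<Rightarrow> real^'d \<Rightarrow> 'h" where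
  "elementary_fun l r x = (\<Sum>(a, b, A)\<leftarrow>l. indicator {a<..b} r *\<^sub>R A x)"

definition elementary_int ::
  "(real \<Rightarrow> 'w \<Rightarrow> real^'d::finite) \<Rightarrow> ('d, 'h::real_normed_vector) elementary \<Rightarrow> 'w \<Rightarrow> 'h" where
  "elementary_int W l \<omega> = (\<Sum>(a, b, A)\<leftarrow>l. A (W b \<omega> - W a \<omega>))"

definition is_stoch_integral ::
  "'w measure \<Rightarrow> (real \<Rightarrow> 'w \<Rightarrow> real^'d::finite) \<Rightarrow> 'h set \<Rightarrow> real \<Rightarrow> real \<Rightarrow>
    (real \<Rightarrow> real^'d \<Rightarrow> 'h::real_normed_vector) \<Rightarrow> ('w \<Rightarrow> 'h) \<Rightarrow> bool" where
  "is_stoch_integral M W K s t \<Phi> I \<longleftrightarrow>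
     I \<in> rv_L2 M K \<and>
     (\<exists>l. (\<forall>n::nat. elementary_on K s t (l n)) \<and>
        (\<lambda>n. \<integral>\<^sup>+r\<in>{s..t}. ennreal (\<Sum>e\<in>Basis. (norm (elementary_fun (l n) r e - \<Phi> r e))\<^sup>2) \<partial>lborel) \<longlonglongrightarrow> 0 \<and>
        (\<lambda>n. \<integral>\<^sup>+\<omega>. ennreal ((norm (elementary_int W (l n) \<omega> - I \<omega>))\<^sup>2) \<partial>M) \<longlonglongrightarrow> 0)"

definition k2 :: "real \<Rightarrow> real \<Rightarrow> real" where
  "k2 \<alpha> t = t powr (\<alpha> - 1) / Gamma \<alpha>"

definition sigma_op :: "real \<Rightarrow> real \<Rightarrow> real \<Rightarrow> real^'d::finite \<Rightarrow> (real, real^'d) L2" where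
  "sigma_op T \<alpha> t x = mk_L2 (\<lambda>\<xi>. (indicator {0<..<T} \<xi> * k2 \<alpha> (\<xi> - t) * indicator {t<..} \<xi>) *\<^sub>R x)"

text \<open>\<open>J\<close> stands for the stochastic integral over \<open>[s,t]\<close>. The time integrals are Bochner integrals in
  \<open>L\<^sup>2\<close>.\<close>

definition is_solution ::
  "real \<Rightarrow> ((real, real^'d::finite) L2 \<Rightarrow> (real \<times> real, real^'d) L2) \<Rightarrow> 'w measure \<Rightarrow>
    ('w \<Rightarrow> (real, real^'d) L2) \<Rightarrow> real \<Rightarrow> real \<Rightarrow> (real, real^'d) L2 \<Rightarrow>
    ('w \<Rightarrow> (real, real^'d) L2) \<Rightarrow> bool" where
  "is_solution T B M J s t \<phi> w \<longleftrightarrow>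
     w \<in> rv_L2 M (H_space T) \<and>
     (AE \<omega> in M. w \<omega> = \<phi> + (LINT r:{s..t}|lborel. L2_section (Bbar T B (w \<omega>)) r) + J \<omega>)"

text \<open>A version of the solution, which is unique up to almost sure equality.\<close>

definition solution ::
  "real \<Rightarrow> ((real, real^'d::finite) L2 \<Rightarrow> (real \<times> real, real^'d) L2) \<Rightarrow> 'w measure \<Rightarrow>
    ('w \<Rightarrow> (real, real^'d) L2) \<Rightarrow> real \<Rightarrow> real \<Rightarrow> (real, real^'d) L2 \<Rightarrow> 'w \<Rightarrow> (real, real^'d) L2" where
  "solution T B M J s t \<phi> = (SOME w. is_solution T B M J s t \<phi> w)"

definition is_linearised_solution ::
  "real \<Rightarrow> ((real, real^'d::finite) L2 \<Rightarrow> (real \<times> real, real^'d) L2) \<Rightarrow> 'w measure \<Rightarrow>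
    ('w \<Rightarrow> (real, real^'d) L2) \<Rightarrow> real \<Rightarrow> real \<Rightarrow> (real, real^'d) L2 \<Rightarrow>
    ('w \<Rightarrow> (real, real^'d) L2) \<Rightarrow> bool" where
  "is_linearised_solution T B M w s t \<psi> v \<longleftrightarrow>
     v \<in> rv_L2 M (H_space T) \<and>
     (AE \<omega> in M. v \<omega> = \<psi> + (LINT r:{s..t}|lborel. L2_section (DBbar T B (w \<omega>) (v \<omega>)) r))"

text \<open>\<open>D\<close> is a Frechet differential at \<open>\<phi>\<close> of a map \<open>f\<close> from the subspace \<open>K\<close> to \<open>L\<^sup>2(\<Omega>; K)\<close>; as
  elements of the target are functions, linearity of \<open>D\<close> is required up to almost sure equality.\<close>

definition has_frechet_differential ::
  "'w measure \<Rightarrow> 'h set \<Rightarrow> ('h \<Rightarrow> 'w \<Rightarrow> 'h::real_normed_vector) \<Rightarrow> ('h \<Rightarrow> 'w \<Rightarrow> 'h) \<Rightarrow> 'h \<Rightarrow> bool" where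
  "has_frechet_differential M K f D \<phi> \<longleftrightarrow>
     (\<forall>h\<in>K. D h \<in> rv_L2 M K) \<and>
     (\<forall>h\<in>K. \<forall>k\<in>K. AE \<omega> in M. D (h + k) \<omega> = D h \<omega> + D k \<omega>) \<and>
     (\<forall>c. \<forall>h\<in>K. AE \<omega> in M. D (c *\<^sub>R h) \<omega> = c *\<^sub>R D h \<omega>) \<and>
     (\<exists>C. \<forall>h\<in>K. rv_norm M (D h) \<le> C * norm h) \<and>
     ((\<lambda>h. rv_norm M (\<lambda>\<omega>. f (\<phi> + h) \<omega> - f \<phi> \<omega> - D h \<omega>) / norm h) \<longlongrightarrow> 0) (at 0 within K)"

definition C1_Hoelder ::
  "real \<Rightarrow> 'w measure \<Rightarrow> 'h set \<Rightarrow> ('h \<Rightarrow> 'w \<Rightarrow> 'h::real_normed_vector) \<Rightarrow> bool" where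
  "C1_Hoelder \<gamma> M K f \<longleftrightarrow>
     (\<forall>\<phi>\<in>K. f \<phi> \<in> rv_L2 M K) \<and>
     (\<exists>Df. (\<forall>\<phi>\<in>K. has_frechet_differential M K f (Df \<phi>) \<phi>) \<and>
        (\<exists>C. \<forall>\<phi>\<in>K. \<forall>\<psi>\<in>K. \<forall>h\<in>K.
           rv_norm M (\<lambda>\<omega>. Df \<phi> h \<omega> - Df \<psi> h \<omega>) \<le> C * norm (\<phi> - \<psi>) powr \<gamma> * norm h))"

end

theory Submission
  imports Defs
begin

text \<open>The equation can be solved path by path. For a fixed \<open>\<omega>\<close> it reads \<open>w = x + N w\<close> with
\<open>x = \<phi> + J \<omega>\<close> and the deterministic map \<open>N w = \<integral>\<^sub>s\<^sup>t Bbar(w)(r, \<cdot>) dr\<close>, so that everything follows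
from properties of the resolvent \<open>(I - N)\<^sup>-\<^sup>1\<close>; the noise enters only as an element of
\<open>L\<^sup>2(\<Omega>; H)\<close> that shifts the argument.

In the norm of \<open>H\<close> the map \<open>N\<close> need not be a contraction, but it is one in an equivalent norm. Let
\<open>\<parallel>f\<parallel>\<^sub>\<lambda>\<^sup>2 = \<integral> exp(- \<lambda> \<xi>) |f(\<xi>)|\<^sup>2 d\<xi>\<close>. If \<open>F(r, \<xi>)\<close> vanishes unless \<open>r \<le> \<xi>\<close>, the Cauchy-Schwarz
inequality gives \<open>\<parallel>\<integral> F(r, \<cdot>) dr\<parallel>\<^sub>\<lambda>\<^sup>2 \<le> 1/\<lambda> \<integral>\<integral> exp(- \<lambda> r) |F(r, \<xi>)|\<^sup>2 d\<xi> dr\<close>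
(\<open>norm_decay_time_integral\<close>). Since \<open>Bbar\<close> is causal, its Lipschitz estimate localises to
\<open>\<integral>\<^sub>0\<^sup>\<tau> \<parallel>Bbar(v)(r, \<cdot>) - Bbar(w)(r, \<cdot>)\<parallel>\<^sup>2 dr \<le> C0\<^sup>2 \<integral>\<^sub>0\<^sup>\<tau> |v - w|\<^sup>2\<close> for every \<open>\<tau>\<close>
(\<open>Bbar_causal_lipschitz\<close>), and integration over \<open>\<tau>\<close> against \<open>\<lambda> exp(- \<lambda> \<tau>)\<close> turns this into an
estimate between the weighted norms (\<open>norm_decay_comparison\<close>). With \<open>\<lambda> = 4 C0\<^sup>2\<close> the map \<open>N\<close>
contracts by the factor \<open>1/2\<close> (\<open>integrated_drift_contraction\<close>). The weight lies between
\<open>exp(- 4 C0\<^sup>2 T)\<close> and \<open>1\<close>, hence all constants depend on \<open>T\<close> and \<open>C0\<close> only.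

The derivative of \<open>B\<close> on the continuous paths is Hoelder continuous in operator norm, so it extends
to \<open>H\<close> by density, together with the Taylor estimate
\<open>\<parallel>Bbar(w) - Bbar(v) - D(v)(w - v)\<parallel> \<le> C0 \<parallel>w - v\<parallel>\<^sup>1\<^sup>+\<^sup>\<gamma>\<close> (\<open>Bbar_taylor\<close>). The derivative \<open>N'(w)\<close> inherits
the contraction property as a limit of difference quotients, and therefore
\<open>R(w) = (I - N'(w))\<^sup>-\<^sup>1\<close> exists, is bounded by a constant, and is Hoelder continuous in \<open>w\<close>.
Subtracting the equations of the resolvent and of its linearisation shows that \<open>R\<close> evaluated along
the solution is the Frechet derivative of the solution map, with a remainder of order \<open>1 + \<gamma>\<close>
that is uniform in \<open>\<omega>\<close> (\<open>flow_taylor\<close>).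

Finally, a Frechet differential with values in \<open>L\<^sup>2(\<Omega>; H)\<close> is unique up to almost sure equality
(\<open>frechet_differential_unique\<close>), so the equation and the pathwise bounds for \<open>R\<close> hold for any
choice of the differential.\<close>

section \<open>A nonlinear resolvent in an equivalent norm\<close>

text \<open>The map \<open>(I - N)\<^sup>-\<^sup>1\<close>.\<close>

definition resolvent :: "('x::banach \<Rightarrow> 'x) \<Rightarrow> 'x \<Rightarrow> 'x" where
  "resolvent N x = (THE w. w = x + N w)"

text \<open>The equivalent norm is represented by an operator \<open>E\<close>, as \<open>\<parallel>E x\<parallel>\<close>, so that the type keeps its own norm and
its completeness.\<close>

locale equivalent_norm =
  fixes E :: "'x::banach \<Rightarrow> 'x" and c :: real
  assumes bounded_linear_E: "bounded_linear E"
    and c_pos: "0 < c"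
    and lower: "c * norm x \<le> norm (E x)"
    and upper: "norm (E x) \<le> norm x"
begin

sublocale E: bounded_linear E by (rule bounded_linear_E)

definition half_contraction :: "('x \<Rightarrow> 'x) \<Rightarrow> bool" where
  "half_contraction N \<longleftrightarrow> (\<forall>x y. norm (E (N x - N y)) \<le> norm (E (x - y)) / 2)"

lemma norm_le_E: "norm x \<le> norm (E x) / c"
  using lower[of x] c_pos by (simp add: field_simps)

lemma half_contraction_lipschitz:
  assumes "half_contraction N"
  shows "norm (N x - N y) \<le> norm (x - y) / (2 * c)"
proof -
  have "norm (N x - N y) \<le> norm (E (N x - N y)) / c" by (rule norm_le_E)
  also have "\<dots> \<le> (norm (E (x - y)) / 2) / c"
    using assms c_pos by (intro divide_right_mono) (auto simp: half_contraction_def)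
  also have "\<dots> \<le> (norm (x - y) / 2) / c"
    using c_pos upper by (intro divide_right_mono) auto
  finally show ?thesis by simp
qed

lemma half_contraction_tendsto:
  assumes N: "half_contraction N" and X: "X \<longlonglongrightarrow> x"
  shows "(\<lambda>n. N (X n)) \<longlonglongrightarrow> N x"
proof -
  have "(\<lambda>n. norm (X n - x) / (2 * c)) \<longlonglongrightarrow> norm (x - x) / (2 * c)"
    using c_pos by (intro tendsto_intros X) auto
  then have "(\<lambda>n. norm (X n - x) / (2 * c)) \<longlonglongrightarrow> 0" by simp
  then have "(\<lambda>n. N (X n) - N x) \<longlonglongrightarrow> 0"
    by (rule Lim_null_comparison[rotated])
      (intro always_eventually allI half_contraction_lipschitz N)
  then show ?thesis by (rule LIM_zero_cancel)
qed

text \<open>Stability of fixed points under a change of the inhomogeneity: half of \<open>\<parallel>E (w - w')\<parallel>\<close> is absorbed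
into the left-hand side. All later bounds on resolvents are instances of this lemma.\<close>

lemma half_contraction_stable:
  assumes N: "half_contraction N" and w: "w = x + N w" and w': "w' = x' + N w'"
  shows "norm (w - w') \<le> 2 / c * norm (x - x')"
proof -
  have "w - w' = (x - x') + (N w - N w')"
    by (subst w, subst w') simp
  then have "norm (E (w - w')) \<le> norm (E (x - x')) + norm (E (N w - N w'))"
    by (metis E.add norm_triangle_ineq)
  also have "\<dots> \<le> norm (E (x - x')) + norm (E (w - w')) / 2"
    using N by (auto simp: half_contraction_def)
  finally have "norm (E (w - w')) \<le> 2 * norm (x - x')"
    using upper[of "x - x'"] by linarith
  then have "norm (E (w - w')) / c \<le> 2 * norm (x - x') / c"
    using c_pos by (intro divide_right_mono) auto
  with norm_le_E[of "w - w'"] show ?thesis by simp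
qed

text \<open>The usual Picard iteration; its increments decay geometrically in the norm \<open>\<parallel>E x\<parallel>\<close>, hence they are
summable in the original norm.\<close>

lemma half_contraction_fixed_point:
  assumes N: "half_contraction N"
  shows "\<exists>!w. w = x + N w"
proof (rule ex_ex1I)
  define X where "X n = ((\<lambda>w. x + N w) ^^ n) 0" for n
  have X_Suc: "X (Suc n) = x + N (X n)" for n by (simp add: X_def)
  have E_le: "norm (E (X (Suc n) - X n)) \<le> norm (E (X 1 - X 0)) * (1/2) ^ n" for n
  proof (induction n)
    case (Suc n)
    have "norm (E (X (Suc (Suc n)) - X (Suc n))) = norm (E (N (X (Suc n)) - N (X n)))"
      by (simp add: X_Suc)
    also have "\<dots> \<le> norm (E (X (Suc n) - X n)) / 2"
      using N by (auto simp: half_contraction_def)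
    finally show ?case using Suc by simp
  qed simp
  have "summable (\<lambda>n. X (Suc n) - X n)"
  proof (rule summable_comparison_test')
    show "summable (\<lambda>n. norm (E (X 1 - X 0)) / c * (1/2) ^ n)"
      by (intro summable_mult summable_geometric) auto
    fix n
    have "norm (X (Suc n) - X n) \<le> norm (E (X (Suc n) - X n)) / c" by (rule norm_le_E)
    also have "\<dots> \<le> norm (E (X 1 - X 0)) * (1/2) ^ n / c"
      using E_le c_pos by (intro divide_right_mono) auto
    finally show "norm (X (Suc n) - X n) \<le> norm (E (X 1 - X 0)) / c * (1/2) ^ n" by simp
  qed
  then have "convergent (\<lambda>n. \<Sum>k<n. X (Suc k) - X k)"
    by (simp add: summable_iff_convergent)
  then have "convergent (\<lambda>n. X n - X 0)"
    by (simp add: sum_lessThan_telescope)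
  then have "convergent X"
    using convergent_add[OF _ convergent_const[of "X 0"]] by force
  then obtain w where w: "X \<longlonglongrightarrow> w" by (auto simp: convergent_def)
  have "(\<lambda>n. X (Suc n)) \<longlonglongrightarrow> x + N w"
    unfolding X_Suc by (intro tendsto_intros half_contraction_tendsto[OF N] w)
  then have "w = x + N w"
    using LIMSEQ_Suc[OF w] LIMSEQ_unique by blast
  then show "\<exists>w. w = x + N w" ..
next
  fix w w' assume "w = x + N w" "w' = x + N w'"
  from half_contraction_stable[OF N this] show "w = w'" by simp
qed

lemma resolvent_solves: "half_contraction N \<Longrightarrow> resolvent N x = x + N (resolvent N x)"
  unfolding resolvent_def by (rule theI'[OF half_contraction_fixed_point])

lemma resolvent_unique: "half_contraction N \<Longrightarrow> w = x + N w \<Longrightarrow> resolvent N x = w"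
  using half_contraction_fixed_point[of N x] resolvent_solves[of N x] by blast

lemma resolvent_lipschitz:
  "half_contraction N \<Longrightarrow> norm (resolvent N x - resolvent N y) \<le> 2 / c * norm (x - y)"
  by (rule half_contraction_stable) (auto intro: resolvent_solves)

lemma continuous_on_resolvent:
  assumes "half_contraction N"
  shows "continuous_on A (resolvent N)"
proof -
  have "(2 / c)-lipschitz_on A (resolvent N)"
    using resolvent_lipschitz[OF assms] c_pos
    by (intro lipschitz_onI) (auto simp: dist_norm)
  then show ?thesis by (rule lipschitz_on_continuous_on)
qed

lemma resolvent_linear_bound:
  assumes L: "half_contraction L" and lin: "linear L"
  shows "norm (resolvent L x) \<le> 2 / c * norm x"
  using half_contraction_stable[OF L resolvent_solves[OF L, of x], of 0 0] linear_0[OF lin] by simp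

lemma linear_resolvent:
  assumes L: "half_contraction L" and lin: "linear L"
  shows "linear (resolvent L)"
proof (rule linearI)
  show "resolvent L (x + y) = resolvent L x + resolvent L y" for x y
    by (rule resolvent_unique[OF L],
        rule trans[OF arg_cong2[where f = "(+)", OF resolvent_solves[OF L] resolvent_solves[OF L]]])
      (simp add: linear_add[OF lin] algebra_simps)
  show "resolvent L (r *\<^sub>R x) = r *\<^sub>R resolvent L x" for r x
    using resolvent_solves[OF L, of x]
    by (intro resolvent_unique[OF L]) (metis linear_scale[OF lin] scaleR_right_distrib)
qed

text \<open>The resolvent identity \<open>v - v' = (L - L') v' + L (v - v')\<close> reduces this to stability of the fixed
point.\<close>

lemma resolvent_linear_hoelder:
  assumes L: "half_contraction L" "linear L" and L': "half_contraction L'" "linear L'"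
    and diff: "\<And>h. norm (L h - L' h) \<le> K * norm h" and K: "0 \<le> K"
  shows "norm (resolvent L h - resolvent L' h) \<le> (2 / c)\<^sup>2 * K * norm h"
proof -
  let ?v = "resolvent L h" and ?v' = "resolvent L' h"
  have "?v - ?v' = (L ?v' - L' ?v') + L (?v - ?v')"
    by (rule trans[OF arg_cong2[where f = "(-)", OF resolvent_solves[OF L(1)] resolvent_solves[OF L'(1)]]])
      (simp add: linear_diff[OF L(2)])
  from half_contraction_stable[OF L(1) this, of 0 0]
  have "norm (?v - ?v') \<le> 2 / c * norm (L ?v' - L' ?v')"
    by (simp add: linear_0[OF L(2)])
  also have "\<dots> \<le> 2 / c * (K * (2 / c * norm h))"
    using order_trans[OF diff mult_left_mono[OF resolvent_linear_bound[OF L', of h] K]] c_pos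
    by (intro mult_left_mono) auto
  finally show ?thesis by (simp add: power2_eq_square mult_ac)
qed

text \<open>A derivative inherits the Lipschitz constant in every equivalent norm, because it is a limit of
difference quotients. This transfers the contraction property from a map to its linearisation.\<close>

lemma half_contraction_derivative:
  assumes N: "half_contraction N" and lin: "linear L" and g: "0 < g"
    and taylor: "\<And>h. norm (N (w + h) - N w - L h) \<le> K * norm h powr (1 + g)"
  shows "half_contraction L"
proof -
  have "norm (E (L h)) \<le> norm (E h) / 2" for h
  proof -
    have le: "norm (E (L h)) \<le> norm (E h) / 2 + K * norm h powr (1 + g) * \<theta> powr g" if "0 < \<theta>" for \<theta> :: real
    proof -
      have "\<theta> * norm (E (L h)) = norm (E (L (\<theta> *\<^sub>R h)))"
        using that by (simp add: linear_scale[OF lin] E.scaleR)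
      also have "\<dots> = norm (E (N (w + \<theta> *\<^sub>R h) - N w) - E (N (w + \<theta> *\<^sub>R h) - N w - L (\<theta> *\<^sub>R h)))"
        by (simp add: E.diff)
      also have "\<dots> \<le> norm (E (N (w + \<theta> *\<^sub>R h) - N w)) + norm (E (N (w + \<theta> *\<^sub>R h) - N w - L (\<theta> *\<^sub>R h)))"
        by (rule norm_triangle_ineq4)
      also have "\<dots> \<le> norm (E ((w + \<theta> *\<^sub>R h) - w)) / 2 + K * norm (\<theta> *\<^sub>R h) powr (1 + g)"
        using N[unfolded half_contraction_def, rule_format, of "w + \<theta> *\<^sub>R h" w]
          order_trans[OF upper taylor, of "\<theta> *\<^sub>R h"] by (rule add_mono)
      also have "\<dots> = \<theta> * (norm (E h) / 2 + K * norm h powr (1 + g) * \<theta> powr g)"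
        using that by (simp add: E.scaleR powr_mult powr_add algebra_simps)
      finally show ?thesis using that by simp
    qed
    have "((\<lambda>\<theta>. norm (E h) / 2 + K * norm h powr (1 + g) * \<theta> powr g) \<longlongrightarrow>
        norm (E h) / 2 + K * norm h powr (1 + g) * 0 powr g) (at_right 0)"
    proof -
      have "((\<lambda>\<theta>::real. \<theta> powr g) \<longlongrightarrow> 0 powr g) (at_right 0)"
      proof (rule tendsto_powr2)
        show "\<forall>\<^sub>F \<theta>::real in at_right 0. 0 \<le> \<theta>"
          by (rule eventually_mono[OF eventually_at_right_less]) simp
      qed (use g in \<open>auto intro: tendsto_ident_at\<close>)
      then show ?thesis by (intro tendsto_add tendsto_mult tendsto_const)
    qed
    from tendsto_lowerbound[OF this, of "norm (E (L h))"] le g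
    show ?thesis by (simp add: eventually_mono[OF eventually_at_right_less])
  qed
  then show ?thesis
    by (simp add: half_contraction_def linear_diff[OF lin, symmetric])
qed

text \<open>The error \<open>d - v\<close> of the linearisation, where \<open>d\<close> is the increment of the resolvent and \<open>v\<close> solves
the linearised equation, is itself a fixed point: \<open>d - v = \<rho> + L (d - v)\<close>, where \<open>\<rho>\<close> is the Taylor
remainder of \<open>N\<close> at the increment \<open>d\<close>.\<close>

lemma resolvent_taylor:
  assumes N: "half_contraction N" and L: "half_contraction L" "linear L" and g: "0 < g" and K: "0 \<le> K"
    and taylor: "\<And>k. norm (N (resolvent N x + k) - N (resolvent N x) - L k) \<le> K * norm k powr (1 + g)"
  shows "norm (resolvent N (x + h) - resolvent N x - resolvent L h)
    \<le> 2 / c * K * (2 / c) powr (1 + g) * norm h powr (1 + g)"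
proof -
  let ?w = "resolvent N x"
  define d where "d = resolvent N (x + h) - ?w"
  have d: "norm d \<le> 2 / c * norm h"
    using resolvent_lipschitz[OF N, of "x + h" x] by (simp add: d_def)
  have wd: "resolvent N (x + h) = ?w + d" by (simp add: d_def)
  have d_eq: "d = h + (N (?w + d) - N ?w)"
    unfolding wd[symmetric]
    by (subst d_def, rule trans[OF arg_cong2[where f = "(-)", OF resolvent_solves[OF N] resolvent_solves[OF N]]]) simp
  have "d - resolvent L h = (N (?w + d) - N ?w - L d) + L (d - resolvent L h)"
    by (rule trans[OF arg_cong2[where f = "(-)", OF d_eq resolvent_solves[OF L(1)]]])
      (simp add: linear_diff[OF L(2)])
  from half_contraction_stable[OF L(1) this, of 0 0]
  have "norm (d - resolvent L h) \<le> 2 / c * norm (N (?w + d) - N ?w - L d)"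
    by (simp add: linear_0[OF L(2)])
  also have "\<dots> \<le> 2 / c * (K * (2 / c * norm h) powr (1 + g))"
    using d g K c_pos by (intro mult_left_mono order_trans[OF taylor] powr_mono2) auto
  also have "\<dots> = 2 / c * K * (2 / c) powr (1 + g) * norm h powr (1 + g)"
    using c_pos by (subst powr_mult) auto
  finally show ?thesis by (simp add: d_def)
qed

end

section \<open>Pointwise calculus in the Hilbert space\<close>

instance L2 :: (euclidean_space, euclidean_space) banach ..

lemma L2_eqI:
  assumes "AE x in lborel. rep_L2 F x = rep_L2 G x"
  shows "F = G"
  using mk_L2_eq_iff[OF sq_integrable_rep_L2[of F] sq_integrable_rep_L2[of G]] assms by simp

lemma AE_rep_add: "AE x in lborel. rep_L2 (F + G) x = rep_L2 F x + rep_L2 G x"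
  using rep_mk_L2[OF sq_integrable_add[OF sq_integrable_rep_L2[of F] sq_integrable_rep_L2[of G]]]
  by (simp add: mk_L2_add sq_integrable_rep_L2)

lemma AE_rep_diff: "AE x in lborel. rep_L2 (F - G) x = rep_L2 F x - rep_L2 G x"
  using rep_mk_L2[OF sq_integrable_diff[OF sq_integrable_rep_L2[of F] sq_integrable_rep_L2[of G]]]
  by (simp add: mk_L2_diff sq_integrable_rep_L2)

lemma AE_rep_scaleR: "AE x in lborel. rep_L2 (c *\<^sub>R F) x = c *\<^sub>R rep_L2 F x"
  using rep_mk_L2[OF sq_integrable_scaleR[OF sq_integrable_rep_L2[of F]], of c]
  by (simp add: mk_L2_scaleR sq_integrable_rep_L2)

lemma AE_rep_0: "AE x in lborel. rep_L2 0 x = 0"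
  using rep_mk_L2[OF sq_integrable_0] by simp

lemma inner_L2_eq: "F \<bullet> G = (\<integral>x. rep_L2 F x \<bullet> rep_L2 G x \<partial>lborel)"
  using inner_mk_L2[OF sq_integrable_rep_L2[of F] sq_integrable_rep_L2[of G]] by simp

lemma ennreal_norm_mk_L2:
  "sq_integrable f \<Longrightarrow> ennreal ((norm (mk_L2 f))\<^sup>2) = (\<integral>\<^sup>+x. ennreal ((norm (f x))\<^sup>2) \<partial>lborel)"
  by (simp add: norm_mk_L2 nn_integral_eq_integral sq_integrable_def)

lemma ennreal_norm_L2: "ennreal ((norm F)\<^sup>2) = (\<integral>\<^sup>+x. ennreal ((norm (rep_L2 F x))\<^sup>2) \<partial>lborel)"
  using ennreal_norm_mk_L2[OF sq_integrable_rep_L2[of F]] by simp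

lemma norm_L2_mono:
  assumes "AE x in lborel. norm (rep_L2 F x) \<le> norm (rep_L2 G x)"
  shows "norm F \<le> norm G"
proof -
  have "ennreal ((norm F)\<^sup>2) \<le> ennreal ((norm G)\<^sup>2)"
    unfolding ennreal_norm_L2
    by (rule nn_integral_mono_AE, rule eventually_mono[OF assms]) (auto intro!: ennreal_leI power_mono)
  then show ?thesis by (auto dest: power2_le_imp_le)
qed

lemma sq_integrable_iff_nn_integral:
  assumes "f \<in> borel_measurable borel"
  shows "sq_integrable f \<longleftrightarrow> (\<integral>\<^sup>+x. ennreal ((norm (f x))\<^sup>2) \<partial>lborel) < \<infinity>"
  using assms by (simp add: sq_integrable_def integrable_iff_bounded)

section \<open>Multiplication operators\<close>

definition mult_L2 :: "('m \<Rightarrow> real) \<Rightarrow> ('m::euclidean_space, 'a::euclidean_space) L2 \<Rightarrow> ('m, 'a) L2" where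
  "mult_L2 m F = mk_L2 (\<lambda>x. m x *\<^sub>R rep_L2 F x)"

text \<open>The bound \<open>1\<close> covers the two kinds of multipliers that are needed: indicators and decaying weights.\<close>

definition multiplier :: "('m::euclidean_space \<Rightarrow> real) \<Rightarrow> bool" where
  "multiplier m \<longleftrightarrow> m \<in> borel_measurable borel \<and> (\<forall>x. \<bar>m x\<bar> \<le> 1)"

lemma multiplier_indicator [intro]: "A \<in> sets borel \<Longrightarrow> multiplier (indicator A)"
  by (auto simp: multiplier_def indicator_def)

lemma sq_integrable_mult:
  assumes "multiplier m" "sq_integrable f"
  shows "sq_integrable (\<lambda>x. m x *\<^sub>R f x)"
proof (rule sq_integrable_bound[OF assms(2) assms(2), of _ 1 0])
  show "(\<lambda>x. m x *\<^sub>R f x) \<in> borel_measurable borel"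
    using assms by (auto simp: multiplier_def dest: sq_integrable_measurable)
  show "norm (m x *\<^sub>R f x) \<le> 1 * norm (f x) + 0 * norm (f x)" for x
    using assms mult_right_mono[of "\<bar>m x\<bar>" 1 "norm (f x)"] by (simp add: multiplier_def)
qed

lemma AE_rep_mult: "multiplier m \<Longrightarrow> AE x in lborel. rep_L2 (mult_L2 m F) x = m x *\<^sub>R rep_L2 F x"
  unfolding mult_L2_def by (intro rep_mk_L2 sq_integrable_mult sq_integrable_rep_L2)

lemma norm_mult_mono:
  assumes m: "multiplier m" and n: "multiplier n" and le: "AE x in lborel. norm (m x *\<^sub>R rep_L2 F x) \<le> norm (n x *\<^sub>R rep_L2 G x)"
  shows "norm (mult_L2 m F) \<le> norm (mult_L2 n G)"
proof (rule norm_L2_mono)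
  show "AE x in lborel. norm (rep_L2 (mult_L2 m F) x) \<le> norm (rep_L2 (mult_L2 n G) x)"
    using AE_rep_mult[OF m, of F] AE_rep_mult[OF n, of G] le by eventually_elim simp
qed

lemma norm_mult_le:
  assumes "multiplier m"
  shows "norm (mult_L2 m F) \<le> norm F"
proof (rule norm_L2_mono)
  show "AE x in lborel. norm (rep_L2 (mult_L2 m F) x) \<le> norm (rep_L2 F x)"
    using AE_rep_mult[OF assms, of F]
  proof eventually_elim
    case (elim x)
    then show ?case
      using assms mult_right_mono[of "\<bar>m x\<bar>" 1 "norm (rep_L2 F x)"] by (simp add: multiplier_def)
  qed
qed

lemma bounded_linear_mult:
  assumes m: "multiplier m"
  shows "bounded_linear (mult_L2 m)"
proof (rule bounded_linear_intro[where K = 1])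
  show "mult_L2 m (F + G) = mult_L2 m F + mult_L2 m G" for F G
  proof (rule L2_eqI)
    show "AE x in lborel. rep_L2 (mult_L2 m (F + G)) x = rep_L2 (mult_L2 m F + mult_L2 m G) x"
      using AE_rep_mult[OF m, of "F + G"] AE_rep_mult[OF m, of F] AE_rep_mult[OF m, of G]
        AE_rep_add[of F G] AE_rep_add[of "mult_L2 m F" "mult_L2 m G"]
      by eventually_elim (simp add: scaleR_add_right)
  qed
  show "mult_L2 m (r *\<^sub>R F) = r *\<^sub>R mult_L2 m F" for r F
  proof (rule L2_eqI)
    show "AE x in lborel. rep_L2 (mult_L2 m (r *\<^sub>R F)) x = rep_L2 (r *\<^sub>R mult_L2 m F) x"
      using AE_rep_mult[OF m, of "r *\<^sub>R F"] AE_rep_mult[OF m, of F]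
        AE_rep_scaleR[of r F] AE_rep_scaleR[of r "mult_L2 m F"]
      by eventually_elim simp
  qed
  show "norm (mult_L2 m F) \<le> norm F * 1" for F
    using norm_mult_le[OF m, of F] by simp
qed

lemma mult_mult:
  assumes m: "multiplier m" and n: "multiplier n"
  shows "mult_L2 m (mult_L2 n F) = mult_L2 (\<lambda>x. m x * n x) F"
proof (rule L2_eqI)
  have mn: "multiplier (\<lambda>x. m x * n x)"
    using assms by (auto simp: multiplier_def abs_mult intro!: mult_le_one)
  show "AE x in lborel. rep_L2 (mult_L2 m (mult_L2 n F)) x = rep_L2 (mult_L2 (\<lambda>x. m x * n x) F) x"
    using AE_rep_mult[OF m, of "mult_L2 n F"] AE_rep_mult[OF n, of F] AE_rep_mult[OF mn, of F]
    by eventually_elim simp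
qed

lemma mult_commute:
  assumes "multiplier m" "multiplier n"
  shows "mult_L2 m (mult_L2 n F) = mult_L2 n (mult_L2 m F)"
  using assms by (simp add: mult_mult mult.commute)

lemma L2_on_iff:
  assumes S: "S \<in> sets borel"
  shows "F \<in> L2_on S \<longleftrightarrow> mult_L2 (indicator S) F = F"
proof
  assume "F \<in> L2_on S"
  then have "AE x in lborel. x \<notin> S \<longrightarrow> rep_L2 F x = 0" by (simp add: L2_on_def)
  then have "AE x in lborel. rep_L2 (mult_L2 (indicator S) F) x = rep_L2 F x"
    using AE_rep_mult[OF multiplier_indicator[OF S], of F]
    by eventually_elim (auto simp: indicator_def)
  then show "mult_L2 (indicator S) F = F" by (rule L2_eqI)
next
  assume "mult_L2 (indicator S) F = F"
  with AE_rep_mult[OF multiplier_indicator[OF S], of F] have "AE x in lborel. rep_L2 F x = indicator S x *\<^sub>R rep_L2 F x"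
    by simp
  then show "F \<in> L2_on S" unfolding L2_on_def
    by (simp, elim eventually_mono) (auto simp: indicator_def)
qed

lemma mult_in_L2_on:
  assumes S: "S \<in> sets borel"
  shows "mult_L2 (indicator S) F \<in> L2_on S"
proof -
  have "(\<lambda>x. indicator S x * indicator S x :: real) = indicator S"
    by (auto simp: indicator_def)
  then show ?thesis
    unfolding L2_on_iff[OF S] by (simp add: mult_mult multiplier_indicator S)
qed

lemma subspace_L2_on:
  assumes S: "S \<in> sets borel"
  shows "subspace (L2_on S)"
proof -
  interpret bounded_linear "mult_L2 (indicator S)"
    by (rule bounded_linear_mult[OF multiplier_indicator[OF S]])
  show ?thesis
    by (auto simp: subspace_def L2_on_iff[OF S] zero add scaleR)
qed

section \<open>Sections and the time integral\<close>

text \<open>In a separable metric space every open set is a countable union of balls.\<close>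

lemma borel_measurable_dist:
  fixes f :: "'w \<Rightarrow> 'b::{second_countable_topology, metric_space}"
  assumes "\<And>q. (\<lambda>x. dist q (f x)) \<in> borel_measurable M"
  shows "f \<in> borel_measurable M"
proof (rule borel_measurableI)
  fix U :: "'b set" assume U: "open U"
  let ?B = "{ball q e | q e. ball q e \<subseteq> U}"
  obtain B where B: "B \<subseteq> ?B" "countable B" "\<Union>B = \<Union>?B"
    by (rule Lindelof[of ?B]) auto
  have "\<Union>?B = U"
    using U unfolding open_contains_ball by (auto, metis centre_in_ball)
  with B have "f -` U \<inter> space M = (\<Union>b\<in>B. f -` b \<inter> space M)" by auto
  also have "\<dots> \<in> sets M"
  proof (rule sets.countable_UN'[OF B(2)], safe)
    fix b assume "b \<in> B"
    then obtain q e where "b = ball q e" using B(1) by auto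
    moreover have "{x \<in> space M. dist q (f x) < e} \<in> sets M"
      using assms[of q] by measurable
    moreover have "f -` ball q e \<inter> space M = {x \<in> space M. dist q (f x) < e}" by auto
    ultimately show "f -` b \<inter> space M \<in> sets M" by simp
  qed
  finally show "f -` U \<inter> space M \<in> sets M" .
qed

lemma nn_integral_lborel_pair:
  fixes f :: "'m::euclidean_space \<times> 'n::euclidean_space \<Rightarrow> ennreal"
  assumes "f \<in> borel_measurable borel"
  shows "(\<integral>\<^sup>+x. f x \<partial>lborel) = (\<integral>\<^sup>+x. \<integral>\<^sup>+y. f (x, y) \<partial>lborel \<partial>lborel)"
  using assms sigma_finite_measure.nn_integral_fst[OF sigma_finite_lborel, of f lborel]
  by (simp add: lborel_prod)

lemma AE_lborel_pairD:
  fixes P :: "'m::euclidean_space \<times> 'n::euclidean_space \<Rightarrow> bool"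
  assumes "AE z in lborel. P z"
  shows "AE x in lborel. AE y in lborel. P (x, y)"
  by (rule lborel_pair.AE_pair, subst lborel_prod) (rule assms)

lemma AE_lborel_pairI:
  fixes P :: "'m::euclidean_space \<times> 'n::euclidean_space \<Rightarrow> bool"
  assumes "{z. P z} \<in> sets borel" "AE x in lborel. AE y in lborel. P (x, y)"
  shows "AE z in lborel. P z"
proof -
  have "{z \<in> space (lborel \<Otimes>\<^sub>M lborel). P z} \<in> sets (lborel \<Otimes>\<^sub>M lborel)"
    by (subst (1 2) lborel_prod) (use assms(1) in simp)
  from lborel_pair.AE_pair_measure[OF this assms(2)] show ?thesis
    by (subst (asm) lborel_prod)
qed

lemma AE_sq_integrable_section:
  fixes F :: "(real \<times> real, 'a::euclidean_space) L2"
  shows "AE r in lborel. sq_integrable (\<lambda>y. rep_L2 F (r, y))"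
proof -
  have "(\<integral>\<^sup>+r. \<integral>\<^sup>+y. ennreal ((norm (rep_L2 F (r, y)))\<^sup>2) \<partial>lborel \<partial>lborel) = ennreal ((norm F)\<^sup>2)"
    by (simp add: ennreal_norm_L2 nn_integral_lborel_pair)
  then have "AE r in lborel. (\<integral>\<^sup>+y. ennreal ((norm (rep_L2 F (r, y)))\<^sup>2) \<partial>lborel) \<noteq> \<infinity>"
    by (intro nn_integral_PInf_AE) auto
  then show ?thesis
    by eventually_elim (simp add: sq_integrable_iff_nn_integral less_top)
qed

lemma AE_rep_section:
  fixes F :: "(real \<times> real, 'a::euclidean_space) L2"
  shows "AE r in lborel. AE y in lborel. rep_L2 (L2_section F r) y = rep_L2 F (r, y)"
  using AE_sq_integrable_section[of F]
  by eventually_elim (simp add: L2_section_def rep_mk_L2)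

text \<open>Distances from a fixed element are, by Fubini, measurable functions of \<open>r\<close>. The case distinction
accounts for the null set of those \<open>r\<close> for which the section is not square-integrable and
\<open>L2_section\<close> takes the value 0.\<close>

lemma measurable_L2_section [measurable]:
  fixes F :: "(real \<times> real, 'a::euclidean_space) L2"
  shows "L2_section F \<in> borel_measurable borel"
proof (rule borel_measurable_dist)
  fix q :: "(real, 'a) L2"
  have "dist q (L2_section F r) = (if (\<integral>\<^sup>+y. ennreal ((norm (rep_L2 F (r, y)))\<^sup>2) \<partial>lborel) < \<infinity>
      then sqrt (enn2real (\<integral>\<^sup>+y. ennreal ((norm (rep_L2 q y - rep_L2 F (r, y)))\<^sup>2) \<partial>lborel)) else norm q)" for r
  proof (cases "sq_integrable (\<lambda>y. rep_L2 F (r, y))")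
    case True
    let ?g = "\<lambda>y. rep_L2 q y - rep_L2 F (r, y)"
    have g: "sq_integrable ?g" by (intro sq_integrable_diff sq_integrable_rep_L2 True)
    have "dist q (L2_section F r) = norm (mk_L2 ?g)"
      by (simp add: L2_section_def dist_norm mk_L2_diff True sq_integrable_rep_L2)
    also have "\<dots> = sqrt (enn2real (\<integral>\<^sup>+y. ennreal ((norm (?g y))\<^sup>2) \<partial>lborel))"
      by (simp add: ennreal_norm_mk_L2[OF g, symmetric])
    finally show ?thesis using True by (simp add: sq_integrable_iff_nn_integral)
  next
    case False
    then have "L2_section F r = 0" by (simp add: L2_section_def mk_L2_def)
    then show ?thesis using False by (simp add: sq_integrable_iff_nn_integral)
  qed
  then show "(\<lambda>r. dist q (L2_section F r)) \<in> borel_measurable borel" by simp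
qed

lemma nn_integral_norm_section:
  fixes F :: "(real \<times> real, 'a::euclidean_space) L2"
  shows "(\<integral>\<^sup>+r. ennreal ((norm (L2_section F r))\<^sup>2) \<partial>lborel) = ennreal ((norm F)\<^sup>2)"
proof -
  have "(\<integral>\<^sup>+r. ennreal ((norm (L2_section F r))\<^sup>2) \<partial>lborel)
      = (\<integral>\<^sup>+r. \<integral>\<^sup>+y. ennreal ((norm (rep_L2 F (r, y)))\<^sup>2) \<partial>lborel \<partial>lborel)"
  proof (rule nn_integral_cong_AE)
    show "AE r in lborel. ennreal ((norm (L2_section F r))\<^sup>2)
        = (\<integral>\<^sup>+y. ennreal ((norm (rep_L2 F (r, y)))\<^sup>2) \<partial>lborel)"
      using AE_sq_integrable_section[of F]
      by eventually_elim (simp add: L2_section_def ennreal_norm_mk_L2)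
  qed
  then show ?thesis by (simp add: ennreal_norm_L2 nn_integral_lborel_pair)
qed

lemma set_integrable_section:
  fixes F :: "(real \<times> real, 'a::euclidean_space) L2"
  shows "set_integrable lborel {s..t} (L2_section F)"
  unfolding set_integrable_def
proof (rule Bochner_Integration.integrable_bound)
  have "integrable lborel (\<lambda>r. (norm (L2_section F r))\<^sup>2)"
    by (rule integrableI_bounded) (simp_all add: nn_integral_norm_section)
  then show "integrable lborel (\<lambda>r. indicator {s..t} r + (norm (L2_section F r))\<^sup>2)"
    by (intro Bochner_Integration.integrable_add integrable_real_indicator) (auto simp: emeasure_lborel_Icc_eq)
  show "(\<lambda>r. indicator {s..t} r *\<^sub>R L2_section F r) \<in> borel_measurable lborel"
    by measurable
  have "x \<le> 1 + x\<^sup>2" for x :: real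
    using sum_squares_bound[of x 1] by (simp add: power2_eq_square) (smt (verit) zero_le_square)
  then show "AE r in lborel. norm (indicator {s..t} r *\<^sub>R L2_section F r) \<le> norm (indicator {s..t} r + (norm (L2_section F r))\<^sup>2)"
    by (intro AE_I2) (auto simp: indicator_def)
qed

definition time_integral :: "real \<Rightarrow> real \<Rightarrow> (real \<times> real, 'a::euclidean_space) L2 \<Rightarrow> (real, 'a) L2" where
  "time_integral s t F = (LINT r:{s..t}|lborel. L2_section F r)"

text \<open>The function \<open>(r, \<xi>) \<mapsto> 1\<^bsub>[s,t]\<^esub>(r) g(\<xi>)\<close>. The map \<open>g \<mapsto> time_constant s t g\<close> is the adjoint of the
time integral, which makes it possible to estimate Bochner integrals by Lebesgue integrals over the
square.\<close>

definition time_constant :: "real \<Rightarrow> real \<Rightarrow> (real, 'a::euclidean_space) L2 \<Rightarrow> (real \<times> real, 'a) L2" where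
  "time_constant s t g = mk_L2 (\<lambda>z. indicator {s..t} (fst z) *\<^sub>R rep_L2 g (snd z))"

lemma measurable_time_constant:
  fixes g :: "(real, 'a::euclidean_space) L2"
  shows "(\<lambda>z. indicator {s..t} (fst z) *\<^sub>R rep_L2 g (snd z)) \<in> borel_measurable (borel :: (real \<times> real) measure)"
  by (subst borel_prod[symmetric]) measurable

lemma nn_integral_time_constant:
  fixes g :: "(real, 'a::euclidean_space) L2"
  assumes "s \<le> t"
  shows "(\<integral>\<^sup>+z. ennreal ((norm (indicator {s..t} (fst z) *\<^sub>R rep_L2 g (snd z)))\<^sup>2) \<partial>lborel)
    = ennreal ((t - s) * (norm g)\<^sup>2)"
proof -
  have "(\<integral>\<^sup>+z. ennreal ((norm (indicator {s..t} (fst z) *\<^sub>R rep_L2 g (snd z)))\<^sup>2) \<partial>lborel)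
    = (\<integral>\<^sup>+r. \<integral>\<^sup>+y. ennreal ((norm (indicator {s..t} r *\<^sub>R rep_L2 g y))\<^sup>2) \<partial>lborel \<partial>lborel)"
    using measurable_time_constant[of s t g]
    by (subst nn_integral_lborel_pair) (auto simp del: norm_scaleR)
  also have "\<dots> = (\<integral>\<^sup>+r. ennreal ((norm g)\<^sup>2) * indicator {s..t} r \<partial>lborel)"
    by (intro nn_integral_cong) (auto simp: indicator_def ennreal_norm_L2)
  also have "\<dots> = ennreal ((t - s) * (norm g)\<^sup>2)"
    using assms by (subst nn_integral_cmult_indicator) (simp_all add: ennreal_mult mult.commute)
  finally show ?thesis .
qed

lemma sq_integrable_time_constant:
  fixes g :: "(real, 'a::euclidean_space) L2" and s t :: real
  shows "sq_integrable (\<lambda>z. indicator {s..t} (fst z) *\<^sub>R rep_L2 g (snd z))"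
proof (cases "s \<le> t")
  case True
  from sq_integrable_iff_nn_integral[OF measurable_time_constant[of s t g]] nn_integral_time_constant[OF True, of g]
  show ?thesis by (simp del: norm_scaleR)
qed (simp add: sq_integrable_0)

lemma norm_time_constant: "s \<le> t \<Longrightarrow> (norm (time_constant s t g))\<^sup>2 = (t - s) * (norm g)\<^sup>2"
proof -
  assume "s \<le> t"
  then have "ennreal ((norm (time_constant s t g))\<^sup>2) = ennreal ((t - s) * (norm g)\<^sup>2)"
    by (simp add: time_constant_def ennreal_norm_mk_L2 sq_integrable_time_constant nn_integral_time_constant
        del: norm_scaleR)
  then show ?thesis using \<open>s \<le> t\<close> by simp
qed

lemma time_integral_adjoint: "time_integral s t F \<bullet> g = F \<bullet> time_constant s t g"
proof -
  have "time_integral s t F \<bullet> g = (\<integral>r. (indicator {s..t} r *\<^sub>R L2_section F r) \<bullet> g \<partial>lborel)"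
    unfolding time_integral_def set_lebesgue_integral_def
    using set_integrable_section[of s t F] by (intro integral_inner_left[symmetric]) (simp add: set_integrable_def)
  also have "\<dots> = (\<integral>r. \<integral>y. rep_L2 F (r, y) \<bullet> (indicator {s..t} r *\<^sub>R rep_L2 g y) \<partial>lborel \<partial>lborel)"
  proof (rule integral_cong_AE)
    show "AE r in lborel. (indicator {s..t} r *\<^sub>R L2_section F r) \<bullet> g
        = (\<integral>y. rep_L2 F (r, y) \<bullet> (indicator {s..t} r *\<^sub>R rep_L2 g y) \<partial>lborel)"
      using AE_rep_section[of F]
    proof eventually_elim
      case (elim r)
      have "L2_section F r \<bullet> g = (\<integral>y. rep_L2 F (r, y) \<bullet> rep_L2 g y \<partial>lborel)"
        unfolding inner_L2_eq by (rule integral_cong_AE) (use elim in auto)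
      then show ?case by simp
    qed
  qed measurable
  also have "\<dots> = (\<integral>z. rep_L2 F z \<bullet> (indicator {s..t} (fst z) *\<^sub>R rep_L2 g (snd z)) \<partial>lborel)"
    using lborel_pair.integral_fst'[of "\<lambda>z. rep_L2 F z \<bullet> (indicator {s..t} (fst z) *\<^sub>R rep_L2 g (snd z))"]
      integrable_inner_sq_integrable[OF sq_integrable_rep_L2[of F] sq_integrable_time_constant[of s t g]]
    by (simp add: lborel_prod)
  also have "\<dots> = F \<bullet> time_constant s t g"
    using inner_mk_L2[OF sq_integrable_rep_L2[of F] sq_integrable_time_constant[of s t g]]
    by (simp add: time_constant_def)
  finally show ?thesis .
qed

text \<open>Test \<open>f = \<integral>\<^sub>s\<^sup>t F(r, \<cdot>) dr\<close> against itself and use the adjoint.\<close>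

lemma norm_time_integral:
  assumes "s \<le> t"
  shows "norm (time_integral s t F) \<le> sqrt (t - s) * norm F"
proof -
  let ?f = "time_integral s t F"
  have "norm (time_constant s t ?f) = sqrt (t - s) * norm ?f"
    using norm_time_constant[OF assms, of ?f]
    by (metis norm_ge_zero real_sqrt_abs abs_of_nonneg real_sqrt_mult)
  moreover have "(norm ?f)\<^sup>2 \<le> norm F * norm (time_constant s t ?f)"
    unfolding power2_norm_eq_inner time_integral_adjoint by (rule norm_cauchy_schwarz)
  ultimately have "norm ?f * norm ?f \<le> (sqrt (t - s) * norm F) * norm ?f"
    by (simp add: power2_eq_square mult_ac)
  then show ?thesis using assms by (cases "norm ?f = 0") (auto simp: mult_le_cancel_right)
qed

lemma bounded_linear_time_integral:
  assumes "s \<le> t"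
  shows "bounded_linear (time_integral s t)"
proof (rule bounded_linear_intro)
  show "time_integral s t (F + G) = time_integral s t F + time_integral s t G" for F G :: "(real \<times> real, 'a) L2"
    by (subst vector_eq_rdot[symmetric]) (simp add: time_integral_adjoint inner_add_left)
  show "time_integral s t (c *\<^sub>R F) = c *\<^sub>R time_integral s t F" for c and F :: "(real \<times> real, 'a) L2"
    by (subst vector_eq_rdot[symmetric]) (simp add: time_integral_adjoint)
  show "norm (time_integral s t F) \<le> norm F * sqrt (t - s)" for F :: "(real \<times> real, 'a) L2"
    using norm_time_integral[OF assms, of F] by (simp add: mult.commute)
qed

section \<open>Exponentially weighted norms\<close>

text \<open>The square root of the weight \<open>exp(- l x)\<close>. Clamping \<open>x\<close> to \<open>[0,T]\<close> keeps the weight between two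
positive constants on the whole line.\<close>

definition decay :: "real \<Rightarrow> real \<Rightarrow> real \<Rightarrow> real" where
  "decay l T x = exp (- l * max 0 (min T x) / 2)"

lemma measurable_decay [measurable]: "decay l T \<in> borel_measurable borel"
  unfolding decay_def by measurable

lemma decay_pos: "0 < decay l T x"
  by (simp add: decay_def)

lemma decay_le_1: "0 \<le> l \<Longrightarrow> decay l T x \<le> 1"
  by (simp add: decay_def)

lemma decay_ge: "0 \<le> l \<Longrightarrow> 0 \<le> T \<Longrightarrow> exp (- l * T / 2) \<le> decay l T x"
  by (auto simp: decay_def intro!: mult_left_mono)

lemma decay_square: "0 \<le> x \<Longrightarrow> x \<le> T \<Longrightarrow> (decay l T x)\<^sup>2 = exp (- l * x)"
  by (simp add: decay_def power2_eq_square exp_add[symmetric])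

lemma multiplier_decay: "0 \<le> l \<Longrightarrow> p \<in> borel_measurable borel \<Longrightarrow> multiplier (\<lambda>x. decay l T (p x))"
  by (auto simp: multiplier_def decay_le_1 less_imp_le[OF decay_pos] abs_of_pos[OF decay_pos])

lemma equivalent_norm_decay:
  assumes "0 \<le> l" "0 \<le> T"
  shows "equivalent_norm (mult_L2 (decay l T) :: (real, 'b::euclidean_space) L2 \<Rightarrow> _) (exp (- l * T / 2))"
proof (rule equivalent_norm.intro)
  have m: "multiplier (decay l T)"
    using multiplier_decay[OF assms(1), of "\<lambda>x. x"] by simp
  show "bounded_linear (mult_L2 (decay l T) :: (real, 'b) L2 \<Rightarrow> _)"
    by (rule bounded_linear_mult[OF m])
  fix F :: "(real, 'b) L2"
  show "norm (mult_L2 (decay l T) F) \<le> norm F" by (rule norm_mult_le[OF m])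
  have "norm (exp (- l * T / 2) *\<^sub>R F) \<le> norm (mult_L2 (decay l T) F)"
  proof (rule norm_L2_mono)
    show "AE x in lborel. norm (rep_L2 (exp (- l * T / 2) *\<^sub>R F) x) \<le> norm (rep_L2 (mult_L2 (decay l T) F) x)"
      using AE_rep_mult[OF m, of F] AE_rep_scaleR[of "exp (- l * T / 2)" F]
    proof eventually_elim
      case (elim x)
      show ?case using mult_right_mono[OF decay_ge[OF assms, of x] norm_ge_zero, of "rep_L2 F x"]
        unfolding elim by (simp add: abs_of_pos[OF decay_pos])
    qed
  qed
  then show "exp (- l * T / 2) * norm F \<le> norm (mult_L2 (decay l T) F)" by simp
qed simp

text \<open>The decomposition \<open>exp(- l r) = exp(- l T) + \<integral>\<^sub>r\<^sup>T l exp(- l \<tau>) d\<tau>\<close> of the weight into layers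
\<open>r < \<tau>\<close>.\<close>

lemma decay_layers:
  assumes l: "0 \<le> l" and "0 < r" "r < T"
  shows "ennreal ((decay l T r)\<^sup>2)
    = (\<integral>\<^sup>+\<tau>. ennreal (l * exp (- l * \<tau>)) * indicator {0<..T} \<tau> * indicator {r<..} \<tau> \<partial>lborel) + ennreal (exp (- l * T))"
proof -
  have "(\<integral>\<^sup>+\<tau>. ennreal (l * exp (- l * \<tau>)) * indicator {0<..T} \<tau> * indicator {r<..} \<tau> \<partial>lborel)
      = (\<integral>\<^sup>+\<tau>. ennreal (l * exp (- l * \<tau>)) * indicator {r..T} \<tau> \<partial>lborel)"
    using AE_lborel_singleton[of r] assms
    by (intro nn_integral_cong_AE, elim eventually_mono) (auto simp: indicator_def)
  also have "\<dots> = ennreal (- exp (- l * T) - - exp (- l * r))"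
    using assms by (intro nn_integral_FTC_Icc) (auto intro!: derivative_eq_intros)
  also have "\<dots> + ennreal (exp (- l * T)) = ennreal (exp (- l * r))"
    using assms by (subst ennreal_plus[symmetric]) (auto intro: mult_left_mono)
  finally show ?thesis using assms by (simp add: decay_square)
qed

text \<open>By Tonelli, the layer decomposition of the weight passes to weighted norms. The function \<open>p\<close> selects
the time coordinate: the identity for paths, the first projection for functions on the square.\<close>

lemma norm_decay_layers:
  fixes F :: "('m::euclidean_space, 'a::euclidean_space) L2"
  assumes l: "0 \<le> l" and p [measurable]: "p \<in> borel_measurable borel"
    and supp: "AE x in lborel. p x \<notin> {0<..<T} \<longrightarrow> rep_L2 F x = 0"
  shows "ennreal ((norm (mult_L2 (\<lambda>x. decay l T (p x)) F))\<^sup>2)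
    = (\<integral>\<^sup>+\<tau>. ennreal (l * exp (- l * \<tau>)) * indicator {0<..T} \<tau> *
        ennreal ((norm (mult_L2 (indicator {x. p x < \<tau>}) F))\<^sup>2) \<partial>lborel)
      + ennreal (exp (- l * T)) * ennreal ((norm F)\<^sup>2)"
proof -
  define k where "k \<tau> = ennreal (l * exp (- l * \<tau>)) * indicator {0<..T} \<tau>" for \<tau>
  have [measurable]: "k \<in> borel_measurable borel" unfolding k_def by measurable
  let ?f = "\<lambda>x. ennreal ((norm (rep_L2 F x))\<^sup>2)"
  have "ennreal ((norm (mult_L2 (\<lambda>x. decay l T (p x)) F))\<^sup>2) = (\<integral>\<^sup>+x. ennreal ((decay l T (p x))\<^sup>2) * ?f x \<partial>lborel)"
    unfolding ennreal_norm_L2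
  proof (rule nn_integral_cong_AE)
    show "AE x in lborel. ennreal ((norm (rep_L2 (mult_L2 (\<lambda>x. decay l T (p x)) F) x))\<^sup>2)
        = ennreal ((decay l T (p x))\<^sup>2) * ?f x"
      using AE_rep_mult[OF multiplier_decay[OF l p, of T], of F]
      by eventually_elim (simp add: power_mult_distrib ennreal_mult)
  qed
  also have "\<dots> = (\<integral>\<^sup>+x. (\<integral>\<^sup>+\<tau>. k \<tau> * indicator {p x<..} \<tau> * ?f x \<partial>lborel) + ennreal (exp (- l * T)) * ?f x \<partial>lborel)"
  proof (rule nn_integral_cong_AE)
    show "AE x in lborel. ennreal ((decay l T (p x))\<^sup>2) * ?f x
        = (\<integral>\<^sup>+\<tau>. k \<tau> * indicator {p x<..} \<tau> * ?f x \<partial>lborel) + ennreal (exp (- l * T)) * ?f x"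
      using supp
    proof eventually_elim
      case (elim x)
      show ?case
      proof (cases "p x \<in> {0<..<T}")
        case True
        then have "ennreal ((decay l T (p x))\<^sup>2)
            = (\<integral>\<^sup>+\<tau>. k \<tau> * indicator {p x<..} \<tau> \<partial>lborel) + ennreal (exp (- l * T))"
          using decay_layers[OF l, of "p x" T] by (simp add: k_def)
        then show ?thesis by (simp add: nn_integral_multc distrib_right)
      qed (use elim in simp)
    qed
  qed
  also have "\<dots> = (\<integral>\<^sup>+x. \<integral>\<^sup>+\<tau>. k \<tau> * indicator {p x<..} \<tau> * ?f x \<partial>lborel \<partial>lborel) + ennreal (exp (- l * T)) * ennreal ((norm F)\<^sup>2)"
    unfolding ennreal_norm_L2
    by (subst nn_integral_add) (auto simp: nn_integral_cmult indicator_def cong: if_cong)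
  also have "(\<integral>\<^sup>+x. \<integral>\<^sup>+\<tau>. k \<tau> * indicator {p x<..} \<tau> * ?f x \<partial>lborel \<partial>lborel)
      = (\<integral>\<^sup>+\<tau>. \<integral>\<^sup>+x. k \<tau> * indicator {p x<..} \<tau> * ?f x \<partial>lborel \<partial>lborel)"
    by (rule lborel_pair.Fubini') (simp add: indicator_def)
  also have "\<dots> = (\<integral>\<^sup>+\<tau>. k \<tau> * ennreal ((norm (mult_L2 (indicator {x. p x < \<tau>}) F))\<^sup>2) \<partial>lborel)"
  proof (rule nn_integral_cong)
    fix \<tau>
    have m: "multiplier (indicator {x. p x < \<tau>})" by (rule multiplier_indicator) simp
    have "ennreal ((norm (mult_L2 (indicator {x. p x < \<tau>}) F))\<^sup>2) = (\<integral>\<^sup>+x. indicator {p x<..} \<tau> * ?f x \<partial>lborel)"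
      unfolding ennreal_norm_L2
      by (rule nn_integral_cong_AE, rule eventually_mono[OF AE_rep_mult[OF m, of F]]) (auto simp: indicator_def)
    moreover have "(\<lambda>x. indicator {p x<..} \<tau> * ?f x) \<in> borel_measurable borel"
      by (simp add: indicator_def)
    ultimately show "(\<integral>\<^sup>+x. k \<tau> * indicator {p x<..} \<tau> * ?f x \<partial>lborel)
        = k \<tau> * ennreal ((norm (mult_L2 (indicator {x. p x < \<tau>}) F))\<^sup>2)"
      by (simp add: nn_integral_cmult mult.assoc)
  qed
  finally show ?thesis by (simp add: k_def)
qed

text \<open>An inequality between the norms restricted to \<open>p < \<tau>\<close> and \<open>q < \<tau>\<close>, valid for all \<open>\<tau>\<close>, implies the
same inequality between the weighted norms, by integration over the layers.\<close>

lemma norm_decay_comparison: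
  fixes F :: "('m::euclidean_space, 'a::euclidean_space) L2" and G :: "('n::euclidean_space, 'b::euclidean_space) L2"
  assumes l: "0 \<le> l" and C: "0 \<le> C"
    and p: "p \<in> borel_measurable borel" "AE x in lborel. p x \<notin> {0<..<T} \<longrightarrow> rep_L2 F x = 0"
    and q: "q \<in> borel_measurable borel" "AE x in lborel. q x \<notin> {0<..<T} \<longrightarrow> rep_L2 G x = 0"
    and le: "norm F \<le> C * norm G" "\<And>\<tau>. 0 < \<tau> \<Longrightarrow> \<tau> \<le> T \<Longrightarrow>
      norm (mult_L2 (indicator {x. p x < \<tau>}) F) \<le> C * norm (mult_L2 (indicator {x. q x < \<tau>}) G)"
  shows "norm (mult_L2 (\<lambda>x. decay l T (p x)) F) \<le> C * norm (mult_L2 (\<lambda>x. decay l T (q x)) G)"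
proof -
  have sq: "ennreal (x\<^sup>2) \<le> ennreal (C\<^sup>2) * ennreal (y\<^sup>2)" if "x \<le> C * y" "0 \<le> x" for x y
    using power_mono[OF that, of 2] by (simp add: ennreal_mult[symmetric] power_mult_distrib)
  define N where "N \<tau> = ennreal ((norm (mult_L2 (indicator {x. q x < \<tau>}) G))\<^sup>2)" for \<tau>
  define k where "k \<tau> = ennreal (l * exp (- l * \<tau>)) * indicator {0<..T} \<tau>" for \<tau>
  have "ennreal ((norm (mult_L2 (\<lambda>x. decay l T (p x)) F))\<^sup>2)
     = (\<integral>\<^sup>+\<tau>. k \<tau> * ennreal ((norm (mult_L2 (indicator {x. p x < \<tau>}) F))\<^sup>2) \<partial>lborel)
        + ennreal (exp (- l * T)) * ennreal ((norm F)\<^sup>2)"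
    unfolding k_def by (rule norm_decay_layers[OF l p])
  also have "\<dots> \<le> (\<integral>\<^sup>+\<tau>. ennreal (C\<^sup>2) * (k \<tau> * N \<tau>) \<partial>lborel)
        + ennreal (C\<^sup>2) * (ennreal (exp (- l * T)) * ennreal ((norm G)\<^sup>2))"
  proof (intro add_mono nn_integral_mono)
    show "ennreal (exp (- l * T)) * ennreal ((norm F)\<^sup>2) \<le> ennreal (C\<^sup>2) * (ennreal (exp (- l * T)) * ennreal ((norm G)\<^sup>2))"
      using mult_left_mono[OF sq[OF le(1)], of "ennreal (exp (- l * T))"] by (simp add: mult_ac)
    show "k \<tau> * ennreal ((norm (mult_L2 (indicator {x. p x < \<tau>}) F))\<^sup>2) \<le> ennreal (C\<^sup>2) * (k \<tau> * N \<tau>)" for \<tau>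
    proof (cases "\<tau> \<in> {0<..T}")
      case True
      then show ?thesis
        using mult_left_mono[OF sq[OF le(2)], of \<tau> "k \<tau>"] by (simp add: N_def mult_ac)
    qed (simp add: k_def)
  qed
  also have "\<dots> = ennreal (C\<^sup>2) * ((\<integral>\<^sup>+\<tau>. k \<tau> * N \<tau> \<partial>lborel) + ennreal (exp (- l * T)) * ennreal ((norm G)\<^sup>2))"
    (is "_ = _ * ?R")
  proof -
    have "N \<in> borel_measurable borel"
    proof -
      have "mono (\<lambda>\<tau>. (norm (mult_L2 (indicator {x. q x < \<tau>}) G))\<^sup>2)"
      proof (rule monoI, rule power_mono, rule norm_mult_mono)
        fix a b :: real assume "a \<le> b"
        then show "AE x in lborel. norm (indicator {x. q x < a} x *\<^sub>R rep_L2 G x)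
            \<le> norm (indicator {x. q x < b} x *\<^sub>R rep_L2 G x)"
          by (intro AE_I2) (auto simp: indicator_def)
      qed (use q(1) in auto)
      from borel_measurable_mono[OF this] show ?thesis unfolding N_def by measurable
    qed
    moreover have "k \<in> borel_measurable borel" unfolding k_def by measurable
    ultimately show ?thesis by (simp add: nn_integral_cmult distrib_left)
  qed
  also have "?R = ennreal ((norm (mult_L2 (\<lambda>x. decay l T (q x)) G))\<^sup>2)"
    unfolding k_def N_def by (rule norm_decay_layers[OF l q, symmetric])
  finally have "(norm (mult_L2 (\<lambda>x. decay l T (p x)) F))\<^sup>2 \<le> (C * norm (mult_L2 (\<lambda>x. decay l T (q x)) G))\<^sup>2"
    by (simp add: ennreal_mult[symmetric] power_mult_distrib)
  then show ?thesis by (rule power2_le_imp_le) (simp add: C)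
qed

text \<open>The source of the gain \<open>1 / sqrt l\<close>. Let \<open>f\<close> be the time integral and \<open>e\<close> the square root of the
weight. Then \<open>\<parallel>e f\<parallel>\<^sup>2 = \<integral>\<integral> F(r, \<xi>) \<bullet> e(\<xi>)\<^sup>2 f(\<xi>)\<close>, integrated over \<open>s \<le> r \<le> t\<close> and \<open>r \<le> \<xi>\<close>. Splitting
\<open>1 = e(r) / e(r)\<close> and applying the Cauchy-Schwarz inequality leaves the factor
\<open>\<integral>\<^sub>0\<^sup>\<xi> exp(l r) dr \<le> exp(l \<xi>) / l\<close>.\<close>

lemma norm_decay_time_integral:
  fixes F :: "(real \<times> real, 'a::euclidean_space) L2"
  assumes l: "0 < l" and T: "0 < T"
    and supp: "AE z in lborel. \<not> (0 < fst z \<and> fst z \<le> snd z \<and> snd z < T) \<longrightarrow> rep_L2 F z = 0"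
  shows "norm (mult_L2 (decay l T) (time_integral s t F))
    \<le> norm (mult_L2 (\<lambda>z. decay l T (fst z)) F) / sqrt l"
proof -
  let ?e = "decay l T"
  have e: "multiplier ?e" using multiplier_decay[of l "\<lambda>x. x" T] l by simp
  have e1: "multiplier (\<lambda>z::real \<times> real. ?e (fst z))"
    using l by (intro multiplier_decay) (auto simp: borel_prod[symmetric])
  define f where "f = time_integral s t F"
  define g where "g = mult_L2 ?e (mult_L2 ?e f)"
  define D where "D = {z::real \<times> real. 0 < fst z \<and> fst z \<le> snd z \<and> snd z < T}"
  have "{z \<in> space (borel \<Otimes>\<^sub>M borel). 0 < fst z \<and> fst z \<le> snd z \<and> snd z < T} \<in> sets (borel \<Otimes>\<^sub>M borel)"
    by measurable
  then have [measurable]: "D \<in> sets (borel \<Otimes>\<^sub>M borel)" by (simp add: D_def space_pair_measure)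
  \<comment> \<open>the second factor in the Cauchy-Schwarz inequality; the first one is \<open>e(r) F(r, \<xi>)\<close>\<close>
  define H where "H z = (indicator D z * indicator {s..t} (fst z) / ?e (fst z)) *\<^sub>R rep_L2 g (snd z)" for z
  have Hm: "H \<in> borel_measurable (borel \<Otimes>\<^sub>M borel)"
    unfolding H_def by measurable
  have Hint: "(\<integral>\<^sup>+z. ennreal ((norm (H z))\<^sup>2) \<partial>lborel) \<le> ennreal ((norm (mult_L2 ?e f))\<^sup>2 / l)"
  proof -
    have "(\<integral>\<^sup>+z. ennreal ((norm (H z))\<^sup>2) \<partial>lborel) = (\<integral>\<^sup>+r. \<integral>\<^sup>+y. ennreal ((norm (H (r, y)))\<^sup>2) \<partial>lborel \<partial>lborel)"
      using Hm by (intro nn_integral_lborel_pair) (simp add: borel_prod)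
    also have "\<dots> = (\<integral>\<^sup>+y. \<integral>\<^sup>+r. ennreal ((norm (H (r, y)))\<^sup>2) \<partial>lborel \<partial>lborel)"
      using Hm by (intro lborel_pair.Fubini') simp
    also have "\<dots> \<le> (\<integral>\<^sup>+y. ennreal ((norm (rep_L2 (mult_L2 ?e f) y))\<^sup>2 / l) \<partial>lborel)"
    proof (rule nn_integral_mono_AE)
      show "AE y in lborel. (\<integral>\<^sup>+r. ennreal ((norm (H (r, y)))\<^sup>2) \<partial>lborel) \<le> ennreal ((norm (rep_L2 (mult_L2 ?e f) y))\<^sup>2 / l)"
        using AE_rep_mult[OF e, of "mult_L2 ?e f"]
      proof eventually_elim
        case (elim y)
        let ?v = "rep_L2 (mult_L2 ?e f) y"
        show ?case
        proof (cases "0 < y \<and> y < T")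
          case True
          have "(\<integral>\<^sup>+r. ennreal ((norm (H (r, y)))\<^sup>2) \<partial>lborel)
              \<le> (\<integral>\<^sup>+r. ennreal ((?e y)\<^sup>2 * (norm ?v)\<^sup>2) * (ennreal (exp (l * r)) * indicator {0..y} r) \<partial>lborel)"
          proof (rule nn_integral_mono)
            fix r
            have "z / (?e r)\<^sup>2 = exp (l * r) * z" if "0 \<le> r" "r \<le> T" for z
              using decay_square[OF that, of l] by (simp add: exp_minus divide_inverse)
            then show "ennreal ((norm (H (r, y)))\<^sup>2)
                \<le> ennreal ((?e y)\<^sup>2 * (norm ?v)\<^sup>2) * (ennreal (exp (l * r)) * indicator {0..y} r)"
              using True elim
              by (auto simp: H_def g_def D_def indicator_def power_mult_distrib power_divide
                  ennreal_mult[symmetric] mult_ac)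
          qed
          also have "\<dots> = ennreal ((?e y)\<^sup>2 * (norm ?v)\<^sup>2) * (\<integral>\<^sup>+r. ennreal (exp (l * r)) * indicator {0..y} r \<partial>lborel)"
            by (rule nn_integral_cmult) measurable
          also have "(\<integral>\<^sup>+r. ennreal (exp (l * r)) * indicator {0..y} r \<partial>lborel) = ennreal (exp (l * y) / l - exp (l * 0) / l)"
            using True l by (intro nn_integral_FTC_Icc) (auto intro!: derivative_eq_intros)
          also have "ennreal ((?e y)\<^sup>2 * (norm ?v)\<^sup>2) * \<dots> \<le> ennreal ((?e y)\<^sup>2 * (norm ?v)\<^sup>2) * ennreal (exp (l * y) / l)"
            using l by (intro mult_left_mono ennreal_leI) auto
          also have "\<dots> = ennreal ((norm ?v)\<^sup>2 / l)"
            using True l by (simp add: ennreal_mult[symmetric] decay_square exp_minus)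
          finally show ?thesis .
        next
          case False
          then have "H (r, y) = 0" for r by (auto simp: H_def D_def)
          then show ?thesis by simp
        qed
      qed
    qed
    also have "\<dots> = (\<integral>\<^sup>+y. ennreal (1 / l) * ennreal ((norm (rep_L2 (mult_L2 ?e f) y))\<^sup>2) \<partial>lborel)"
      using l by (intro nn_integral_cong) (simp add: ennreal_mult[symmetric])
    also have "\<dots> = ennreal ((norm (mult_L2 ?e f))\<^sup>2 / l)"
      using l by (subst nn_integral_cmult) (simp_all add: ennreal_norm_L2[symmetric] ennreal_mult[symmetric])
    finally show ?thesis .
  qed
  have Hsq: "sq_integrable H"
    using Hm Hint by (subst sq_integrable_iff_nn_integral) (auto simp: borel_prod intro: le_less_trans)
  have normH: "norm (mk_L2 H) \<le> norm (mult_L2 ?e f) / sqrt l"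
  proof (rule power2_le_imp_le)
    have "ennreal ((norm (mk_L2 H))\<^sup>2) \<le> ennreal ((norm (mult_L2 ?e f))\<^sup>2 / l)"
      using Hint by (simp add: ennreal_norm_mk_L2[OF Hsq])
    then show "(norm (mk_L2 H))\<^sup>2 \<le> (norm (mult_L2 ?e f) / sqrt l)\<^sup>2"
      using l by (simp add: power_divide)
  qed (use l in simp)
  have "(norm (mult_L2 ?e f))\<^sup>2 = f \<bullet> g"
  proof -
    have "mult_L2 ?e f \<bullet> mult_L2 ?e f = f \<bullet> g"
      unfolding inner_L2_eq
    proof (rule integral_cong_AE)
      show "AE x in lborel. rep_L2 (mult_L2 ?e f) x \<bullet> rep_L2 (mult_L2 ?e f) x = rep_L2 f x \<bullet> rep_L2 g x"
        using AE_rep_mult[OF e, of f] AE_rep_mult[OF e, of "mult_L2 ?e f"]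
        by eventually_elim (simp add: g_def)
    qed measurable
    then show ?thesis by (simp add: power2_norm_eq_inner)
  qed
  also have "\<dots> = (\<integral>z. rep_L2 F z \<bullet> (indicator {s..t} (fst z) *\<^sub>R rep_L2 g (snd z)) \<partial>lborel)"
    using inner_mk_L2[OF sq_integrable_rep_L2[of F] sq_integrable_time_constant[of s t g]]
    by (simp add: f_def time_integral_adjoint time_constant_def)
  also have "\<dots> = (\<integral>z. (?e (fst z) *\<^sub>R rep_L2 F z) \<bullet> H z \<partial>lborel)"
  proof (rule integral_cong_AE)
    show "AE z in lborel. rep_L2 F z \<bullet> (indicator {s..t} (fst z) *\<^sub>R rep_L2 g (snd z)) = (?e (fst z) *\<^sub>R rep_L2 F z) \<bullet> H z"
      using supp
    proof eventually_elim
      case (elim z)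
      then show ?case
        using decay_pos[of l T "fst z"] by (cases "z \<in> D") (auto simp: H_def D_def)
    qed
    show "(\<lambda>z. rep_L2 F z \<bullet> (indicator {s..t} (fst z) *\<^sub>R rep_L2 g (snd z))) \<in> borel_measurable lborel"
      using measurable_time_constant[of s t g] by (simp del: inner_scaleR_right)
    show "(\<lambda>z. (?e (fst z) *\<^sub>R rep_L2 F z) \<bullet> H z) \<in> borel_measurable lborel"
      using sq_integrable_measurable[OF Hsq] sq_integrable_measurable[OF sq_integrable_mult[OF e1 sq_integrable_rep_L2[of F]]]
      by (simp del: inner_scaleR_left)
  qed
  also have "\<dots> = mult_L2 (\<lambda>z. ?e (fst z)) F \<bullet> mk_L2 H"
    unfolding mult_L2_def using sq_integrable_mult[OF e1 sq_integrable_rep_L2[of F]] Hsq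
    by (rule inner_mk_L2[symmetric])
  also have "\<dots> \<le> norm (mult_L2 (\<lambda>z. ?e (fst z)) F) * norm (mk_L2 H)"
    by (rule norm_cauchy_schwarz)
  also have "\<dots> \<le> norm (mult_L2 (\<lambda>z. ?e (fst z)) F) * (norm (mult_L2 ?e f) / sqrt l)"
    by (intro mult_left_mono normH) simp
  finally have "norm (mult_L2 ?e f) * norm (mult_L2 ?e f) \<le> (norm (mult_L2 (\<lambda>z. ?e (fst z)) F) / sqrt l) * norm (mult_L2 ?e f)"
    by (simp add: power2_eq_square)
  then have "norm (mult_L2 ?e f) \<le> norm (mult_L2 (\<lambda>z. ?e (fst z)) F) / sqrt l"
    by (cases "norm (mult_L2 ?e f) = 0") (use l in \<open>auto intro: mult_right_le_imp_le\<close>)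
  then show ?thesis by (simp add: f_def)
qed

section \<open>Density of the continuous functions\<close>

lemma mk_L2_dominated:
  fixes s :: "nat \<Rightarrow> 'm::euclidean_space \<Rightarrow> 'a::euclidean_space" and w :: "'m \<Rightarrow> real"
  assumes f: "f \<in> borel_measurable borel" and s: "\<And>n. s n \<in> borel_measurable borel"
    and w: "sq_integrable w" and sw: "\<And>n x. norm (s n x) \<le> w x" and fw: "\<And>x. norm (f x) \<le> w x"
    and lim: "AE x in lborel. (\<lambda>n. s n x) \<longlonglongrightarrow> f x"
  shows "(\<lambda>n. mk_L2 (s n)) \<longlonglongrightarrow> mk_L2 f"
proof -
  note [measurable] = f s
  have sq: "sq_integrable (s n)" "sq_integrable f" for n
    by (rule sq_integrable_bound[OF w w, of _ 1 0]; use f s order_trans[OF sw abs_ge_self] order_trans[OF fw abs_ge_self] in simp)+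
  have "(\<lambda>n. \<integral>x. (norm (s n x - f x))\<^sup>2 \<partial>lborel) \<longlonglongrightarrow> (\<integral>x. 0 \<partial>(lborel::'m measure))"
  proof (rule integral_dominated_convergence)
    show "integrable lborel (\<lambda>x. 4 * (w x)\<^sup>2)"
      using w by (simp add: sq_integrable_def)
    show "AE x in lborel. (\<lambda>n. (norm (s n x - f x))\<^sup>2) \<longlonglongrightarrow> 0"
      using lim
    proof eventually_elim
      case (elim x)
      have "(\<lambda>n. (norm (s n x - f x))\<^sup>2) \<longlonglongrightarrow> (norm (f x - f x))\<^sup>2"
        by (intro tendsto_intros elim)
      then show ?case by simp
    qed
    show "AE x in lborel. norm ((norm (s n x - f x))\<^sup>2) \<le> 4 * (w x)\<^sup>2" for n
    proof (intro AE_I2)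
      fix x
      have "norm (s n x - f x) \<le> 2 * w x"
        using sw[of n x] fw[of x] norm_triangle_ineq4[of "s n x" "f x"] by linarith
      then have "(norm (s n x - f x))\<^sup>2 \<le> (2 * w x)\<^sup>2"
        by (intro power_mono) auto
      then show "norm ((norm (s n x - f x))\<^sup>2) \<le> 4 * (w x)\<^sup>2"
        by (simp add: power_mult_distrib)
    qed
  qed measurable
  moreover have "(\<integral>x. (norm (s n x - f x))\<^sup>2 \<partial>lborel) = (norm (mk_L2 (s n) - mk_L2 f))\<^sup>2" for n
    by (simp add: mk_L2_diff[symmetric] sq norm_mk_L2 sq_integrable_diff)
  ultimately have "(\<lambda>n. (norm (mk_L2 (s n) - mk_L2 f))\<^sup>2) \<longlonglongrightarrow> 0"
    by simp
  then have "(\<lambda>n. sqrt ((norm (mk_L2 (s n) - mk_L2 f))\<^sup>2)) \<longlonglongrightarrow> sqrt 0"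
    by (rule tendsto_real_sqrt)
  then have "(\<lambda>n. norm (mk_L2 (s n) - mk_L2 f)) \<longlonglongrightarrow> 0" by simp
  then show ?thesis
    by (rule LIM_zero_cancel[OF tendsto_norm_zero_cancel])
qed

lemma sq_integrable_norm: "sq_integrable f \<Longrightarrow> sq_integrable (\<lambda>x. norm (f x))"
  by (auto simp: sq_integrable_def)

lemma closed_L2_on:
  assumes S: "S \<in> sets borel"
  shows "closed (L2_on S :: ('m::euclidean_space, 'a::euclidean_space) L2 set)"
proof -
  have "continuous_on UNIV (mult_L2 (indicator S) :: ('m, 'a) L2 \<Rightarrow> _)"
    by (intro linear_continuous_on bounded_linear_mult multiplier_indicator S)
  then have "closed {F :: ('m, 'a) L2. mult_L2 (indicator S) F = F}"
    by (intro closed_Collect_eq) auto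
  moreover have "L2_on S = {F :: ('m, 'a) L2. mult_L2 (indicator S) F = F}"
    using L2_on_iff[OF S] by blast
  ultimately show ?thesis by simp
qed

lemma mk_L2_cong_AE:
  assumes "sq_integrable f" "sq_integrable g" "AE x in lborel. f x = g x"
  shows "mk_L2 f = mk_L2 g"
  using assms by (simp add: mk_L2_eq_iff)

lemma sq_integrable_indicator_Icc:
  fixes a b c :: real
  shows "sq_integrable (\<lambda>x. c * indicator {a..b} x :: real)"
proof -
  have "integrable lborel (\<lambda>x. c\<^sup>2 * indicator {a..b} x :: real)"
    by (intro integrable_mult_right integrable_real_indicator) (auto simp: emeasure_lborel_Icc_eq)
  moreover have "(\<lambda>x. (norm (c * indicator {a..b} x :: real))\<^sup>2) = (\<lambda>x. c\<^sup>2 * indicator {a..b} x)"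
    by (auto simp: indicator_def)
  ultimately show ?thesis by (simp add: sq_integrable_def)
qed

lemma sq_integrable_bounded_Icc:
  fixes w :: "real \<Rightarrow> 'a::euclidean_space"
  assumes "w \<in> borel_measurable borel" and "\<And>x. norm (w x) \<le> c * indicator {a..b} x"
  shows "sq_integrable w"
  by (rule sq_integrable_bound[OF sq_integrable_indicator_Icc[of c a b] sq_integrable_indicator_Icc[of c a b] assms(1), of 1 0])
    (use order_trans[OF assms(2) abs_ge_self] in simp)

lemma continuous_Icc_bounded:
  fixes w :: "real \<Rightarrow> 'a::euclidean_space"
  assumes "continuous_on {a..b} w"
  obtains c where "\<And>x. norm (indicator {a..b} x *\<^sub>R w x) \<le> c * indicator {a..b} x"
proof -
  have "bounded (w ` {a..b})"
    by (intro compact_imp_bounded compact_continuous_image assms) simp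
  then obtain c where "\<forall>y\<in>w ` {a..b}. norm y \<le> c" unfolding bounded_iff by blast
  then have "norm (indicator {a..b} x *\<^sub>R w x) \<le> c * indicator {a..b} x" for x
    by (auto simp: indicator_def)
  then show ?thesis by (rule that)
qed

lemma sq_integrable_continuous_Icc:
  fixes w :: "real \<Rightarrow> 'a::euclidean_space"
  assumes "continuous_on {a..b} w"
  shows "sq_integrable (\<lambda>x. indicator {a..b} x *\<^sub>R w x)"
proof -
  obtain c where "\<And>x. norm (indicator {a..b} x *\<^sub>R w x) \<le> c * indicator {a..b} x"
    using continuous_Icc_bounded[OF assms] by blast
  then show ?thesis
    by (intro sq_integrable_bounded_Icc[of _ c a b] borel_measurable_continuous_on_indicator assms) auto
qed

lemma Lambda_spaceI: "continuous_on {0..T} w \<Longrightarrow> mk_L2 (\<lambda>x. indicator {0..T} x *\<^sub>R w x) \<in> Lambda_space T"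
  by (auto simp: Lambda_space_def)

lemma Lambda_spaceE:
  assumes "F \<in> Lambda_space T"
  obtains w where "continuous_on {0..T} w" "F = mk_L2 (\<lambda>x. indicator {0..T} x *\<^sub>R w x)"
  using assms by (auto simp: Lambda_space_def)

lemma subspace_Lambda: "subspace (Lambda_space T)"
proof (unfold subspace_def, intro conjI ballI allI)
  show "0 \<in> Lambda_space T"
    using Lambda_spaceI[of T "\<lambda>_. 0"] by simp
  fix F G :: "(real, real^'d) L2" assume "F \<in> Lambda_space T" "G \<in> Lambda_space T"
  then obtain v w where v: "continuous_on {0..T} v" "F = mk_L2 (\<lambda>x. indicator {0..T} x *\<^sub>R v x)"
    and w: "continuous_on {0..T} w" "G = mk_L2 (\<lambda>x. indicator {0..T} x *\<^sub>R w x)"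
    by (auto simp: Lambda_space_def)
  have "F + G = mk_L2 (\<lambda>x. indicator {0..T} x *\<^sub>R (v x + w x))"
    unfolding v w scaleR_add_right by (intro mk_L2_add[symmetric] sq_integrable_continuous_Icc v w)
  also have "\<dots> \<in> Lambda_space T" by (intro Lambda_spaceI continuous_intros v w)
  finally show "F + G \<in> Lambda_space T" .
next
  fix c and F :: "(real, real^'d) L2" assume "F \<in> Lambda_space T"
  then obtain v where v: "continuous_on {0..T} v" "F = mk_L2 (\<lambda>x. indicator {0..T} x *\<^sub>R v x)"
    by (rule Lambda_spaceE)
  have "c *\<^sub>R F = mk_L2 (\<lambda>x. indicator {0..T} x *\<^sub>R (c *\<^sub>R v x))"
    unfolding v scaleR_left_commute[of _ c] by (intro mk_L2_scaleR[symmetric] sq_integrable_continuous_Icc v)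
  also have "\<dots> \<in> Lambda_space T" by (intro Lambda_spaceI continuous_intros v)
  finally show "c *\<^sub>R F \<in> Lambda_space T" .
qed

lemma AE_lborel_neq2: "AE x in lborel. x \<noteq> a \<and> x \<noteq> (b::real)"
  using AE_lborel_singleton[of a] AE_lborel_singleton[of b] by eventually_elim simp

lemma Lambda_subset_H: "Lambda_space T \<subseteq> H_space T"
proof
  fix F :: "(real, real^'d) L2" assume "F \<in> Lambda_space T"
  then obtain v where v: "continuous_on {0..T} v" "F = mk_L2 (\<lambda>x. indicator {0..T} x *\<^sub>R v x)"
    by (rule Lambda_spaceE)
  have "AE x in lborel. x \<notin> {0<..<T} \<longrightarrow> rep_L2 F x = 0"
    using rep_mk_L2[OF sq_integrable_continuous_Icc[OF v(1)]] AE_lborel_neq2[of 0 T]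
    unfolding v(2) by eventually_elim (auto simp: indicator_def)
  then show "F \<in> H_space T" by (simp add: L2_on_def)
qed

text \<open>For \<open>m > 0\<close>, the radial retraction onto the closed ball of radius \<open>m\<close>.\<close>

definition truncate :: "real \<Rightarrow> 'a::real_normed_vector \<Rightarrow> 'a" where
  "truncate m v = (m / max m (norm v)) *\<^sub>R v"

lemma norm_truncate_le: "0 < m \<Longrightarrow> norm (truncate m v) \<le> m"
  by (auto simp: truncate_def field_simps max_def)

lemma norm_truncate_le_norm: "0 < m \<Longrightarrow> norm (truncate m v) \<le> norm v"
  using mult_right_mono[of "m / max m (norm v)" 1 "norm v"] by (simp add: truncate_def)

lemma truncate_eq: "0 < m \<Longrightarrow> norm v \<le> m \<Longrightarrow> truncate m v = v"
  by (simp add: truncate_def max_def)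

lemma continuous_truncate: "0 < m \<Longrightarrow> continuous_on UNIV (truncate m)"
  unfolding truncate_def by (intro continuous_intros) auto

text \<open>A measurable function is almost everywhere a limit of continuous functions. Truncating them at a
fixed level turns this into convergence in \<open>L\<^sup>2(0,T)\<close>, and the truncations of an element of \<open>H\<close>
converge to it as the level increases.\<close>

lemma H_subset_closure_Lambda: "H_space T \<subseteq> closure (Lambda_space T)"
proof
  fix F :: "(real, real^'d) L2" assume F: "F \<in> H_space T"
  define f where "f = rep_L2 F"
  have f [measurable]: "f \<in> borel_measurable borel" by (simp add: f_def)
  have "f measurable_on UNIV"
    by (intro lebesgue_measurable_imp_measurable_on measurable_completion) auto
  then obtain N g where N: "negligible N" and g: "\<And>n. continuous_on UNIV (g n)"
    and lim: "\<And>x. x \<notin> N \<Longrightarrow> (\<lambda>n::nat. g n x) \<longlonglongrightarrow> f x"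
    by (auto simp: measurable_on_def)
  have tr: "mk_L2 (\<lambda>x. indicator {0..T} x *\<^sub>R truncate (Suc m) (f x)) \<in> closure (Lambda_space T)" for m
  proof -
    have "(\<lambda>n. mk_L2 (\<lambda>x. indicator {0..T} x *\<^sub>R truncate (Suc m) (g n x)))
        \<longlonglongrightarrow> mk_L2 (\<lambda>x. indicator {0..T} x *\<^sub>R truncate (Suc m) (f x))"
    proof (rule mk_L2_dominated)
      have [measurable]: "truncate (real (Suc m)) \<in> borel_measurable (borel :: (real^'d) measure)"
        by (intro borel_measurable_continuous_onI continuous_truncate) simp
      have [measurable]: "g n \<in> borel_measurable borel" for n
        by (intro borel_measurable_continuous_onI g)
      show "(\<lambda>x. indicator {0..T} x *\<^sub>R truncate (Suc m) (f x)) \<in> borel_measurable borel"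
        "(\<lambda>x. indicator {0..T} x *\<^sub>R truncate (Suc m) (g n x)) \<in> borel_measurable borel" for n
        by measurable
      show "sq_integrable (\<lambda>x. real (Suc m) * indicator {0..T} x)" by (rule sq_integrable_indicator_Icc)
      show "norm (indicator {0..T} x *\<^sub>R truncate (Suc m) (f x)) \<le> real (Suc m) * indicator {0..T} x"
        "norm (indicator {0..T} x *\<^sub>R truncate (Suc m) (g n x)) \<le> real (Suc m) * indicator {0..T} x" for n x
        using norm_truncate_le[of "real (Suc m)"] by (auto simp: indicator_def)
      have "AE x in lebesgue. x \<notin> N"
        using N by (intro AE_not_in) (simp add: negligible_iff_null_sets)
      then have "AE x in lborel. x \<notin> N" by (simp add: AE_completion_iff)
      then show "AE x in lborel. (\<lambda>n. indicator {0..T} x *\<^sub>R truncate (Suc m) (g n x))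
          \<longlonglongrightarrow> indicator {0..T} x *\<^sub>R truncate (Suc m) (f x)"
      proof eventually_elim
        case (elim x)
        show ?case
          using continuous_on_tendsto_compose[OF continuous_truncate lim[OF elim]]
          by (intro tendsto_intros) auto
      qed
    qed
    moreover have "mk_L2 (\<lambda>x. indicator {0..T} x *\<^sub>R truncate (Suc m) (g n x)) \<in> closure (Lambda_space T)" for n
      by (rule subsetD[OF closure_subset], intro Lambda_spaceI continuous_on_compose2[OF continuous_truncate continuous_on_subset[OF g]]) auto
    ultimately show ?thesis
      by (rule closed_sequentially[OF closed_closure, rotated])
  qed
  have "(\<lambda>m. mk_L2 (\<lambda>x. indicator {0..T} x *\<^sub>R truncate (Suc m) (f x))) \<longlonglongrightarrow> mk_L2 (\<lambda>x. indicator {0..T} x *\<^sub>R f x)"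
  proof (rule mk_L2_dominated)
    have [measurable]: "truncate (real (Suc m)) \<in> borel_measurable (borel :: (real^'d) measure)" for m
      by (intro borel_measurable_continuous_onI continuous_truncate) simp
    show "(\<lambda>x. indicator {0..T} x *\<^sub>R truncate (Suc m) (f x)) \<in> borel_measurable borel" for m by measurable
    show "(\<lambda>x. indicator {0..T} x *\<^sub>R f x) \<in> borel_measurable borel" by measurable
    show "sq_integrable (\<lambda>x. norm (f x))"
      unfolding f_def by (intro sq_integrable_norm sq_integrable_rep_L2)
    show "norm (indicator {0..T} x *\<^sub>R truncate (Suc m) (f x)) \<le> norm (f x)" for m x
      using norm_truncate_le_norm[of "real (Suc m)"] by (auto simp: indicator_def)
    show "norm (indicator {0..T} x *\<^sub>R f x) \<le> norm (f x)" for x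
      by (auto simp: indicator_def)
    show "AE x in lborel. (\<lambda>m. indicator {0..T} x *\<^sub>R truncate (Suc m) (f x)) \<longlonglongrightarrow> indicator {0..T} x *\<^sub>R f x"
    proof (intro AE_I2 tendsto_intros)
      fix x
      show "(\<lambda>m. truncate (Suc m) (f x)) \<longlonglongrightarrow> f x"
      proof (rule tendsto_eventually, rule eventually_mono[OF eventually_ge_at_top[of "nat \<lceil>norm (f x)\<rceil>"]])
        fix m assume "nat \<lceil>norm (f x)\<rceil> \<le> m"
        then have "norm (f x) \<le> real (Suc m)" by linarith
        then show "truncate (real (Suc m)) (f x) = f x" by (intro truncate_eq) auto
      qed
    qed
  qed
  moreover have "mk_L2 (\<lambda>x. indicator {0..T} x *\<^sub>R f x) = F"
  proof -
    have "AE x in lborel. indicator {0..T} x *\<^sub>R f x = f x"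
      using F by (auto simp: L2_on_def f_def indicator_def elim!: eventually_mono)
    then have "mk_L2 (\<lambda>x. indicator {0..T} x *\<^sub>R f x) = mk_L2 f"
      unfolding f_def by (intro mk_L2_cong_AE sq_integrable_mult multiplier_indicator sq_integrable_rep_L2) auto
    then show ?thesis by (simp add: f_def)
  qed
  ultimately have "(\<lambda>m. mk_L2 (\<lambda>x. indicator {0..T} x *\<^sub>R truncate (Suc m) (f x))) \<longlonglongrightarrow> F"
    by simp
  from closed_sequentially[OF closed_closure tr this] show "F \<in> closure (Lambda_space T)" .
qed

lemma closure_Lambda: "closure (Lambda_space T) = H_space T"
  by (intro antisym H_subset_closure_Lambda closure_minimal Lambda_subset_H closed_L2_on) simp

text \<open>A path that follows \<open>v\<close> until \<open>\<tau>\<close> and \<open>w\<close> afterwards is in general discontinuous at \<open>\<tau>\<close>.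
Interpolating on an interval of length \<open>1/n\<close> gives continuous paths that coincide with \<open>v\<close> before
\<open>\<tau>\<close> and approach the glued path in \<open>L\<^sup>2\<close>.\<close>

lemma cutoff_in_Lambda:
  fixes v w :: "(real, real^'d::finite) L2"
  assumes v: "v \<in> Lambda_space T" and w: "w \<in> Lambda_space T"
  obtains u where "\<And>n::nat. u n \<in> Lambda_space T" "\<And>n. agree_on {0<..<\<tau>} v (u n)"
    "(\<lambda>n. u n - w) \<longlonglongrightarrow> mult_L2 (indicator {x. x < \<tau>}) (v - w)"
proof -
  obtain a where a: "continuous_on {0..T} a" "v = mk_L2 (\<lambda>x. indicator {0..T} x *\<^sub>R a x)"
    using v by (rule Lambda_spaceE)
  obtain b where b: "continuous_on {0..T} b" "w = mk_L2 (\<lambda>x. indicator {0..T} x *\<^sub>R b x)"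
    using w by (rule Lambda_spaceE)
  \<comment> \<open>for \<open>n > 0\<close> equal to 1 before \<open>\<tau>\<close> and to 0 after \<open>\<tau> + 1/n\<close>\<close>
  define \<rho> where "\<rho> n x = max 0 (min 1 (1 - real n * (x - \<tau>)))" for n x
  have \<rho>: "continuous_on A (\<rho> n)" for n A
    unfolding \<rho>_def by (intro continuous_intros)
  have \<rho>01: "0 \<le> \<rho> n x" "\<rho> n x \<le> 1" for n x by (auto simp: \<rho>_def)
  have \<rho>1: "\<rho> n x = 1" if "x < \<tau>" for n x
  proof -
    have "real n * (x - \<tau>) \<le> 0" using that by (intro mult_nonneg_nonpos) auto
    then show ?thesis by (simp add: \<rho>_def)
  qed
  define u where "u n = mk_L2 (\<lambda>x. indicator {0..T} x *\<^sub>R (b x + \<rho> n x *\<^sub>R (a x - b x)))" for n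
  have cont: "continuous_on {0..T} (\<lambda>x. b x + \<rho> n x *\<^sub>R (a x - b x))"
    "continuous_on {0..T} (\<lambda>x. \<rho> n x *\<^sub>R (a x - b x))" "continuous_on {0..T} (\<lambda>x. a x - b x)" for n
    by (intro continuous_intros a b \<rho>)+
  note sq = sq_integrable_continuous_Icc
  show thesis
  proof (rule that)
    show "u n \<in> Lambda_space T" for n
      unfolding u_def by (intro Lambda_spaceI cont)
    show "agree_on {0<..<\<tau>} v (u n)" for n
      unfolding agree_on_def u_def a(2)
      using rep_mk_L2[OF sq[OF a(1)]] rep_mk_L2[OF sq[OF cont(1)[of n]]]
      by eventually_elim (auto simp: \<rho>1)
    have "u n - w = mk_L2 (\<lambda>x. indicator {0..T} x *\<^sub>R (\<rho> n x *\<^sub>R (a x - b x)))" for n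
      unfolding u_def b(2) mk_L2_diff[OF sq[OF cont(1)] sq[OF b(1)], symmetric]
      by (simp add: scaleR_add_right)
    moreover have "(\<lambda>n. mk_L2 (\<lambda>x. indicator {0..T} x *\<^sub>R (\<rho> n x *\<^sub>R (a x - b x))))
      \<longlonglongrightarrow> mk_L2 (\<lambda>x. indicator {x. x < \<tau>} x *\<^sub>R (indicator {0..T} x *\<^sub>R (a x - b x)))"
    proof (rule mk_L2_dominated)
      show "(\<lambda>x. indicator {x. x < \<tau>} x *\<^sub>R (indicator {0..T} x *\<^sub>R (a x - b x))) \<in> borel_measurable borel"
        by (intro sq_integrable_measurable sq_integrable_mult multiplier_indicator sq cont) auto
      show "(\<lambda>x. indicator {0..T} x *\<^sub>R (\<rho> n x *\<^sub>R (a x - b x))) \<in> borel_measurable borel" for n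
        by (intro sq_integrable_measurable sq cont)
      show "sq_integrable (\<lambda>x. norm (indicator {0..T} x *\<^sub>R (a x - b x)))"
        by (intro sq_integrable_norm sq cont)
      show "norm (indicator {0..T} x *\<^sub>R (\<rho> n x *\<^sub>R (a x - b x))) \<le> norm (indicator {0..T} x *\<^sub>R (a x - b x))" for n x
        using \<rho>01[of n x] mult_right_mono[of "\<rho> n x" 1 "norm (a x - b x)"] by (auto simp: indicator_def)
      show "norm (indicator {x. x < \<tau>} x *\<^sub>R (indicator {0..T} x *\<^sub>R (a x - b x)))
          \<le> norm (indicator {0..T} x *\<^sub>R (a x - b x))" for x
        by (auto simp: indicator_def)
      show "AE x in lborel. (\<lambda>n. indicator {0..T} x *\<^sub>R (\<rho> n x *\<^sub>R (a x - b x)))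
          \<longlonglongrightarrow> indicator {x. x < \<tau>} x *\<^sub>R (indicator {0..T} x *\<^sub>R (a x - b x))"
        using AE_lborel_singleton[of \<tau>]
      proof eventually_elim
        case (elim x)
        have "(\<lambda>n. \<rho> n x) \<longlonglongrightarrow> indicator {x. x < \<tau>} x"
        proof (cases "x < \<tau>")
          case False
          with elim have x: "0 < x - \<tau>" by simp
          then obtain k :: nat where k: "1 < real k * (x - \<tau>)"
            using reals_Archimedean3 by blast
          show ?thesis
          proof (rule tendsto_eventually, rule eventually_mono[OF eventually_ge_at_top[of k]])
            fix n assume "k \<le> n"
            then have "real k * (x - \<tau>) \<le> real n * (x - \<tau>)" using x by (intro mult_right_mono) auto
            with k False show "\<rho> n x = indicator {x. x < \<tau>} x" by (simp add: \<rho>_def)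
          qed
        qed (simp add: \<rho>1)
        then have "(\<lambda>n. indicator {0..T} x *\<^sub>R (\<rho> n x *\<^sub>R (a x - b x)))
          \<longlonglongrightarrow> indicator {0..T} x *\<^sub>R (indicator {x. x < \<tau>} x *\<^sub>R (a x - b x))"
          by (intro tendsto_intros)
        then show ?case by (simp add: mult.commute)
      qed
    qed
    moreover have "mk_L2 (\<lambda>x. indicator {x. x < \<tau>} x *\<^sub>R (indicator {0..T} x *\<^sub>R (a x - b x)))
      = mult_L2 (indicator {x. x < \<tau>}) (v - w)"
    proof -
      have vw: "v - w = mk_L2 (\<lambda>x. indicator {0..T} x *\<^sub>R (a x - b x))"
        unfolding a(2) b(2) mk_L2_diff[OF sq[OF a(1)] sq[OF b(1)], symmetric]
        by (simp add: scaleR_diff_right)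
      show ?thesis unfolding mult_L2_def
        using rep_mk_L2[OF sq[OF cont(3)]]
        by (intro mk_L2_cong_AE sq_integrable_mult multiplier_indicator sq cont sq_integrable_rep_L2)
          (auto simp: vw elim!: eventually_mono)
    qed
    ultimately show "(\<lambda>n. u n - w) \<longlonglongrightarrow> mult_L2 (indicator {x. x < \<tau>}) (v - w)" by simp
  qed
qed

section \<open>The drift and its causality\<close>

lemma uniformly_continuous_extension:
  fixes f :: "'a::metric_space \<Rightarrow> 'b::complete_space"
  assumes "uniformly_continuous_on X f"
  shows "\<exists>g. uniformly_continuous_on (closure X) g \<and> (\<forall>x\<in>X. f x = g x)"
  using assms
proof (rule uniformly_continuous_on_extension_on_closure)
  fix g assume "uniformly_continuous_on (closure X) g" "\<And>x. x \<in> X \<Longrightarrow> f x = g x"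
  then show ?thesis by blast
qed

lemma tendsto_norm_powr:
  fixes x :: "'a::real_normed_vector"
  assumes "0 < p" and "(X \<longlongrightarrow> x) F"
  shows "((\<lambda>n. norm (X n) powr p) \<longlongrightarrow> norm x powr p) F"
  using assms by (intro tendsto_powr2 tendsto_intros) auto

lemma set_lborel_pair [measurable (raw)]:
  fixes P :: "real \<times> real \<Rightarrow> bool"
  assumes "Measurable.pred (borel \<Otimes>\<^sub>M borel) P"
  shows "{z. P z} \<in> sets borel"
  using assms by (simp add: pred_def space_pair_measure borel_prod)

text \<open>The value for which the factor \<open>C0 / sqrt l\<close> of the contraction estimate equals \<open>1/2\<close>.\<close>

definition decay_rate :: "real \<Rightarrow> real" where "decay_rate C0 = 4 * C0\<^sup>2"

definition norm_ratio :: "real \<Rightarrow> real \<Rightarrow> real" where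
  "norm_ratio T C0 = exp (- decay_rate C0 * T / 2)"

locale smooth_drift =
  fixes T C0 \<gamma> :: real and B :: "(real, real^'d::finite) L2 \<Rightarrow> (real \<times> real, real^'d) L2"
  assumes T: "0 < T" and C0: "0 < C0" and \<gamma>: "0 < \<gamma>" and smooth: "smooth_volterra_drift T C0 \<gamma> B"
begin

abbreviation Lam :: "(real, real^'d) L2 set" where "Lam \<equiv> Lambda_space T"
abbreviation H :: "(real, real^'d) L2 set" where "H \<equiv> H_space T"
abbreviation P :: "(real, real^'d) L2 \<Rightarrow> (real, real^'d) L2" where
  "P \<equiv> mult_L2 (indicator {0<..<T})"

lemma drift: "volterra_drift T C0 B"
  using smooth by (simp add: smooth_volterra_drift_def)

lemma
  shows B_in: "w \<in> Lam \<Longrightarrow> B w \<in> Hsq_space T"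
    and B_lipschitz: "w1 \<in> Lam \<Longrightarrow> w2 \<in> Lam \<Longrightarrow> norm (B w1 - B w2) \<le> C0 * norm (w1 - w2)"
    and B_volterra: "w \<in> Lam \<Longrightarrow> AE r in lborel. r \<in> {0<..<T} \<longrightarrow> agree_on {0<..<r} (L2_section (B w) r) 0"
    and B_causal: "w1 \<in> Lam \<Longrightarrow> w2 \<in> Lam \<Longrightarrow> 0 < t \<Longrightarrow> t \<le> T \<Longrightarrow> agree_on {0<..<t} w1 w2 \<Longrightarrow>
      AE r in lborel. r \<in> {0<..<t} \<longrightarrow> L2_section (B w1) r = L2_section (B w2) r"
  using drift T by (auto simp: volterra_drift_def)

lemma
  shows B_derivative: "w \<in> Lam \<Longrightarrow> (B has_derivative D_Lambda T B w) (at w within Lam)"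
    and D_Lambda_hoelder: "w1 \<in> Lam \<Longrightarrow> w2 \<in> Lam \<Longrightarrow> h \<in> Lam \<Longrightarrow>
      norm (D_Lambda T B w1 h - D_Lambda T B w2 h) \<le> C0 * norm (w1 - w2) powr \<gamma> * norm h"
  using smooth by (auto simp: smooth_volterra_drift_def frechet_derivative_works)

lemma multiplier_P: "multiplier (indicator {0<..<T} :: real \<Rightarrow> real)"
  by (rule multiplier_indicator) simp

lemma P_in_H: "P w \<in> H"
  by (rule mult_in_L2_on) simp

lemma P_eq: "w \<in> H \<Longrightarrow> P w = w"
  by (simp add: L2_on_iff[symmetric])

sublocale P: bounded_linear P
  by (rule bounded_linear_mult[OF multiplier_P])

lemma norm_P_le: "norm (P w) \<le> norm w"
  by (rule norm_mult_le[OF multiplier_P])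

lemma subspace_H: "subspace H"
  by (rule subspace_L2_on) simp

lemma Lam_H: "w \<in> Lam \<Longrightarrow> w \<in> H"
  using Lambda_subset_H by blast

text \<open>A sequence of continuous paths that approximates \<open>w\<close>. Closed conditions on \<open>Lam\<close> are transferred to
\<open>H\<close> along such sequences.\<close>

definition approx :: "(real, real^'d) L2 \<Rightarrow> nat \<Rightarrow> (real, real^'d) L2" where
  "approx w = (SOME X. (\<forall>n. X n \<in> Lam) \<and> X \<longlonglongrightarrow> w)"

lemma
  assumes "w \<in> H"
  shows approx_in: "approx w n \<in> Lam" and approx_tendsto: "approx w \<longlonglongrightarrow> w"
proof -
  have "\<exists>X. (\<forall>n. X n \<in> Lam) \<and> X \<longlonglongrightarrow> w"
    using assms unfolding closure_Lambda[symmetric] closure_sequential .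
  from someI_ex[OF this] have "(\<forall>n. approx w n \<in> Lam) \<and> approx w \<longlonglongrightarrow> w"
    unfolding approx_def .
  then show "approx w n \<in> Lam" "approx w \<longlonglongrightarrow> w" by simp_all
qed

text \<open>The Volterra property, collected from almost all sections into a statement about the support on the
square.\<close>

lemma B_support:
  assumes w: "w \<in> Lam"
  shows "B w \<in> L2_on {z. 0 < fst z \<and> fst z \<le> snd z \<and> snd z < T}"
proof -
  let ?F = "rep_L2 (B w)"
  have [measurable]: "?F \<in> borel_measurable (borel \<Otimes>\<^sub>M borel)" by (simp add: borel_prod)
  have "AE z in lborel. 0 < fst z \<and> fst z < T \<and> 0 < snd z \<and> snd z < fst z \<longrightarrow> ?F z = 0"
  proof (rule AE_lborel_pairI)
    show "{z. 0 < fst z \<and> fst z < T \<and> 0 < snd z \<and> snd z < fst z \<longrightarrow> ?F z = 0} \<in> sets borel"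
      by measurable
    show "AE r in lborel. AE y in lborel. 0 < fst (r, y) \<and> fst (r, y) < T \<and> 0 < snd (r, y) \<and> snd (r, y) < fst (r, y) \<longrightarrow> ?F (r, y) = 0"
      using B_volterra[OF w] AE_rep_section[of "B w"]
    proof eventually_elim
      case (elim r)
      show ?case
      proof (cases "0 < r \<and> r < T")
        case True
        with elim(1) have "AE y in lborel. y \<in> {0<..<r} \<longrightarrow> rep_L2 (L2_section (B w) r) y = rep_L2 0 y"
          by (simp add: agree_on_def)
        with elim(2) AE_rep_0 show ?thesis by eventually_elim auto
      next
        case False
        then show ?thesis by (intro AE_I2) auto
      qed
    qed
  qed
  moreover have "AE z in lborel. z \<notin> {0<..<T} \<times> {0<..<T} \<longrightarrow> ?F z = 0"
    using B_in[OF w] by (simp add: L2_on_def)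
  ultimately have "AE z in lborel. z \<notin> {z. 0 < fst z \<and> fst z \<le> snd z \<and> snd z < T} \<longrightarrow> ?F z = 0"
    by eventually_elim force
  then show ?thesis by (simp add: L2_on_def)
qed

text \<open>Before time \<open>\<tau>\<close> the drift does not change if \<open>v\<close> is replaced by a path that continues close to \<open>w\<close>
after \<open>\<tau>\<close>, so only the difference of \<open>v\<close> and \<open>w\<close> before \<open>\<tau>\<close> contributes to the Lipschitz
estimate.\<close>

lemma B_causal_lipschitz:
  assumes v: "v \<in> Lam" and w: "w \<in> Lam" and \<tau>: "0 < \<tau>" "\<tau> \<le> T"
  shows "norm (mult_L2 (indicator {z. fst z < \<tau>}) (B v - B w)) \<le> C0 * norm (mult_L2 (indicator {x. x < \<tau>}) (v - w))"
proof -
  obtain u where u: "\<And>n::nat. u n \<in> Lam" "\<And>n. agree_on {0<..<\<tau>} v (u n)"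
    "(\<lambda>n. u n - w) \<longlonglongrightarrow> mult_L2 (indicator {x. x < \<tau>}) (v - w)"
    using cutoff_in_Lambda[OF v w] by metis
  have "{z::real \<times> real. fst z < \<tau>} \<in> sets borel" by measurable
  then have m: "multiplier (indicator {z::real \<times> real. fst z < \<tau>})" by (rule multiplier_indicator)
  have le: "norm (mult_L2 (indicator {z. fst z < \<tau>}) (B v - B w)) \<le> C0 * norm (u n - w)" for n
  proof -
    have [measurable]: "rep_L2 (B x) \<in> borel_measurable (borel \<Otimes>\<^sub>M borel)" for x by (simp add: borel_prod)
    have "AE z in lborel. 0 < fst z \<and> fst z < \<tau> \<longrightarrow> rep_L2 (B v) z = rep_L2 (B (u n)) z"
    proof (rule AE_lborel_pairI)
      show "{z. 0 < fst z \<and> fst z < \<tau> \<longrightarrow> rep_L2 (B v) z = rep_L2 (B (u n)) z} \<in> sets borel"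
        by measurable
      show "AE r in lborel. AE y in lborel. 0 < fst (r, y) \<and> fst (r, y) < \<tau> \<longrightarrow> rep_L2 (B v) (r, y) = rep_L2 (B (u n)) (r, y)"
        using B_causal[OF v u(1) \<tau> u(2), of n] AE_rep_section[of "B v"] AE_rep_section[of "B (u n)"]
      proof eventually_elim
        case (elim r)
        show ?case
        proof (cases "0 < r \<and> r < \<tau>")
          case True
          with elim(1) have eq: "L2_section (B v) r = L2_section (B (u n)) r" by simp
          from elim(2,3) show ?thesis by eventually_elim (simp add: eq)
        next
          case False
          then show ?thesis by (intro AE_I2) auto
        qed
      qed
    qed
    moreover have "AE z in lborel. z \<notin> {0<..<T} \<times> {0<..<T} \<longrightarrow> rep_L2 (B x) z = 0" if "x \<in> Lam" for x
      using B_in[OF that] by (simp add: L2_on_def)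
    note this[OF v] this[OF u(1)[of n]]
    ultimately have "AE z in lborel. rep_L2 (mult_L2 (indicator {z. fst z < \<tau>}) (B v - B w)) z
        = rep_L2 (mult_L2 (indicator {z. fst z < \<tau>}) (B (u n) - B w)) z"
      using AE_rep_mult[OF m, of "B v - B w"] AE_rep_mult[OF m, of "B (u n) - B w"]
        AE_rep_diff[of "B v" "B w"] AE_rep_diff[of "B (u n)" "B w"]
    proof eventually_elim
      case (elim z)
      then show ?case by (cases "0 < fst z") (auto simp: indicator_def mem_Times_iff)
    qed
    then have "mult_L2 (indicator {z. fst z < \<tau>}) (B v - B w) = mult_L2 (indicator {z. fst z < \<tau>}) (B (u n) - B w)"
      by (rule L2_eqI)
    also have "norm \<dots> \<le> norm (B (u n) - B w)" by (rule norm_mult_le[OF m])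
    also have "\<dots> \<le> C0 * norm (u n - w)" by (rule B_lipschitz[OF u(1) w])
    finally show ?thesis .
  qed
  have "(\<lambda>n. C0 * norm (u n - w)) \<longlonglongrightarrow> C0 * norm (mult_L2 (indicator {x. x < \<tau>}) (v - w))"
    by (intro tendsto_intros u(3))
  then show ?thesis by (rule LIMSEQ_le_const) (intro exI allI impI le)
qed

section \<open>The continuous extension of the drift\<close>

text \<open>\<open>B\<close> is uniformly continuous on a dense subspace, so the extension chosen by \<open>Bbar\<close> exists.\<close>

lemma Bbar_extends: "continuous_on H (Bbar T B) \<and> (\<forall>w\<in>Lam. Bbar T B w = B w)"
proof -
  have "C0-lipschitz_on Lam B"
    using B_lipschitz C0 by (intro lipschitz_onI) (auto simp: dist_norm)
  then have "uniformly_continuous_on Lam B" by (rule lipschitz_on_uniformly_continuous)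
  then obtain G where "uniformly_continuous_on (closure Lam) G" "\<And>w. w \<in> Lam \<Longrightarrow> B w = G w"
    using uniformly_continuous_extension by blast
  then have "continuous_on H G \<and> (\<forall>w\<in>Lam. G w = B w)"
    by (simp add: closure_Lambda uniformly_continuous_imp_continuous)
  from someI[of "\<lambda>G. continuous_on H G \<and> (\<forall>w\<in>Lam. G w = B w)", OF this] show ?thesis
    unfolding Bbar_def .
qed

lemma B_tendsto_Bbar:
  assumes X: "\<And>n. X n \<in> Lam" "X \<longlonglongrightarrow> w"
  shows "(\<lambda>n. B (X n)) \<longlonglongrightarrow> Bbar T B w"
proof -
  have "closed H" by (rule closed_L2_on) simp
  moreover have X_H: "X n \<in> H" for n by (rule Lam_H[OF X(1)])
  ultimately have w: "w \<in> H" using X(2) by (rule closed_sequentially)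
  have cont: "continuous_on H (Bbar T B)" using Bbar_extends by simp
  have "Bbar T B (X n) = B (X n)" for n using Bbar_extends X(1) by blast
  moreover have "(\<lambda>n. Bbar T B (X n)) \<longlonglongrightarrow> Bbar T B w"
    by (rule continuous_on_tendsto_compose[OF cont X(2) w]) (simp add: X_H)
  ultimately show ?thesis by (simp only:)
qed

lemma Bbar_support:
  assumes "w \<in> H"
  shows "Bbar T B w \<in> L2_on {z. 0 < fst z \<and> fst z \<le> snd z \<and> snd z < T}"
proof -
  define X where "X = approx w"
  have X: "\<And>n. X n \<in> Lam" "X \<longlonglongrightarrow> w"
    unfolding X_def by (intro approx_in approx_tendsto assms)+
  have "{z::real \<times> real. 0 < fst z \<and> fst z \<le> snd z \<and> snd z < T} \<in> sets borel" by measurable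
  from closed_sequentially[OF closed_L2_on[OF this] B_support[OF X(1)] B_tendsto_Bbar[OF X]]
  show ?thesis .
qed

lemma Bbar_lipschitz:
  assumes v: "v \<in> H" and w: "w \<in> H"
  shows "norm (Bbar T B v - Bbar T B w) \<le> C0 * norm (v - w)"
proof -
  define X where "X = approx v"
  have X: "\<And>n. X n \<in> Lam" "X \<longlonglongrightarrow> v"
    unfolding X_def by (intro approx_in approx_tendsto v)+
  define Y where "Y = approx w"
  have Y: "\<And>n. Y n \<in> Lam" "Y \<longlonglongrightarrow> w"
    unfolding Y_def by (intro approx_in approx_tendsto w)+
  have "(\<lambda>n. norm (B (X n) - B (Y n))) \<longlonglongrightarrow> norm (Bbar T B v - Bbar T B w)"
    "(\<lambda>n. C0 * norm (X n - Y n)) \<longlonglongrightarrow> C0 * norm (v - w)"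
    by (intro tendsto_intros B_tendsto_Bbar X Y)+
  then show ?thesis by (rule LIMSEQ_le) (intro exI allI impI B_lipschitz X Y)
qed

lemma Bbar_causal_lipschitz:
  assumes v: "v \<in> H" and w: "w \<in> H" and \<tau>: "0 < \<tau>" "\<tau> \<le> T"
  shows "norm (mult_L2 (indicator {z. fst z < \<tau>}) (Bbar T B v - Bbar T B w))
    \<le> C0 * norm (mult_L2 (indicator {x. x < \<tau>}) (v - w))"
proof -
  define X where "X = approx v"
  have X: "\<And>n. X n \<in> Lam" "X \<longlonglongrightarrow> v"
    unfolding X_def by (intro approx_in approx_tendsto v)+
  define Y where "Y = approx w"
  have Y: "\<And>n. Y n \<in> Lam" "Y \<longlonglongrightarrow> w"
    unfolding Y_def by (intro approx_in approx_tendsto w)+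
  have "{z::real \<times> real. fst z < \<tau>} \<in> sets borel" by measurable
  then interpret m1: bounded_linear "mult_L2 (indicator {z::real \<times> real. fst z < \<tau>}) :: _ \<Rightarrow> (real \<times> real, real^'d) L2"
    by (intro bounded_linear_mult multiplier_indicator)
  interpret m2: bounded_linear "mult_L2 (indicator {x::real. x < \<tau>}) :: _ \<Rightarrow> (real, real^'d) L2"
    by (intro bounded_linear_mult multiplier_indicator) simp
  have "(\<lambda>n. norm (mult_L2 (indicator {z. fst z < \<tau>}) (B (X n) - B (Y n))))
      \<longlonglongrightarrow> norm (mult_L2 (indicator {z. fst z < \<tau>}) (Bbar T B v - Bbar T B w))"
    "(\<lambda>n. C0 * norm (mult_L2 (indicator {x. x < \<tau>}) (X n - Y n))) \<longlonglongrightarrow> C0 * norm (mult_L2 (indicator {x. x < \<tau>}) (v - w))"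
    by (intro tendsto_intros m1.tendsto m2.tendsto B_tendsto_Bbar X Y)+
  then show ?thesis by (rule LIMSEQ_le) (intro exI allI impI B_causal_lipschitz X Y \<tau>)
qed

section \<open>The derivative of the extended drift\<close>

lemma linear_D_Lambda: "w \<in> Lam \<Longrightarrow> bounded_linear (D_Lambda T B w)"
  using B_derivative has_derivative_bounded_linear by blast

lemma segment_in_Lam: "w1 \<in> Lam \<Longrightarrow> w2 \<in> Lam \<Longrightarrow> w1 + \<theta> *\<^sub>R (w2 - w1) \<in> Lam"
  by (intro subspace_add subspace_scale subspace_diff subspace_Lambda)

text \<open>The mean value inequality on the segment from \<open>w1\<close> to \<open>w2\<close>. It is applied to a function of one real
variable, because the operator norm of \<open>D_Lambda\<close> is controlled only on \<open>Lam\<close>.\<close>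

lemma B_taylor:
  assumes w1: "w1 \<in> Lam" and w2: "w2 \<in> Lam"
  shows "norm (B w2 - B w1 - D_Lambda T B w1 (w2 - w1)) \<le> C0 * norm (w2 - w1) powr (1 + \<gamma>)"
proof -
  define h where "h = w2 - w1"
  have h: "h \<in> Lam" unfolding h_def by (intro subspace_diff subspace_Lambda w1 w2)
  have seg: "w1 + \<theta> *\<^sub>R h \<in> Lam" for \<theta> using segment_in_Lam[OF w1 w2] by (simp add: h_def)
  define f where "f \<theta> = B (w1 + \<theta> *\<^sub>R h) - \<theta> *\<^sub>R D_Lambda T B w1 h" for \<theta>
  define f' where "f' \<theta> y = D_Lambda T B (w1 + \<theta> *\<^sub>R h) (y *\<^sub>R h) - y *\<^sub>R D_Lambda T B w1 h" for \<theta> y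
  have "norm (f 1 - f 0) \<le> C0 * norm h powr (1 + \<gamma>) * norm (1 - 0 :: real)"
  proof (rule differentiable_bound)
    fix \<theta> :: real assume \<theta>: "\<theta> \<in> {0..1}"
    have "((\<lambda>\<theta>. B (w1 + \<theta> *\<^sub>R h)) has_derivative (\<lambda>y. D_Lambda T B (w1 + \<theta> *\<^sub>R h) (y *\<^sub>R h))) (at \<theta> within {0..1})"
    proof (rule has_derivative_in_compose2[where t = Lam and g' = "D_Lambda T B"])
      show "((\<lambda>\<theta>. w1 + \<theta> *\<^sub>R h) has_derivative (\<lambda>y. y *\<^sub>R h)) (at \<theta> within {0..1})"
        by (auto intro!: derivative_eq_intros)
    qed (use B_derivative seg \<theta> in auto)
    then show "(f has_derivative f' \<theta>) (at \<theta> within {0..1})"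
      unfolding f_def f'_def by (auto intro!: derivative_eq_intros)
    show "onorm (f' \<theta>) \<le> C0 * norm h powr (1 + \<gamma>)"
    proof (rule onorm_bound)
      fix y :: real
      interpret D: bounded_linear "D_Lambda T B (w1 + \<theta> *\<^sub>R h)" by (rule linear_D_Lambda[OF seg])
      have "norm (f' \<theta> y) = \<bar>y\<bar> * norm (D_Lambda T B (w1 + \<theta> *\<^sub>R h) h - D_Lambda T B w1 h)"
        unfolding f'_def by (simp add: D.scaleR scaleR_diff_right[symmetric] del: scaleR_diff_right)
      also have "\<dots> \<le> \<bar>y\<bar> * (C0 * norm (\<theta> *\<^sub>R h) powr \<gamma> * norm h)"
        using D_Lambda_hoelder[OF seg w1 h, of \<theta>] by (intro mult_left_mono) auto
      also have "\<dots> \<le> \<bar>y\<bar> * (C0 * norm h powr \<gamma> * norm h)"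
        using \<theta> C0 \<gamma> by (intro mult_left_mono mult_right_mono powr_mono2) (auto intro: mult_left_le_one_le)
      also have "\<dots> = C0 * norm h powr (1 + \<gamma>) * norm y"
        by (simp add: powr_add)
      finally show "norm (f' \<theta> y) \<le> C0 * norm h powr (1 + \<gamma>) * norm y" .
    qed (use C0 in simp)
  qed auto
  moreover have "f 1 - f 0 = B w2 - B w1 - D_Lambda T B w1 (w2 - w1)"
    by (simp add: f_def h_def)
  ultimately show ?thesis by (simp add: h_def)
qed

text \<open>Composed with the projection onto \<open>H\<close>, the derivatives at continuous paths form a uniformly
continuous map into the complete space of bounded operators, so they extend to the closure.\<close>

lemma derivative_extension:
  "\<exists>D :: (real, real^'d) L2 \<Rightarrow> (real, real^'d) L2 \<Rightarrow>\<^sub>L (real \<times> real, real^'d) L2.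
    continuous_on H D \<and>
    (\<forall>w\<in>Lam. \<forall>h\<in>Lam. blinfun_apply (D w) h = D_Lambda T B w h) \<and>
    (\<forall>v\<in>Lam. \<forall>w\<in>Lam. norm (D v - D w) \<le> C0 * norm (v - w) powr \<gamma>)"
proof -
  define D0 where "D0 w = Blinfun (\<lambda>h. D_Lambda T B w (P h))" for w
  have D0: "blinfun_apply (D0 w) h = D_Lambda T B w (P h)" if "w \<in> Lam" for w h
  proof -
    have "bounded_linear (\<lambda>h. D_Lambda T B w (P h))"
      by (intro bounded_linear_compose[OF linear_D_Lambda[OF that]] P.bounded_linear_axioms)
    then show ?thesis by (simp add: D0_def bounded_linear_Blinfun_apply)
  qed
  have hoelder: "norm (D0 v - D0 w) \<le> C0 * norm (v - w) powr \<gamma>" if v: "v \<in> Lam" and w: "w \<in> Lam" for v w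
  proof (rule norm_blinfun_bound)
    fix h
    define X where "X = approx (P h)"
    have X: "\<And>n. X n \<in> Lam" "X \<longlonglongrightarrow> P h"
      unfolding X_def by (intro approx_in approx_tendsto P_in_H)+
    interpret v: bounded_linear "D_Lambda T B v" by (rule linear_D_Lambda[OF v])
    interpret w: bounded_linear "D_Lambda T B w" by (rule linear_D_Lambda[OF w])
    have "(\<lambda>n. norm (D_Lambda T B v (X n) - D_Lambda T B w (X n))) \<longlonglongrightarrow> norm (D_Lambda T B v (P h) - D_Lambda T B w (P h))"
      "(\<lambda>n. C0 * norm (v - w) powr \<gamma> * norm (X n)) \<longlonglongrightarrow> C0 * norm (v - w) powr \<gamma> * norm (P h)"
      by (intro tendsto_norm tendsto_diff tendsto_mult_left v.tendsto w.tendsto X)+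
    then have "norm (D_Lambda T B v (P h) - D_Lambda T B w (P h)) \<le> C0 * norm (v - w) powr \<gamma> * norm (P h)"
      by (rule LIMSEQ_le) (intro exI allI impI D_Lambda_hoelder[OF v w X(1)])
    also have "\<dots> \<le> C0 * norm (v - w) powr \<gamma> * norm h"
      using C0 norm_P_le by (intro mult_left_mono) auto
    finally show "norm (blinfun_apply (D0 v - D0 w) h) \<le> C0 * norm (v - w) powr \<gamma> * norm h"
      by (simp add: blinfun.diff_left D0 v w)
  qed (use C0 in simp)
  have "uniformly_continuous_on Lam D0"
    unfolding uniformly_continuous_on_def
  proof (intro allI impI)
    fix e :: real assume e: "0 < e"
    \<comment> \<open>the solution of \<open>C0 * d powr \<gamma> = e\<close>\<close>
    define d where "d = (e / C0) powr (1 / \<gamma>)"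
    have d: "0 < d" "C0 * d powr \<gamma> = e" using e C0 \<gamma> by (simp_all add: d_def powr_powr)
    have "dist (D0 w) (D0 v) < e" if "v \<in> Lam" "w \<in> Lam" "dist w v < d" for v w
    proof -
      have "dist (D0 w) (D0 v) \<le> C0 * dist w v powr \<gamma>"
        using hoelder[OF that(2,1)] by (simp add: dist_norm)
      also have "\<dots> < C0 * d powr \<gamma>"
        using C0 \<gamma> that(3) by (intro mult_strict_left_mono powr_less_mono2) auto
      finally show ?thesis using d by simp
    qed
    with d(1) show "\<exists>d>0. \<forall>v\<in>Lam. \<forall>w\<in>Lam. dist w v < d \<longrightarrow> dist (D0 w) (D0 v) < e" by blast
  qed
  then obtain D where D: "uniformly_continuous_on (closure Lam) D" "\<And>w. w \<in> Lam \<Longrightarrow> D0 w = D w"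
    using uniformly_continuous_extension by blast
  show ?thesis
  proof (intro exI[of _ D] conjI ballI)
    show "continuous_on H D"
      using D(1) by (simp add: closure_Lambda uniformly_continuous_imp_continuous)
    show "blinfun_apply (D w) h = D_Lambda T B w h" if "w \<in> Lam" "h \<in> Lam" for w h
      using that D0[of w h] D(2)[of w] by (simp add: P_eq Lam_H)
    show "norm (D v - D w) \<le> C0 * norm (v - w) powr \<gamma>" if "v \<in> Lam" "w \<in> Lam" for v w
      using hoelder[OF that] that D(2) by simp
  qed
qed

text \<open>Derivatives within a subspace agree on that subspace, as one sees by restricting to a line. Hence
the choice made by \<open>frechet_derivative\<close> is immaterial for arguments in \<open>H\<close>.\<close>

lemma derivative_unique_on_H:
  fixes f :: "(real, real^'d) L2 \<Rightarrow> 'y::real_normed_vector"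
  assumes f: "(f has_derivative f1) (at w within H)" "(f has_derivative f2) (at w within H)"
    and w: "w \<in> H" and h: "h \<in> H"
  shows "f1 h = f2 h"
proof -
  have line: "((\<lambda>\<theta>::real. w + \<theta> *\<^sub>R h) has_derivative (\<lambda>y. y *\<^sub>R h)) (at 0)"
    by (auto intro!: derivative_eq_intros)
  have sub: "range (\<lambda>\<theta>::real. w + \<theta> *\<^sub>R h) \<subseteq> H"
    using subspace_H w h by (auto intro!: subspace_add subspace_scale)
  have "((\<lambda>\<theta>::real. f (w + \<theta> *\<^sub>R h)) has_derivative (\<lambda>y. g (y *\<^sub>R h))) (at 0)"
    if "(f has_derivative g) (at w within H)" for g
    using has_derivative_in_compose[OF line, of f g] has_derivative_subset[OF that sub] by simp
  from has_derivative_unique[OF this[OF f(1)] this[OF f(2)]] have "f1 (1 *\<^sub>R h) = f2 (1 *\<^sub>R h)"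
    by (rule fun_cong)
  then show ?thesis by simp
qed

definition Dbar :: "(real, real^'d) L2 \<Rightarrow> (real, real^'d) L2 \<Rightarrow>\<^sub>L (real \<times> real, real^'d) L2" where
  "Dbar = (SOME D. continuous_on H D \<and>
    (\<forall>w\<in>Lam. \<forall>h\<in>Lam. blinfun_apply (D w) h = D_Lambda T B w h) \<and>
    (\<forall>v\<in>Lam. \<forall>w\<in>Lam. norm (D v - D w) \<le> C0 * norm (v - w) powr \<gamma>))"

lemma
  shows continuous_Dbar: "continuous_on H Dbar"
    and Dbar_eq: "w \<in> Lam \<Longrightarrow> h \<in> Lam \<Longrightarrow> blinfun_apply (Dbar w) h = D_Lambda T B w h"
    and Dbar_hoelder_Lam: "v \<in> Lam \<Longrightarrow> w \<in> Lam \<Longrightarrow> norm (Dbar v - Dbar w) \<le> C0 * norm (v - w) powr \<gamma>"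
  using someI_ex[OF derivative_extension] unfolding Dbar_def[symmetric] by auto

lemma Dbar_tendsto:
  assumes "\<And>n. X n \<in> Lam" "X \<longlonglongrightarrow> w" "w \<in> H"
  shows "(\<lambda>n. Dbar (X n)) \<longlonglongrightarrow> Dbar w"
  by (rule continuous_on_tendsto_compose[OF continuous_Dbar assms(2,3)]) (simp add: assms(1) Lam_H)

lemma Dbar_hoelder:
  assumes v: "v \<in> H" and w: "w \<in> H"
  shows "norm (Dbar v - Dbar w) \<le> C0 * norm (v - w) powr \<gamma>"
proof -
  define X where "X = approx v"
  have X: "\<And>n. X n \<in> Lam" "X \<longlonglongrightarrow> v"
    unfolding X_def by (intro approx_in approx_tendsto v)+
  define Y where "Y = approx w"
  have Y: "\<And>n. Y n \<in> Lam" "Y \<longlonglongrightarrow> w"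
    unfolding Y_def by (intro approx_in approx_tendsto w)+
  have "(\<lambda>n. norm (Dbar (X n) - Dbar (Y n))) \<longlonglongrightarrow> norm (Dbar v - Dbar w)"
    "(\<lambda>n. C0 * norm (X n - Y n) powr \<gamma>) \<longlonglongrightarrow> C0 * norm (v - w) powr \<gamma>"
    by (intro tendsto_norm tendsto_diff tendsto_mult_left tendsto_norm_powr Dbar_tendsto X Y v w \<gamma>)+
  then show ?thesis by (rule LIMSEQ_le) (intro exI allI impI Dbar_hoelder_Lam X Y)
qed

lemma Bbar_taylor:
  assumes v: "v \<in> H" and w: "w \<in> H"
  shows "norm (Bbar T B w - Bbar T B v - blinfun_apply (Dbar v) (w - v)) \<le> C0 * norm (w - v) powr (1 + \<gamma>)"
proof -
  define X where "X = approx v"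
  have X: "\<And>n. X n \<in> Lam" "X \<longlonglongrightarrow> v"
    unfolding X_def by (intro approx_in approx_tendsto v)+
  define Y where "Y = approx w"
  have Y: "\<And>n. Y n \<in> Lam" "Y \<longlonglongrightarrow> w"
    unfolding Y_def by (intro approx_in approx_tendsto w)+
  have "(\<lambda>n. norm (B (Y n) - B (X n) - blinfun_apply (Dbar (X n)) (Y n - X n)))
      \<longlonglongrightarrow> norm (Bbar T B w - Bbar T B v - blinfun_apply (Dbar v) (w - v))"
    by (intro tendsto_norm tendsto_diff blinfun.tendsto Dbar_tendsto B_tendsto_Bbar X Y v)
  moreover have "(\<lambda>n. C0 * norm (Y n - X n) powr (1 + \<gamma>)) \<longlonglongrightarrow> C0 * norm (w - v) powr (1 + \<gamma>)"
    using \<gamma> by (intro tendsto_mult_left tendsto_norm_powr tendsto_diff X Y) auto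
  ultimately show ?thesis
  proof (rule LIMSEQ_le)
    have "blinfun_apply (Dbar (X n)) (Y n - X n) = D_Lambda T B (X n) (Y n - X n)" for n
      by (intro Dbar_eq subspace_diff subspace_Lambda X Y)
    then show "\<exists>N. \<forall>n\<ge>N. norm (B (Y n) - B (X n) - blinfun_apply (Dbar (X n)) (Y n - X n)) \<le> C0 * norm (Y n - X n) powr (1 + \<gamma>)"
      using B_taylor[OF X(1) Y(1)] by auto
  qed
qed

lemma has_derivative_Bbar:
  assumes w: "w \<in> H"
  shows "(Bbar T B has_derivative blinfun_apply (Dbar w)) (at w within H)"
proof (rule has_derivativeI_sandwich[where e = 1])
  have "((\<lambda>y. C0 * norm (y - w) powr \<gamma>) \<longlongrightarrow> C0 * norm (w - w) powr \<gamma>) (at w within H)"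
    by (intro tendsto_mult_left tendsto_norm_powr \<gamma> tendsto_diff tendsto_ident_at tendsto_const)
  then show "((\<lambda>y. C0 * norm (y - w) powr \<gamma>) \<longlongrightarrow> 0) (at w within H)" using \<gamma> by simp
  fix y assume "y \<in> H" "y \<noteq> w"
  then show "norm (Bbar T B y - Bbar T B w - blinfun_apply (Dbar w) (y - w)) / norm (y - w) \<le> C0 * norm (y - w) powr \<gamma>"
    using Bbar_taylor[OF w, of y] by (simp add: powr_add divide_le_eq mult_ac)
qed (auto intro: blinfun.bounded_linear_right)

lemma DBbar_eq:
  assumes w: "w \<in> H" and h: "h \<in> H"
  shows "DBbar T B w h = blinfun_apply (Dbar w) h"
proof (rule derivative_unique_on_H[OF _ has_derivative_Bbar[OF w] w h])
  show "(Bbar T B has_derivative DBbar T B w) (at w within H)"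
    unfolding DBbar_def frechet_derivative_works[symmetric] using has_derivative_Bbar[OF w] by (rule differentiableI)
qed

section \<open>The integrated drift is a contraction\<close>

text \<open>Composing with the projection \<open>P\<close>, the identity on \<open>H\<close>, gives a map on the whole Banach space, to
which the fixed point theorem applies.\<close>

definition integrated_drift :: "real \<Rightarrow> real \<Rightarrow> (real, real^'d) L2 \<Rightarrow> (real, real^'d) L2" where
  "integrated_drift s t w = time_integral s t (Bbar T B (P w))"

abbreviation rate :: real where "rate \<equiv> decay_rate C0"

abbreviation lower :: real where "lower \<equiv> norm_ratio T C0"

sublocale weighted: equivalent_norm "mult_L2 (decay rate T) :: (real, real^'d) L2 \<Rightarrow> _" lower
  unfolding norm_ratio_def using T by (intro equivalent_norm_decay) (simp_all add: decay_rate_def)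

text \<open>The gain \<open>1 / sqrt rate\<close> of the time integral meets the causal Lipschitz estimate of the drift in the
weighted norm; \<open>P\<close> commutes with the weight because both are multiplication operators.\<close>

lemma integrated_drift_contraction: "weighted.half_contraction (integrated_drift s t)" if "s \<le> t"
  unfolding weighted.half_contraction_def
proof (intro allI)
  fix v w :: "(real, real^'d) L2"
  let ?E = "mult_L2 (decay rate T) :: (real, real^'d) L2 \<Rightarrow> _"
  let ?F = "Bbar T B (P v) - Bbar T B (P w)" and ?d = "P v - P w"
  let ?S = "{z::real \<times> real. 0 < fst z \<and> fst z \<le> snd z \<and> snd z < T}"
  interpret S: bounded_linear "time_integral s t :: (real \<times> real, real^'d) L2 \<Rightarrow> _"
    by (rule bounded_linear_time_integral[OF that])
  have rate: "0 < rate" "sqrt rate = 2 * C0" using C0 by (simp_all add: decay_rate_def real_sqrt_mult)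
  have "?S \<in> sets borel" by measurable
  then have "?F \<in> L2_on ?S"
    by (intro subspace_diff subspace_L2_on Bbar_support P_in_H)
  then have supp: "AE z in lborel. \<not> (0 < fst z \<and> fst z \<le> snd z \<and> snd z < T) \<longrightarrow> rep_L2 ?F z = 0"
    by (simp add: L2_on_def)
  have "?d \<in> H" by (intro subspace_diff subspace_H P_in_H)
  then have suppd: "AE x in lborel. x \<notin> {0<..<T} \<longrightarrow> rep_L2 ?d x = 0" by (simp add: L2_on_def)
  have "?E (integrated_drift s t v - integrated_drift s t w) = ?E (time_integral s t ?F)"
    by (simp add: integrated_drift_def S.diff)
  also have "norm \<dots> \<le> norm (mult_L2 (\<lambda>z. decay rate T (fst z)) ?F) / sqrt rate"
    by (rule norm_decay_time_integral[OF rate(1) T supp])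
  also have "\<dots> \<le> (C0 * norm (?E ?d)) / sqrt rate"
  proof (rule divide_right_mono)
    show "norm (mult_L2 (\<lambda>z. decay rate T (fst z)) ?F) \<le> C0 * norm (?E ?d)"
    proof (rule norm_decay_comparison)
      show "fst \<in> borel_measurable (borel :: (real \<times> real) measure)"
        by (simp add: borel_prod[symmetric])
      show "AE z in lborel. fst z \<notin> {0<..<T} \<longrightarrow> rep_L2 ?F z = 0"
        using supp by eventually_elim force
      show "norm ?F \<le> C0 * norm ?d" by (intro Bbar_lipschitz P_in_H)
      show "norm (mult_L2 (indicator {z. fst z < \<tau>}) ?F) \<le> C0 * norm (mult_L2 (indicator {x. x < \<tau>}) ?d)"
        if "0 < \<tau>" "\<tau> \<le> T" for \<tau>
        using that by (intro Bbar_causal_lipschitz P_in_H)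
    qed (use suppd rate C0 in auto)
  qed (use rate C0 in simp)
  also have "\<dots> = norm (?E ?d) / 2" using C0 by (simp add: rate)
  also have "?E ?d = P (?E (v - w))"
    unfolding P.diff[symmetric]
    using rate multiplier_decay[of rate "\<lambda>x. x" T] by (intro mult_commute multiplier_P) auto
  also have "norm \<dots> / 2 \<le> norm (?E (v - w)) / 2" using norm_P_le by (rule divide_right_mono) simp
  finally show "norm (?E (integrated_drift s t v - integrated_drift s t w)) \<le> norm (?E (v - w)) / 2" .
qed

end

section \<open>The pathwise flow and its derivative\<close>

lemma L2_on_mono: "A \<subseteq> B \<Longrightarrow> F \<in> L2_on A \<Longrightarrow> F \<in> L2_on B"
  unfolding L2_on_def by (auto elim: eventually_mono)

text \<open>The Bochner integral commutes with the projection onto \<open>L2_on S\<close>.\<close>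

lemma time_integral_in_L2_on:
  assumes F: "F \<in> L2_on {z. snd z \<in> S}" and S: "S \<in> sets borel"
  shows "time_integral s t F \<in> L2_on S"
proof -
  have m: "multiplier (indicator S)" by (rule multiplier_indicator[OF S])
  have "AE z in lborel. snd z \<notin> S \<longrightarrow> rep_L2 F z = 0"
    using F by (simp add: L2_on_def)
  from AE_lborel_pairD[OF this] have "AE r in lborel. mult_L2 (indicator S) (L2_section F r) = L2_section F r"
    using AE_rep_section[of F]
  proof eventually_elim
    case (elim r)
    have "AE y in lborel. rep_L2 (mult_L2 (indicator S) (L2_section F r)) y = rep_L2 (L2_section F r) y"
      using elim AE_rep_mult[OF m, of "L2_section F r"] by eventually_elim (auto simp: indicator_def)
    then show ?case by (rule L2_eqI)
  qed
  then have ae: "AE r in lborel. mult_L2 (indicator S) (indicator {s..t} r *\<^sub>R L2_section F r) = indicator {s..t} r *\<^sub>R L2_section F r"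
    by eventually_elim (simp add: linear_scale[OF bounded_linear.linear[OF bounded_linear_mult[OF m]]])
  have int: "integrable lborel (\<lambda>r. indicator {s..t} r *\<^sub>R L2_section F r)"
    using set_integrable_section[of s t F] by (simp add: set_integrable_def)
  have "mult_L2 (indicator S) (time_integral s t F)
      = (\<integral>r. mult_L2 (indicator S) (indicator {s..t} r *\<^sub>R L2_section F r) \<partial>lborel)"
    unfolding time_integral_def set_lebesgue_integral_def
    by (rule integral_bounded_linear[OF bounded_linear_mult[OF m] int, symmetric])
  also have "\<dots> = time_integral s t F"
    unfolding time_integral_def set_lebesgue_integral_def
  proof (rule integral_cong_AE)
    show "(\<lambda>r. mult_L2 (indicator S) (indicator {s..t} r *\<^sub>R L2_section F r)) \<in> borel_measurable lborel"
      by (rule borel_measurable_integrable[OF integrable_bounded_linear[OF bounded_linear_mult[OF m] int]])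
    show "(\<lambda>r. indicator {s..t} r *\<^sub>R L2_section F r) \<in> borel_measurable lborel"
      by (rule borel_measurable_integrable[OF int])
  qed (rule ae)
  finally show ?thesis by (simp add: L2_on_iff[OF S])
qed

lemma continuous_on_hoelder:
  fixes f :: "'a::real_normed_vector \<Rightarrow> 'b::real_normed_vector"
  assumes "\<And>x y. norm (f x - f y) \<le> C * norm (x - y) powr p" "0 < p"
  shows "continuous_on A f"
  unfolding continuous_on_def
proof
  fix x
  have "((\<lambda>y. C * norm (y - x) powr p) \<longlongrightarrow> C * norm (x - x) powr p) (at x within A)"
    by (intro tendsto_mult_left tendsto_norm_powr assms tendsto_diff tendsto_ident_at tendsto_const)
  then have "((\<lambda>y. C * norm (y - x) powr p) \<longlongrightarrow> 0) (at x within A)"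
    using assms(2) by simp
  then have "((\<lambda>y. f y - f x) \<longlongrightarrow> 0) (at x within A)"
    by (rule Lim_null_comparison[rotated]) (intro always_eventually allI assms(1))
  then show "(f \<longlongrightarrow> f x) (at x within A)" by (rule LIM_zero_cancel)
qed

context smooth_drift
begin

definition integrated_derivative :: "real \<Rightarrow> real \<Rightarrow> (real, real^'d) L2 \<Rightarrow> (real, real^'d) L2 \<Rightarrow> (real, real^'d) L2" where
  "integrated_derivative s t w h = time_integral s t (blinfun_apply (Dbar (P w)) (P h))"

text \<open>Projecting \<open>Bbar\<close> onto its support does not change it, so by uniqueness the projected derivative is
the derivative.\<close>

lemma Dbar_support:
  assumes w: "w \<in> H" and h: "h \<in> H"
  shows "blinfun_apply (Dbar w) h \<in> L2_on {z. 0 < fst z \<and> fst z \<le> snd z \<and> snd z < T}"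
proof -
  let ?S = "{z::real \<times> real. 0 < fst z \<and> fst z \<le> snd z \<and> snd z < T}"
  have S: "?S \<in> sets borel" by measurable
  let ?m = "mult_L2 (indicator ?S) :: (real \<times> real, real^'d) L2 \<Rightarrow> _"
  interpret m: bounded_linear ?m by (intro bounded_linear_mult multiplier_indicator S)
  have "(Bbar T B has_derivative (\<lambda>h. ?m (blinfun_apply (Dbar w) h))) (at w within H)"
  proof (rule has_derivative_transform[OF w])
    show "((\<lambda>v. ?m (Bbar T B v)) has_derivative (\<lambda>h. ?m (blinfun_apply (Dbar w) h))) (at w within H)"
      by (rule m.has_derivative[OF has_derivative_Bbar[OF w]])
    show "Bbar T B v = ?m (Bbar T B v)" if "v \<in> H" for v
      using Bbar_support[OF that] by (simp add: L2_on_iff[OF S])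
  qed
  from derivative_unique_on_H[OF has_derivative_Bbar[OF w] this w h]
  show ?thesis unfolding L2_on_iff[OF S] by (rule sym)
qed

lemma linear_integrated_derivative:
  assumes "s \<le> t"
  shows "linear (integrated_derivative s t w)"
proof -
  have "bounded_linear (\<lambda>h. time_integral s t (blinfun_apply (Dbar (P w)) (P h)))"
    by (intro bounded_linear_compose[OF bounded_linear_time_integral[OF assms]]
        bounded_linear_compose[OF blinfun.bounded_linear_right] P.bounded_linear_axioms)
  then show ?thesis
    unfolding integrated_derivative_def[abs_def] by (rule bounded_linear.linear)
qed

lemma time_integral_L2_on_H:
  assumes "F \<in> L2_on {z. 0 < fst z \<and> fst z \<le> snd z \<and> snd z < T}"
  shows "time_integral s t F \<in> H"
  by (rule time_integral_in_L2_on[OF L2_on_mono[OF _ assms]]) auto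

lemma integrated_drift_in_H: "integrated_drift s t w \<in> H"
  unfolding integrated_drift_def by (intro time_integral_L2_on_H Bbar_support P_in_H)

lemma integrated_derivative_in_H: "integrated_derivative s t w h \<in> H"
  unfolding integrated_derivative_def by (intro time_integral_L2_on_H Dbar_support P_in_H)

text \<open>The factor \<open>sqrt T\<close> is the norm bound for the time integral over a subinterval of \<open>[0,T]\<close>.\<close>

definition modulus :: real where "modulus = sqrt T * C0"

lemma modulus_nonneg: "0 \<le> modulus"
  using T C0 by (simp add: modulus_def)

context
  fixes s t :: real
  assumes s: "0 \<le> s" and st: "s \<le> t" and t: "t \<le> T"
begin

lemma norm_time_integral_le: "norm (time_integral s t F) \<le> sqrt T * norm F"
  by (rule order_trans[OF norm_time_integral[OF st]], rule mult_right_mono) (use s t in auto)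

lemma integrated_drift_taylor:
  "norm (integrated_drift s t (w + h) - integrated_drift s t w - integrated_derivative s t w h)
    \<le> modulus * norm h powr (1 + \<gamma>)"
proof -
  interpret S: bounded_linear "time_integral s t :: (real \<times> real, real^'d) L2 \<Rightarrow> _"
    by (rule bounded_linear_time_integral[OF st])
  have Ph: "P (w + h) - P w = P h" by (simp add: P.add)
  have "integrated_drift s t (w + h) - integrated_drift s t w - integrated_derivative s t w h
      = time_integral s t (Bbar T B (P (w + h)) - Bbar T B (P w) - blinfun_apply (Dbar (P w)) (P (w + h) - P w))"
    unfolding integrated_drift_def integrated_derivative_def S.diff Ph by (rule refl)
  then have "norm (integrated_drift s t (w + h) - integrated_drift s t w - integrated_derivative s t w h)
      \<le> sqrt T * norm (Bbar T B (P (w + h)) - Bbar T B (P w) - blinfun_apply (Dbar (P w)) (P (w + h) - P w))"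
    by (simp only: norm_time_integral_le)
  also have "\<dots> \<le> sqrt T * (C0 * norm (P (w + h) - P w) powr (1 + \<gamma>))"
    by (intro mult_left_mono Bbar_taylor P_in_H) (use T in simp)
  also have "\<dots> \<le> sqrt T * (C0 * norm h powr (1 + \<gamma>))"
    unfolding Ph using T C0 \<gamma> norm_P_le[of h] by (intro mult_left_mono powr_mono2) auto
  finally show ?thesis by (simp add: modulus_def mult.assoc)
qed

lemma integrated_derivative_hoelder:
  "norm (integrated_derivative s t v h - integrated_derivative s t w h) \<le> modulus * norm (v - w) powr \<gamma> * norm h"
proof -
  interpret S: bounded_linear "time_integral s t :: (real \<times> real, real^'d) L2 \<Rightarrow> _"
    by (rule bounded_linear_time_integral[OF st])
  have "integrated_derivative s t v h - integrated_derivative s t w h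
      = time_integral s t (blinfun_apply (Dbar (P v) - Dbar (P w)) (P h))"
    by (simp only: integrated_derivative_def S.diff blinfun.diff_left)
  then have "norm (integrated_derivative s t v h - integrated_derivative s t w h)
      \<le> sqrt T * norm (blinfun_apply (Dbar (P v) - Dbar (P w)) (P h))"
    by (simp only: norm_time_integral_le)
  also have "\<dots> \<le> sqrt T * (norm (Dbar (P v) - Dbar (P w)) * norm (P h))"
    by (intro mult_left_mono norm_blinfun) (use T in simp)
  also have "\<dots> \<le> sqrt T * ((C0 * norm (P v - P w) powr \<gamma>) * norm h)"
    using T C0 by (intro mult_left_mono mult_mono Dbar_hoelder P_in_H norm_P_le) auto
  also have "\<dots> \<le> sqrt T * ((C0 * norm (v - w) powr \<gamma>) * norm h)"
    unfolding P.diff[symmetric] using T C0 \<gamma> norm_P_le[of "v - w"]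
    by (intro mult_left_mono mult_right_mono powr_mono2) auto
  finally show ?thesis by (simp add: modulus_def mult.assoc)
qed

lemma half_contraction_drift: "weighted.half_contraction (integrated_drift s t)"
  by (rule integrated_drift_contraction[OF st])

lemma half_contraction_integrated_derivative: "weighted.half_contraction (integrated_derivative s t w)"
  by (rule weighted.half_contraction_derivative[OF half_contraction_drift linear_integrated_derivative[OF st] \<gamma> integrated_drift_taylor])

definition flow :: "(real, real^'d) L2 \<Rightarrow> (real, real^'d) L2" where
  "flow = resolvent (integrated_drift s t)"

definition linear_flow :: "(real, real^'d) L2 \<Rightarrow> (real, real^'d) L2 \<Rightarrow> (real, real^'d) L2" where
  "linear_flow w = resolvent (integrated_derivative s t w)"

lemma flow_solves: "flow x = x + integrated_drift s t (flow x)"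
  unfolding flow_def by (rule weighted.resolvent_solves[OF half_contraction_drift])

lemma flow_unique: "w = x + integrated_drift s t w \<Longrightarrow> flow x = w"
  unfolding flow_def by (rule weighted.resolvent_unique[OF half_contraction_drift])

lemma flow_lipschitz: "norm (flow x - flow y) \<le> 2 / lower * norm (x - y)"
  unfolding flow_def by (rule weighted.resolvent_lipschitz[OF half_contraction_drift])

lemma continuous_flow: "continuous_on A flow"
  unfolding flow_def by (rule weighted.continuous_on_resolvent[OF half_contraction_drift])

lemma flow_in_H: "x \<in> H \<Longrightarrow> flow x \<in> H"
  by (subst flow_solves) (rule subspace_add[OF subspace_H _ integrated_drift_in_H])

lemma linear_flow_solves: "linear_flow w h = h + integrated_derivative s t w (linear_flow w h)"
  unfolding linear_flow_def by (rule weighted.resolvent_solves[OF half_contraction_integrated_derivative])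

lemma linear_flow_unique: "v = h + integrated_derivative s t w v \<Longrightarrow> linear_flow w h = v"
  unfolding linear_flow_def by (rule weighted.resolvent_unique[OF half_contraction_integrated_derivative])

lemma linear_flow_in_H: "h \<in> H \<Longrightarrow> linear_flow w h \<in> H"
  by (subst linear_flow_solves) (rule subspace_add[OF subspace_H _ integrated_derivative_in_H])

lemma linear_flow_linear: "linear (linear_flow w)"
  unfolding linear_flow_def
  by (rule weighted.linear_resolvent[OF half_contraction_integrated_derivative linear_integrated_derivative[OF st]])

lemma linear_flow_bound: "norm (linear_flow w h) \<le> 2 / lower * norm h"
  unfolding linear_flow_def
  by (rule weighted.resolvent_linear_bound[OF half_contraction_integrated_derivative linear_integrated_derivative[OF st]])

lemma linear_flow_hoelder:
  "norm (linear_flow v h - linear_flow w h) \<le> (2 / lower)\<^sup>2 * modulus * norm (v - w) powr \<gamma> * norm h"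
  unfolding linear_flow_def
  using weighted.resolvent_linear_hoelder[OF half_contraction_integrated_derivative linear_integrated_derivative[OF st]
      half_contraction_integrated_derivative linear_integrated_derivative[OF st] integrated_derivative_hoelder, of v w h]
    modulus_nonneg by (simp add: mult.assoc)

lemma continuous_linear_flow: "continuous_on A (\<lambda>w. linear_flow w h)"
  using linear_flow_hoelder
  by (intro continuous_on_hoelder[OF _ \<gamma>, of _ "(2 / lower)\<^sup>2 * modulus * norm h"]) (simp add: mult_ac)

lemma flow_taylor:
  "norm (flow (x + h) - flow x - linear_flow (flow x) h)
    \<le> 2 / lower * modulus * (2 / lower) powr (1 + \<gamma>) * norm h powr (1 + \<gamma>)"
  unfolding flow_def linear_flow_def
  by (rule weighted.resolvent_taylor[OF half_contraction_drift half_contraction_integrated_derivative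
        linear_integrated_derivative[OF st] \<gamma> modulus_nonneg integrated_drift_taylor])

end

end

section \<open>Square-integrable random variables\<close>

lemma norm_diff_square_le:
  fixes x y :: "'a::real_normed_vector"
  shows "(norm (x - y))\<^sup>2 \<le> 2 * (norm x)\<^sup>2 + 2 * (norm y)\<^sup>2"
proof -
  have "(norm (x - y))\<^sup>2 \<le> (norm x + norm y)\<^sup>2"
    by (intro power_mono norm_triangle_ineq4) simp
  also have "\<dots> \<le> 2 * (norm x)\<^sup>2 + 2 * (norm y)\<^sup>2"
    using sum_squares_bound[of "norm x" "norm y"] by (simp add: power2_sum)
  finally show ?thesis .
qed

lemma rv_L2_diff:
  fixes X Y :: "'w \<Rightarrow> 'h::{real_normed_vector, second_countable_topology}"
  assumes K: "subspace K" and X: "X \<in> rv_L2 M K" and Y: "Y \<in> rv_L2 M K"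
  shows "(\<lambda>\<omega>. X \<omega> - Y \<omega>) \<in> rv_L2 M K"
proof -
  have [measurable]: "X \<in> borel_measurable M" "Y \<in> borel_measurable M"
    using X Y by (auto simp: rv_L2_def)
  have "integrable M (\<lambda>\<omega>. (norm (X \<omega> - Y \<omega>))\<^sup>2)"
  proof (rule Bochner_Integration.integrable_bound)
    show "integrable M (\<lambda>\<omega>. 2 * (norm (X \<omega>))\<^sup>2 + 2 * (norm (Y \<omega>))\<^sup>2)"
      using X Y by (auto simp: rv_L2_def)
    show "AE \<omega> in M. norm ((norm (X \<omega> - Y \<omega>))\<^sup>2) \<le> norm (2 * (norm (X \<omega>))\<^sup>2 + 2 * (norm (Y \<omega>))\<^sup>2)"
      using norm_diff_square_le[of "X _" "Y _"] by (intro AE_I2) auto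
  qed measurable
  with X Y K show ?thesis by (auto simp: rv_L2_def intro: subspace_diff)
qed

lemma AE_iff_cong:
  assumes "AE x in M. P x = Q x"
  shows "(AE x in M. P x) \<longleftrightarrow> (AE x in M. Q x)"
proof
  assume "AE x in M. P x"
  with assms show "AE x in M. Q x" by eventually_elim simp
next
  assume "AE x in M. Q x"
  with assms show "AE x in M. P x" by eventually_elim simp
qed

lemma rv_norm_le:
  assumes M: "prob_space M" and le: "AE \<omega> in M. norm (X \<omega>) \<le> c" and c: "0 \<le> c"
  shows "rv_norm M X \<le> c"
proof -
  interpret prob_space M by (rule M)
  have "(\<integral>\<omega>. (norm (X \<omega>))\<^sup>2 \<partial>M) \<le> (\<integral>\<omega>. c\<^sup>2 \<partial>M)"
  proof (rule integral_mono_AE')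
    show "AE \<omega> in M. (norm (X \<omega>))\<^sup>2 \<le> c\<^sup>2"
      using le by eventually_elim (simp add: power_mono)
  qed simp_all
  also have "\<dots> = c\<^sup>2" by (simp add: prob_space)
  finally show ?thesis using c by (simp add: rv_norm_def real_le_lsqrt)
qed

lemma rv_L2_compose:
  fixes X :: "'w \<Rightarrow> 'h::{real_normed_vector, second_countable_topology}" and G :: "'h \<Rightarrow> 'h"
  assumes M: "prob_space M" and X: "X \<in> rv_L2 M K" and G: "continuous_on UNIV G" "\<And>x. x \<in> K \<Longrightarrow> G x \<in> K"
    and bound: "\<And>x. norm (G x) \<le> a + b * norm x"
  shows "(\<lambda>\<omega>. G (X \<omega>)) \<in> rv_L2 M K"
proof -
  interpret prob_space M by (rule M)
  have [measurable]: "X \<in> borel_measurable M" using X by (simp add: rv_L2_def)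
  have GX [measurable]: "(\<lambda>\<omega>. G (X \<omega>)) \<in> borel_measurable M"
    by (rule borel_measurable_continuous_on[OF G(1)]) measurable
  have "integrable M (\<lambda>\<omega>. (norm (G (X \<omega>)))\<^sup>2)"
  proof (rule Bochner_Integration.integrable_bound)
    show "integrable M (\<lambda>\<omega>. 2 * a\<^sup>2 + 2 * b\<^sup>2 * (norm (X \<omega>))\<^sup>2)"
      using X by (auto simp: rv_L2_def)
    have "(norm (G x))\<^sup>2 \<le> 2 * a\<^sup>2 + 2 * b\<^sup>2 * (norm x)\<^sup>2" for x
    proof -
      have "(norm (G x))\<^sup>2 \<le> (a + b * norm x)\<^sup>2"
        by (intro power_mono bound) simp
      also have "\<dots> \<le> 2 * a\<^sup>2 + 2 * b\<^sup>2 * (norm x)\<^sup>2"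
        using sum_squares_bound[of a "b * norm x"] by (simp add: power2_sum power_mult_distrib)
      finally show ?thesis .
    qed
    then show "AE \<omega> in M. norm ((norm (G (X \<omega>)))\<^sup>2) \<le> norm (2 * a\<^sup>2 + 2 * b\<^sup>2 * (norm (X \<omega>))\<^sup>2)"
      by (intro AE_I2) (simp add: order_trans[OF _ abs_ge_self])
  qed measurable
  with X GX G(2) show ?thesis by (auto simp: rv_L2_def)
qed

text \<open>Along \<open>k n = h / (n + 1)\<close> both remainders are \<open>o(\<parallel>k n\<parallel>)\<close>, while their difference is
\<open>(D h - D' h) / (n + 1)\<close>; so \<open>D h - D' h\<close> has norm 0.\<close>

lemma frechet_differential_unique:
  fixes f :: "'h \<Rightarrow> 'w \<Rightarrow> 'h::{real_normed_vector, second_countable_topology}"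
  assumes K: "subspace K" and \<phi>: "\<phi> \<in> K" and f: "\<And>x. x \<in> K \<Longrightarrow> f x \<in> rv_L2 M K"
    and D: "has_frechet_differential M K f D \<phi>" and D': "has_frechet_differential M K f D' \<phi>"
    and h: "h \<in> K"
  shows "AE \<omega> in M. D h \<omega> = D' h \<omega>"
proof (cases "h = 0")
  case True
  have "AE \<omega> in M. D (0 *\<^sub>R h) \<omega> = 0 *\<^sub>R D h \<omega>" "AE \<omega> in M. D' (0 *\<^sub>R h) \<omega> = 0 *\<^sub>R D' h \<omega>"
    using D D' h unfolding has_frechet_differential_def by blast+
  then show ?thesis by eventually_elim (simp add: True)
next
  case False
  define k where "k n = (1 / real (Suc n)) *\<^sub>R h" for n
  have k: "k n \<in> K" "k n \<noteq> 0" for n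
    using K h False by (auto simp: k_def subspace_scale)
  have "(\<lambda>n. 1 / real (Suc n)) \<longlonglongrightarrow> 0" by (rule LIMSEQ_Suc[OF lim_1_over_n])
  from tendsto_scaleR[OF this tendsto_const[of h]] have "k \<longlonglongrightarrow> 0"
    unfolding k_def[abs_def] by simp
  then have flt: "filterlim k (at 0 within K) sequentially"
    using k by (simp add: filterlim_at)
  define X where "X n \<omega> = f (\<phi> + k n) \<omega> - f \<phi> \<omega> - D (k n) \<omega>" for n \<omega>
  define Y where "Y n \<omega> = f (\<phi> + k n) \<omega> - f \<phi> \<omega> - D' (k n) \<omega>" for n \<omega>
  have XY: "X n \<in> rv_L2 M K" "Y n \<in> rv_L2 M K" for n
    unfolding X_def[abs_def] Y_def[abs_def]
    by (intro rv_L2_diff K f subspace_add \<phi> k;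
        use D D' k in \<open>auto simp: has_frechet_differential_def\<close>)+
  have lim: "(\<lambda>n. rv_norm M (X n) / norm (k n)) \<longlonglongrightarrow> 0" "(\<lambda>n. rv_norm M (Y n) / norm (k n)) \<longlonglongrightarrow> 0"
    unfolding X_def[abs_def] Y_def[abs_def]
    by (rule filterlim_compose[OF _ flt]; use D D' in \<open>simp add: has_frechet_differential_def\<close>)+
  have Z: "(\<lambda>\<omega>. D h \<omega> - D' h \<omega>) \<in> rv_L2 M K"
    using D D' h by (intro rv_L2_diff K) (auto simp: has_frechet_differential_def)
  define z where "z = (\<integral>\<omega>. (norm (D h \<omega> - D' h \<omega>))\<^sup>2 \<partial>M)"
  have le: "z \<le> (norm h)\<^sup>2 * (2 * (rv_norm M (X n) / norm (k n))\<^sup>2 + 2 * (rv_norm M (Y n) / norm (k n))\<^sup>2)" for n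
  proof -
    define c where "c = 1 / real (Suc n)"
    have c: "0 < c" "k n = c *\<^sub>R h" by (simp_all add: c_def k_def)
    have sq: "(rv_norm M V)\<^sup>2 = (\<integral>\<omega>. (norm (V \<omega>))\<^sup>2 \<partial>M)" for V :: "'w \<Rightarrow> 'h"
      by (simp add: rv_norm_def)
    have int: "integrable M (\<lambda>\<omega>. (norm (X n \<omega>))\<^sup>2)" "integrable M (\<lambda>\<omega>. (norm (Y n \<omega>))\<^sup>2)"
      "integrable M (\<lambda>\<omega>. (norm (D h \<omega> - D' h \<omega>))\<^sup>2)"
      using XY[of n] Z by (auto simp: rv_L2_def)
    have "AE \<omega> in M. D (k n) \<omega> = c *\<^sub>R D h \<omega>" "AE \<omega> in M. D' (k n) \<omega> = c *\<^sub>R D' h \<omega>"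
      using D D' h unfolding has_frechet_differential_def c(2) by blast+
    then have "AE \<omega> in M. c\<^sup>2 * (norm (D h \<omega> - D' h \<omega>))\<^sup>2 \<le> 2 * (norm (X n \<omega>))\<^sup>2 + 2 * (norm (Y n \<omega>))\<^sup>2"
    proof eventually_elim
      case (elim \<omega>)
      have "norm (Y n \<omega> - X n \<omega>) = norm (c *\<^sub>R (D h \<omega> - D' h \<omega>))"
        by (simp add: X_def Y_def elim scaleR_diff_right)
      then have "c\<^sup>2 * (norm (D h \<omega> - D' h \<omega>))\<^sup>2 = (norm (Y n \<omega> - X n \<omega>))\<^sup>2"
        by (simp add: power_mult_distrib)
      then show ?case using norm_diff_square_le[of "Y n \<omega>" "X n \<omega>"] by simp
    qed
    then have "(\<integral>\<omega>. c\<^sup>2 * (norm (D h \<omega> - D' h \<omega>))\<^sup>2 \<partial>M) \<le> (\<integral>\<omega>. 2 * (norm (X n \<omega>))\<^sup>2 + 2 * (norm (Y n \<omega>))\<^sup>2 \<partial>M)"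
      using int by (intro integral_mono_AE) auto
    then have "c\<^sup>2 * z \<le> 2 * (rv_norm M (X n))\<^sup>2 + 2 * (rv_norm M (Y n))\<^sup>2"
      using int by (simp add: z_def sq)
    moreover have "(norm h)\<^sup>2 * (2 * (rv_norm M (X n) / norm (k n))\<^sup>2 + 2 * (rv_norm M (Y n) / norm (k n))\<^sup>2)
        = (2 * (rv_norm M (X n))\<^sup>2 + 2 * (rv_norm M (Y n))\<^sup>2) / c\<^sup>2"
      using c(1) False by (simp add: c(2) field_simps)
    ultimately show ?thesis using c(1) by (simp add: pos_le_divide_eq mult.commute)
  qed
  have "(\<lambda>n. (norm h)\<^sup>2 * (2 * (rv_norm M (X n) / norm (k n))\<^sup>2 + 2 * (rv_norm M (Y n) / norm (k n))\<^sup>2))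
      \<longlonglongrightarrow> (norm h)\<^sup>2 * (2 * 0\<^sup>2 + 2 * 0\<^sup>2)"
    by (intro tendsto_mult_left tendsto_add tendsto_power lim)
  then have "z \<le> (norm h)\<^sup>2 * (2 * 0\<^sup>2 + 2 * 0\<^sup>2)"
    by (rule LIMSEQ_le_const) (intro exI allI impI le)
  moreover have "0 \<le> z" by (simp add: z_def)
  ultimately have "z = 0" by simp
  moreover have "integrable M (\<lambda>\<omega>. (norm (D h \<omega> - D' h \<omega>))\<^sup>2)" using Z by (simp add: rv_L2_def)
  ultimately have "AE \<omega> in M. (norm (D h \<omega> - D' h \<omega>))\<^sup>2 = 0"
    unfolding z_def by (subst (asm) integral_nonneg_eq_0_iff_AE) auto
  then show ?thesis by eventually_elim simp
qed

section \<open>The solution map\<close>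

text \<open>Here \<open>J\<close> stands for the stochastic integral, which enters the pathwise equation as an element of
\<open>L\<^sup>2(\<Omega>; H)\<close>.\<close>

locale smooth_drift_noise = smooth_drift T C0 \<gamma> B + prob_space M
  for T C0 \<gamma> :: real and B :: "(real, real^'d::finite) L2 \<Rightarrow> (real \<times> real, real^'d) L2" and M :: "'w measure" +
  fixes J :: "'w \<Rightarrow> (real, real^'d) L2" and s t :: real
  assumes J: "J \<in> rv_L2 M (H_space T)" and st: "0 \<le> s" "s \<le> t" "t \<le> T"
begin

abbreviation "\<Phi> \<equiv> flow s t"
abbreviation "R \<equiv> linear_flow s t"
abbreviation "w \<equiv> solution T B M J s t"

lemma time_integral_Bbar: "x \<in> H \<Longrightarrow> (LINT r:{s..t}|lborel. L2_section (Bbar T B x) r) = integrated_drift s t x"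
  by (simp add: integrated_drift_def time_integral_def P_eq)

lemma time_integral_DBbar:
  "x \<in> H \<Longrightarrow> h \<in> H \<Longrightarrow> (LINT r:{s..t}|lborel. L2_section (DBbar T B x h) r) = integrated_derivative s t x h"
  by (simp add: integrated_derivative_def time_integral_def P_eq DBbar_eq)

lemma is_solution_iff:
  assumes "\<phi> \<in> H"
  shows "is_solution T B M J s t \<phi> v \<longleftrightarrow> v \<in> rv_L2 M H \<and> (AE \<omega> in M. v \<omega> = \<Phi> (\<phi> + J \<omega>))"
proof (cases "v \<in> rv_L2 M H")
  case True
  have "AE \<omega> in M. (v \<omega> = \<phi> + (LINT r:{s..t}|lborel. L2_section (Bbar T B (v \<omega>)) r) + J \<omega>) = (v \<omega> = \<Phi> (\<phi> + J \<omega>))"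
  proof (rule AE_I2)
    fix \<omega> assume "\<omega> \<in> space M"
    then have eq: "\<phi> + (LINT r:{s..t}|lborel. L2_section (Bbar T B (v \<omega>)) r) + J \<omega> = (\<phi> + J \<omega>) + integrated_drift s t (v \<omega>)"
      using True by (subst time_integral_Bbar) (auto simp: rv_L2_def)
    show "(v \<omega> = \<phi> + (LINT r:{s..t}|lborel. L2_section (Bbar T B (v \<omega>)) r) + J \<omega>) = (v \<omega> = \<Phi> (\<phi> + J \<omega>))"
      unfolding eq
    proof
      assume "v \<omega> = \<phi> + J \<omega> + integrated_drift s t (v \<omega>)"
      from flow_unique[OF st this] show "v \<omega> = \<Phi> (\<phi> + J \<omega>)" by (rule sym)
    next
      assume v: "v \<omega> = \<Phi> (\<phi> + J \<omega>)"
      show "v \<omega> = \<phi> + J \<omega> + integrated_drift s t (v \<omega>)"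
        unfolding v by (rule flow_solves[OF st])
    qed
  qed
  then have "(AE \<omega> in M. v \<omega> = \<phi> + (LINT r:{s..t}|lborel. L2_section (Bbar T B (v \<omega>)) r) + J \<omega>) \<longleftrightarrow> (AE \<omega> in M. v \<omega> = \<Phi> (\<phi> + J \<omega>))"
    by (rule AE_iff_cong)
  then show ?thesis by (simp add: is_solution_def True)
qed (simp add: is_solution_def)

lemma flow_rv:
  assumes "\<phi> \<in> H"
  shows "(\<lambda>\<omega>. \<Phi> (\<phi> + J \<omega>)) \<in> rv_L2 M H"
proof (rule rv_L2_compose[OF prob_space_axioms J])
  show "continuous_on UNIV (\<lambda>x. \<Phi> (\<phi> + x))"
    by (rule continuous_on_compose2[OF continuous_flow[OF st, of UNIV]]) (auto intro: continuous_intros)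
  show "\<Phi> (\<phi> + x) \<in> H" if "x \<in> H" for x
    by (intro flow_in_H st subspace_add subspace_H assms that)
  show "norm (\<Phi> (\<phi> + x)) \<le> norm (\<Phi> \<phi>) + 2 / lower * norm x" for x
    using flow_lipschitz[OF st, of "\<phi> + x" \<phi>] norm_triangle_sub[of "\<Phi> (\<phi> + x)" "\<Phi> \<phi>"] by simp
qed

lemma
  assumes "\<phi> \<in> H"
  shows solution_rv: "w \<phi> \<in> rv_L2 M H" and solution_eq_flow: "AE \<omega> in M. w \<phi> \<omega> = \<Phi> (\<phi> + J \<omega>)"
proof -
  have "is_solution T B M J s t \<phi> (\<lambda>\<omega>. \<Phi> (\<phi> + J \<omega>))"
    using flow_rv[OF assms] by (simp add: is_solution_iff[OF assms])
  then have "is_solution T B M J s t \<phi> (w \<phi>)"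
    unfolding solution_def by (rule someI[of "is_solution T B M J s t \<phi>"])
  then show "w \<phi> \<in> rv_L2 M H" "AE \<omega> in M. w \<phi> \<omega> = \<Phi> (\<phi> + J \<omega>)"
    by (simp_all add: is_solution_iff[OF assms])
qed

definition solution_derivative :: "(real, real^'d) L2 \<Rightarrow> (real, real^'d) L2 \<Rightarrow> 'w \<Rightarrow> (real, real^'d) L2" where
  "solution_derivative \<phi> h \<omega> = R (\<Phi> (\<phi> + J \<omega>)) h"

lemma solution_derivative_rv:
  assumes \<phi>: "\<phi> \<in> H" and h: "h \<in> H"
  shows "solution_derivative \<phi> h \<in> rv_L2 M H"
  unfolding solution_derivative_def[abs_def]
proof (rule rv_L2_compose[OF prob_space_axioms J])
  have "continuous_on UNIV (\<lambda>x. \<Phi> (\<phi> + x))"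
    by (rule continuous_on_compose2[OF continuous_flow[OF st, of UNIV]]) (auto intro: continuous_intros)
  then show "continuous_on UNIV (\<lambda>x. R (\<Phi> (\<phi> + x)) h)"
    by (rule continuous_on_compose2[OF continuous_linear_flow[OF st, of UNIV]]) simp
  show "R (\<Phi> (\<phi> + x)) h \<in> H" for x by (rule linear_flow_in_H[OF st h])
  show "norm (R (\<Phi> (\<phi> + x)) h) \<le> 2 / lower * norm h + 0 * norm x" for x
    using linear_flow_bound[OF st] by simp
qed

lemma lower_pos: "0 < lower"
  by (simp add: norm_ratio_def)

text \<open>The pathwise Taylor estimate is uniform in \<open>\<omega>\<close>, and therefore it bounds the remainder in
\<open>L\<^sup>2(\<Omega>; H)\<close>.\<close>

lemma has_frechet_differential_solution:
  assumes \<phi>: "\<phi> \<in> H"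
  shows "has_frechet_differential M H w (solution_derivative \<phi>) \<phi>"
  unfolding has_frechet_differential_def
proof (intro conjI ballI allI)
  show "solution_derivative \<phi> h \<in> rv_L2 M H" if "h \<in> H" for h
    by (rule solution_derivative_rv[OF \<phi> that])
  note lin = linear_flow_linear[OF st]
  show "AE \<omega> in M. solution_derivative \<phi> (h + k) \<omega> = solution_derivative \<phi> h \<omega> + solution_derivative \<phi> k \<omega>" for h k
    by (simp add: solution_derivative_def linear_add[OF lin])
  show "AE \<omega> in M. solution_derivative \<phi> (c *\<^sub>R h) \<omega> = c *\<^sub>R solution_derivative \<phi> h \<omega>" for c h
    by (simp add: solution_derivative_def linear_scale[OF lin])
  show "\<exists>C. \<forall>h\<in>H. rv_norm M (solution_derivative \<phi> h) \<le> C * norm h"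
  proof (intro exI ballI rv_norm_le[OF prob_space_axioms])
    fix h
    show "AE \<omega> in M. norm (solution_derivative \<phi> h \<omega>) \<le> 2 / lower * norm h"
      unfolding solution_derivative_def by (intro AE_I2 linear_flow_bound[OF st])
    show "0 \<le> 2 / lower * norm h" using lower_pos by simp
  qed
  define C where "C = 2 / lower * modulus * (2 / lower) powr (1 + \<gamma>)"
  have C: "0 \<le> C" using lower_pos modulus_nonneg by (simp add: C_def)
  have le: "rv_norm M (\<lambda>\<omega>. w (\<phi> + h) \<omega> - w \<phi> \<omega> - solution_derivative \<phi> h \<omega>) / norm h \<le> C * norm h powr \<gamma>"
    if h: "h \<in> H" "h \<noteq> 0" for h
  proof -
    have "\<phi> + h \<in> H" by (intro subspace_add subspace_H \<phi> h)
    from solution_eq_flow[OF \<phi>] solution_eq_flow[OF this]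
    have "AE \<omega> in M. norm (w (\<phi> + h) \<omega> - w \<phi> \<omega> - solution_derivative \<phi> h \<omega>) \<le> C * norm h powr (1 + \<gamma>)"
    proof eventually_elim
      case (elim \<omega>)
      show ?case
        using flow_taylor[OF st, of "\<phi> + J \<omega>" h] by (simp add: C_def elim solution_derivative_def add_ac)
    qed
    from rv_norm_le[OF prob_space_axioms this mult_nonneg_nonneg[OF C powr_ge_zero]]
    have "rv_norm M (\<lambda>\<omega>. w (\<phi> + h) \<omega> - w \<phi> \<omega> - solution_derivative \<phi> h \<omega>) \<le> C * norm h powr (1 + \<gamma>)" .
    then show ?thesis using h by (simp add: powr_add divide_le_eq mult_ac)
  qed
  have "((\<lambda>h. C * norm h powr \<gamma>) \<longlongrightarrow> C * norm (0 :: (real, real^'d) L2) powr \<gamma>) (at 0 within H)"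
    by (intro tendsto_mult_left tendsto_norm_powr \<gamma> tendsto_ident_at)
  then have "((\<lambda>h. C * norm h powr \<gamma>) \<longlongrightarrow> 0) (at 0 within H)" using \<gamma> by simp
  then show "((\<lambda>h. rv_norm M (\<lambda>\<omega>. w (\<phi> + h) \<omega> - w \<phi> \<omega> - solution_derivative \<phi> h \<omega>) / norm h) \<longlongrightarrow> 0) (at 0 within H)"
  proof (rule Lim_null_comparison[rotated])
    show "\<forall>\<^sub>F h in at 0 within H. norm (rv_norm M (\<lambda>\<omega>. w (\<phi> + h) \<omega> - w \<phi> \<omega> - solution_derivative \<phi> h \<omega>) / norm h)
        \<le> C * norm h powr \<gamma>"
      unfolding eventually_at_filter
      by (intro always_eventually allI impI) (use le in \<open>simp add: rv_norm_def\<close>)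
  qed
qed

lemma C1_Hoelder_solution: "C1_Hoelder \<gamma> M H w"
  unfolding C1_Hoelder_def
proof (intro conjI ballI exI[of _ solution_derivative] exI[of _ "(2 / lower)\<^sup>2 * modulus * (2 / lower) powr \<gamma>"])
  show "w \<phi> \<in> rv_L2 M H" if "\<phi> \<in> H" for \<phi> by (rule solution_rv[OF that])
  show "has_frechet_differential M H w (solution_derivative \<phi>) \<phi>" if "\<phi> \<in> H" for \<phi>
    by (rule has_frechet_differential_solution[OF that])
  fix \<phi> \<psi> h
  let ?c = "(2 / lower)\<^sup>2 * modulus"
  have c: "0 \<le> ?c" using modulus_nonneg by simp
  show "rv_norm M (\<lambda>\<omega>. solution_derivative \<phi> h \<omega> - solution_derivative \<psi> h \<omega>)
      \<le> ?c * (2 / lower) powr \<gamma> * norm (\<phi> - \<psi>) powr \<gamma> * norm h"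
  proof (rule rv_norm_le[OF prob_space_axioms AE_I2])
    fix \<omega>
    have "norm (solution_derivative \<phi> h \<omega> - solution_derivative \<psi> h \<omega>)
        \<le> ?c * norm (\<Phi> (\<phi> + J \<omega>) - \<Phi> (\<psi> + J \<omega>)) powr \<gamma> * norm h"
      unfolding solution_derivative_def by (rule linear_flow_hoelder[OF st])
    also have "\<dots> \<le> ?c * (2 / lower * norm (\<phi> - \<psi>)) powr \<gamma> * norm h"
      using flow_lipschitz[OF st, of "\<phi> + J \<omega>" "\<psi> + J \<omega>"] c \<gamma>
      by (intro mult_right_mono mult_left_mono powr_mono2) auto
    also have "\<dots> = ?c * (2 / lower) powr \<gamma> * norm (\<phi> - \<psi>) powr \<gamma> * norm h"
      using lower_pos by (subst powr_mult) auto
    finally show "norm (solution_derivative \<phi> h \<omega> - solution_derivative \<psi> h \<omega>)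
        \<le> ?c * (2 / lower) powr \<gamma> * norm (\<phi> - \<psi>) powr \<gamma> * norm h" .
  qed (use c in simp)
qed

lemma is_linearised_solution_iff:
  assumes \<phi>: "\<phi> \<in> H" and v: "v \<in> rv_L2 M H"
  shows "is_linearised_solution T B M (w \<phi>) s t \<psi> v \<longleftrightarrow> (AE \<omega> in M. v \<omega> = solution_derivative \<phi> \<psi> \<omega>)"
proof -
  have "(AE \<omega> in M. v \<omega> = \<psi> + (LINT r:{s..t}|lborel. L2_section (DBbar T B (w \<phi> \<omega>) (v \<omega>)) r))
      \<longleftrightarrow> (AE \<omega> in M. v \<omega> = solution_derivative \<phi> \<psi> \<omega>)"
  proof (rule AE_iff_cong)
    show "AE \<omega> in M. (v \<omega> = \<psi> + (LINT r:{s..t}|lborel. L2_section (DBbar T B (w \<phi> \<omega>) (v \<omega>)) r))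
        = (v \<omega> = solution_derivative \<phi> \<psi> \<omega>)"
      using solution_eq_flow[OF \<phi>] AE_space
    proof eventually_elim
      case (elim \<omega>)
      have "w \<phi> \<omega> \<in> H" "v \<omega> \<in> H"
        using solution_rv[OF \<phi>] v elim(2) by (simp_all add: rv_L2_def)
      then have eq: "(LINT r:{s..t}|lborel. L2_section (DBbar T B (w \<phi> \<omega>) (v \<omega>)) r) = integrated_derivative s t (w \<phi> \<omega>) (v \<omega>)"
        by (rule time_integral_DBbar)
      show ?case
        unfolding eq solution_derivative_def elim(1)[symmetric]
      proof
        assume "v \<omega> = \<psi> + integrated_derivative s t (w \<phi> \<omega>) (v \<omega>)"
        from linear_flow_unique[OF st this] show "v \<omega> = R (w \<phi> \<omega>) \<psi>" by (rule sym)
      next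
        assume eq: "v \<omega> = R (w \<phi> \<omega>) \<psi>"
        show "v \<omega> = \<psi> + integrated_derivative s t (w \<phi> \<omega>) (v \<omega>)"
          unfolding eq by (rule linear_flow_solves[OF st])
      qed
    qed
  qed
  then show ?thesis by (simp add: is_linearised_solution_def v)
qed

lemma differential_eq:
  assumes Dw: "has_frechet_differential M H w D \<phi>" and \<phi>: "\<phi> \<in> H" and h: "h \<in> H"
  shows "AE \<omega> in M. D h \<omega> = R (w \<phi> \<omega>) h" "AE \<omega> in M. D h \<omega> = solution_derivative \<phi> h \<omega>"
proof -
  show eq: "AE \<omega> in M. D h \<omega> = solution_derivative \<phi> h \<omega>"
    by (rule frechet_differential_unique[OF subspace_H \<phi> solution_rv Dw has_frechet_differential_solution[OF \<phi>] h])
  then show "AE \<omega> in M. D h \<omega> = R (w \<phi> \<omega>) h"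
    using solution_eq_flow[OF \<phi>] by eventually_elim (simp add: solution_derivative_def)
qed

lemma differential_solves:
  assumes Dw: "has_frechet_differential M H w D \<phi>" and \<phi>: "\<phi> \<in> H" and \<psi>: "\<psi> \<in> H"
  shows "is_linearised_solution T B M (w \<phi>) s t \<psi> (D \<psi>)"
    and "is_linearised_solution T B M (w \<phi>) s t \<psi> v \<Longrightarrow> AE \<omega> in M. v \<omega> = D \<psi> \<omega>"
proof -
  have D: "D \<psi> \<in> rv_L2 M H" using Dw \<psi> by (simp add: has_frechet_differential_def)
  note eq = differential_eq(2)[OF Dw \<phi> \<psi>]
  show "is_linearised_solution T B M (w \<phi>) s t \<psi> (D \<psi>)"
    using eq by (simp add: is_linearised_solution_iff[OF \<phi> D])
  assume v: "is_linearised_solution T B M (w \<phi>) s t \<psi> v"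
  then have "v \<in> rv_L2 M H" by (simp add: is_linearised_solution_def)
  with v have "AE \<omega> in M. v \<omega> = solution_derivative \<phi> \<psi> \<omega>" by (simp add: is_linearised_solution_iff[OF \<phi>])
  with eq show "AE \<omega> in M. v \<omega> = D \<psi> \<omega>" by eventually_elim simp
qed

lemma differential_bounds:
  assumes D: "has_frechet_differential M H w D \<phi>" and D': "has_frechet_differential M H w D' \<psi>"
    and \<phi>: "\<phi> \<in> H" and \<psi>: "\<psi> \<in> H" and h: "h \<in> H"
  shows "AE \<omega> in M. norm (D h \<omega>) \<le> 2 / lower * norm h \<and>
    norm (D h \<omega> - D' h \<omega>) \<le> (2 / lower)\<^sup>2 * modulus * norm (w \<phi> \<omega> - w \<psi> \<omega>) powr \<gamma> * norm h"
  using differential_eq(1)[OF D \<phi> h] differential_eq(1)[OF D' \<psi> h]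
  by eventually_elim (simp only: linear_flow_bound[OF st] linear_flow_hoelder[OF st])

end

theorem theorem5:
  fixes T C0 :: real
  assumes "0 < T" and "0 < C0"
  shows "\<exists>C2>0. \<forall>(M :: 'w measure) F (W :: real \<Rightarrow> 'w \<Rightarrow> real^'d::finite) \<alpha> \<gamma>
      (B :: (real, real^'d) L2 \<Rightarrow> (real \<times> real, real^'d) L2) J.
    filtered_prob_space T M F \<and> brownian_motion T M F W \<and>
    1/2 < \<alpha> \<and> \<alpha> < 1 \<and> 0 < \<gamma> \<and> \<gamma> \<le> 1 \<and> smooth_volterra_drift T C0 \<gamma> B \<and>
    (\<forall>s t. 0 \<le> s \<and> s \<le> t \<and> t \<le> T \<longrightarrow>
       is_stoch_integral M W (H_space T) s t (sigma_op T \<alpha>) (J s t)) \<longrightarrow>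
    (\<forall>s t. 0 \<le> s \<and> s \<le> t \<and> t \<le> T \<longrightarrow>
      (let w = solution T B M (J s t) s t in
        C1_Hoelder \<gamma> M (H_space T) w \<and>
        (\<forall>Dw. (\<forall>\<phi>\<in>H_space T. has_frechet_differential M (H_space T) w (Dw \<phi>) \<phi>) \<longrightarrow>
          (\<forall>\<phi>\<in>H_space T. \<forall>\<psi>\<in>H_space T.
             is_linearised_solution T B M (w \<phi>) s t \<psi> (Dw \<phi> \<psi>) \<and>
             (\<forall>v. is_linearised_solution T B M (w \<phi>) s t \<psi> v \<longrightarrow> (AE \<omega> in M. v \<omega> = Dw \<phi> \<psi> \<omega>))) \<and>
          (\<forall>\<phi>\<in>H_space T. \<forall>\<psi>\<in>H_space T. \<forall>\<eta>\<in>H_space T. AE \<omega> in M.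
             norm (Dw \<phi> \<eta> \<omega>) \<le> C2 * norm \<eta> \<and>
             norm (Dw \<phi> \<eta> \<omega> - Dw \<psi> \<eta> \<omega>) \<le> C2 * norm (w \<phi> \<omega> - w \<psi> \<omega>) powr \<gamma> * norm \<eta>))))"
proof -
  \<comment> \<open>the bound for the resolvents: 2 stems from the contraction factor \<open>1/2\<close>, and \<open>norm_ratio T C0\<close> bounds the multiplier \<open>decay\<close> from below\<close>
  define a where "a = 2 / norm_ratio T C0"
  define C2 where "C2 = max a (a\<^sup>2 * (sqrt T * C0))"
  have "0 < a" by (simp add: a_def norm_ratio_def)
  then have C2: "0 < C2" by (simp add: C2_def)
  show ?thesis
  proof (intro exI[of _ C2] conjI C2 allI impI, elim conjE)
    fix M :: "'w measure" and F and W :: "real \<Rightarrow> 'w \<Rightarrow> real^'d" and \<alpha> \<gamma> :: real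
      and B :: "(real, real^'d) L2 \<Rightarrow> (real \<times> real, real^'d) L2" and J s t
    assume M: "filtered_prob_space T M F" and \<gamma>: "0 < \<gamma>" and B: "smooth_volterra_drift T C0 \<gamma> B"
      and J: "\<forall>s t. 0 \<le> s \<and> s \<le> t \<and> t \<le> T \<longrightarrow> is_stoch_integral M W (H_space T) s t (sigma_op T \<alpha>) (J s t)"
      and st: "0 \<le> s" "s \<le> t" "t \<le> T"
    interpret smooth_drift T C0 \<gamma> B
      by (rule smooth_drift.intro[OF assms \<gamma> B])
    interpret smooth_drift_noise T C0 \<gamma> B M "J s t" s t
    proof (intro smooth_drift_noise.intro smooth_drift_noise_axioms.intro smooth_drift_axioms st)
      show "prob_space M" using M by (simp add: filtered_prob_space_def)
      show "J s t \<in> rv_L2 M (H_space T)" using J st by (simp add: is_stoch_integral_def)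
    qed
    show "let w = solution T B M (J s t) s t in
        C1_Hoelder \<gamma> M (H_space T) w \<and>
        (\<forall>Dw. (\<forall>\<phi>\<in>H_space T. has_frechet_differential M (H_space T) w (Dw \<phi>) \<phi>) \<longrightarrow>
          (\<forall>\<phi>\<in>H_space T. \<forall>\<psi>\<in>H_space T.
             is_linearised_solution T B M (w \<phi>) s t \<psi> (Dw \<phi> \<psi>) \<and>
             (\<forall>v. is_linearised_solution T B M (w \<phi>) s t \<psi> v \<longrightarrow> (AE \<omega> in M. v \<omega> = Dw \<phi> \<psi> \<omega>))) \<and>
          (\<forall>\<phi>\<in>H_space T. \<forall>\<psi>\<in>H_space T. \<forall>\<eta>\<in>H_space T. AE \<omega> in M.
             norm (Dw \<phi> \<eta> \<omega>) \<le> C2 * norm \<eta> \<and>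
             norm (Dw \<phi> \<eta> \<omega> - Dw \<psi> \<eta> \<omega>) \<le> C2 * norm (w \<phi> \<omega> - w \<psi> \<omega>) powr \<gamma> * norm \<eta>))"
      unfolding Let_def
    proof (intro conjI allI impI ballI)
      show "C1_Hoelder \<gamma> M H w" by (rule C1_Hoelder_solution)
      fix Dw assume "\<forall>\<phi>\<in>H. has_frechet_differential M H w (Dw \<phi>) \<phi>"
      then have Dw: "has_frechet_differential M H w (Dw \<phi>) \<phi>" if "\<phi> \<in> H" for \<phi> using that by blast
      fix \<phi> \<psi> assume \<phi>: "\<phi> \<in> H" and \<psi>: "\<psi> \<in> H"
      show "is_linearised_solution T B M (w \<phi>) s t \<psi> (Dw \<phi> \<psi>)"
        by (rule differential_solves(1)[OF Dw[OF \<phi>] \<phi> \<psi>])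
      show "AE \<omega> in M. v \<omega> = Dw \<phi> \<psi> \<omega>" if "is_linearised_solution T B M (w \<phi>) s t \<psi> v" for v
        by (rule differential_solves(2)[OF Dw[OF \<phi>] \<phi> \<psi> that])
      fix \<eta> assume \<eta>: "\<eta> \<in> H"
      have le: "a \<le> C2" "a\<^sup>2 * modulus \<le> C2" by (simp_all add: C2_def modulus_def)
      show "AE \<omega> in M. norm (Dw \<phi> \<eta> \<omega>) \<le> C2 * norm \<eta> \<and>
          norm (Dw \<phi> \<eta> \<omega> - Dw \<psi> \<eta> \<omega>) \<le> C2 * norm (w \<phi> \<omega> - w \<psi> \<omega>) powr \<gamma> * norm \<eta>"
        using differential_bounds[OF Dw[OF \<phi>] Dw[OF \<psi>] \<phi> \<psi> \<eta>]
      proof eventually_elim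
        case (elim \<omega>)
        have "norm (Dw \<phi> \<eta> \<omega>) \<le> a * norm \<eta>"
          "norm (Dw \<phi> \<eta> \<omega> - Dw \<psi> \<eta> \<omega>) \<le> a\<^sup>2 * modulus * norm (w \<phi> \<omega> - w \<psi> \<omega>) powr \<gamma> * norm \<eta>"
          using elim by (simp_all add: a_def)
        then show ?case
          by (intro conjI; elim order_trans) (intro mult_right_mono le; simp)+
      qed
    qed
  qed
qed

end
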